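(* Let $\mathcal D$ be a filtered $\varphi$-module with pairwise distinct Hodge–Tate weights and with $\varphi$ diagonalizable over $\mathbb Q_p$. Let $\mathcal F_\bullet$ be a refinement of $\mathcal D$, $\mathcal B=(v_1,\dots,v_d)$ a basis adapted to the filtration with $\mathcal F_i=\langle v_1,\dots,v_i\rangle$, and $\mathcal B_0=(e_1,\dots,e_d)$ a basis of eigenvectors, $\varphi e_i=\alpha_ie_i$, with $\mathcal F_i=\langle e_1,\dots,e_i\rangle$, such that the matrix $P=(\lambda_{i,j})$ of $\mathcal B$ in $\mathcal B_0$ is upper triangular unipotent. Let $J$ be a finite interval of $\mathbb Z$ containing $]t_{HT,1},t_{HT,d}]$ with $|J|>\max_{1\le i\le j\le d}\mathrm{ord}_p(\alpha_j/\alpha_i)$, and $N\ge0$. Then the sequence $Z_n$ converges to an endomorphism $Z_\infty$ whose matrix in $\mathcal B_0$ has entries that are polynomials of total degree $\le d-1$ in the $\lambda_{i,j}$ ($i<j$), with coefficients in $\mathcal H$ depending only on $N$, $J$, the $\alpha_i$ and the $t_{HT,i}$. The slope of the $\Lambda_{\mathbb Q_p}$-module generated by $Z_\infty(\mathcal D)$ is at most $\tilde\beta(|J|)+\max_{1\le i\le k\le d}(\mathrm{ord}_p(\alpha_k)-t_{HT,i})$.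
   Context: Let $p$ be an odd prime, $u$ a topological generator of $1+p\mathbb Z_p$, $\Lambda_{\mathbb Q_p}=\mathbb Q_p\otimes\mathbb Z_p[[x]]$. $\mathcal H$ is the ring of power series in $\mathbb Q_p[[x]]$ converging on the open unit disc of $\mathbb C_p$, $\|f\|_\rho=\sup_{|z|_p\le\rho}|f(z)|_p$, with its Fréchet topology. For $f\in\mathbb Q_p[[x]]$, $f^{(j)}(x)=f(u^{-j}(1+x)-1)$; $\omega_n=(1+x)^{p^n}-1$, $\xi_n=\omega_n/\omega_{n-1}$ ($n\ge1$), $\xi_0=px$; $\ell_n^S=\prod_{j\in S}\xi_n^{(j)}/p$. For a finite interval $J$, a subinterval $J'\subseteq J$ and $n\ge1$, $\tilde\xi_n^{J'\subset J}$ is the unique polynomial of degree $<((p-1)|J'|+|J|)p^{n-1}$ with $\tilde\xi_n^{J'\subset J}\equiv\xi_n^{(j)}/p\pmod{\omega_n^{(j)}}$ ($j\in J'$), $\equiv1\pmod{\omega_{n-1}^{(j)}}$ ($j\in J\setminus J'$); $\tilde\xi_0^{J'\subset J}=\ell_0^{J'}$; $\tilde\beta(s)=\lfloor(s-1)/(p-1)\rfloor$. A filtered $\varphi$-module $\mathcal D$ ($\dim d$, bijective linear $\varphi$, decreasing exhaustive separated filtration) has Hodge–Tate weights $t_{HT,1}\le\dots\le t_{HT,d}$ ($i$ with $\mathrm{Fil}^i\ne\mathrm{Fil}^{i+1}$, multiplicity $\dim\mathrm{Fil}^i/\mathrm{Fil}^{i+1}$); $]a,b]=\{j\in\mathbb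 Z:a<j\le b\}$; $\mathcal B$ is adapted to the filtration if $v_i\in\mathrm{Fil}^{t_{HT,i}}\mathcal D$. A refinement is a complete flag $\mathcal F_1\subset\dots\subset\mathcal F_d=\mathcal D$ ($\dim\mathcal F_i=i$) of $\varphi$-stable subspaces with $\mathcal F_i\cap\mathrm{Fil}^{t_{HT,i}}\mathcal D\ne0$ and $\mathcal F_i\cap\mathrm{Fil}^{t_{HT,i}+1}\mathcal D=0$ for all $i$. $T_n$ is the $\mathcal H$-linear endomorphism of $\mathcal H\otimes\mathcal D$ with $T_n(v_i)=\tilde\xi_n^{]t_{HT,i},t_{HT,d}]\subset J}v_i$; $Z_{N-1}=\mathrm{Id}$ and $Z_n=(1\otimes\varphi)^{n+1}T_n(1\otimes\varphi)^{-(n+1)}Z_{n-1}$ for $n\ge N$. Fix a basis $(b_k)$ of $\mathcal D$, $\|\sum g_k\otimes b_k\|_\rho=\max\|g_k\|_\rho$; $g\in\mathcal H\otimes\mathcal D$ has slope $\le t$ if for some $\rho\in(0,1)$, $\sup_np^{-(t+t_{HT,d})n}\|(1\otimes\varphi)^{-n}g\|_{\rho^{1/p^n}}<\infty$; slope of $g$ = infimum of such $t$; slope of a $\Lambda_{\mathbb Q_p}$-submodule = smallest $t$ bounding the slopes of all its elements. *)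

theory Defs
  imports Complex_Main "HOL-Library.Extended_Real"
    "HOL-Computational_Algebra.Polynomial" "HOL-Computational_Algebra.Factorial_Ring"
begin

text \<open>Q_p is represented by an arbitrary field of characteristic 0 with an absolute value
 nk satisfying the axioms below; these characterise (Q_p, |.|_p) up to unique isometric
 isomorphism (complete non-archimedean field containing Q densely, with the p-adic
 absolute value on the integers).\<close>

definition is_Qp :: "nat \<Rightarrow> ('k::field_char_0 \<Rightarrow> real) \<Rightarrow> bool" where
  "is_Qp p nk \<longleftrightarrow>
     (\<forall>x. nk x \<ge> 0) \<and> (\<forall>x. nk x = 0 \<longleftrightarrow> x = 0) \<and>
     (\<forall>x y. nk (x * y) = nk x * nk y) \<and>
     (\<forall>x y. nk (x + y) \<le> max (nk x) (nk y)) \<and>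
     (\<forall>n::int. n \<noteq> 0 \<longrightarrow> nk (of_int n) = real p powr (- real (multiplicity (int p) n))) \<and>
     (\<forall>X::nat \<Rightarrow> 'k. (\<forall>\<epsilon>>0. \<exists>M. \<forall>m\<ge>M. \<forall>n\<ge>M. nk (X m - X n) < \<epsilon>)
          \<longrightarrow> (\<exists>L. \<forall>\<epsilon>>0. \<exists>M. \<forall>n\<ge>M. nk (X n - L) < \<epsilon>)) \<and>
     (\<forall>x \<epsilon>. \<epsilon> > 0 \<longrightarrow> (\<exists>q::rat. nk (x - of_rat q) < \<epsilon>))"

definition top_gen :: "nat \<Rightarrow> ('k::field_char_0 \<Rightarrow> real) \<Rightarrow> 'k \<Rightarrow> bool" where
  "top_gen p nk u \<longleftrightarrow> nk (u - 1) \<le> 1 / real p \<and>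
     (\<forall>x. nk (x - 1) \<le> 1 / real p \<longrightarrow> (\<forall>\<epsilon>>0. \<exists>n::int. nk (u powi n - x) < \<epsilon>))"

definition ordp :: "nat \<Rightarrow> ('k \<Rightarrow> real) \<Rightarrow> 'k \<Rightarrow> real" where
  "ordp p nk x = - log (real p) (nk x)"

type_synonym 'k ser = "nat \<Rightarrow> 'k"

text \<open>sup norm on the closed disc of radius rho (Gauss norm formula)\<close>
definition gnorm :: "('k \<Rightarrow> real) \<Rightarrow> real \<Rightarrow> 'k ser \<Rightarrow> ereal" where
  "gnorm nk \<rho> f = (SUP n. ereal (nk (f n) * \<rho> ^ n))"

text \<open>convergence on the open unit disc of C_p\<close>
definition inH :: "('k \<Rightarrow> real) \<Rightarrow> 'k ser \<Rightarrow> bool" where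
  "inH nk f \<longleftrightarrow> (\<forall>r. 0 < r \<and> r < 1 \<longrightarrow> (\<lambda>n. nk (f n) * r ^ n) \<longlonglongrightarrow> 0)"

text \<open>Lambda_{Q_p} = Q_p tensor Z_p[[x]]\<close>
definition inLam :: "('k::field \<Rightarrow> real) \<Rightarrow> 'k ser \<Rightarrow> bool" where
  "inLam nk f \<longleftrightarrow> (\<exists>c. c \<noteq> 0 \<and> (\<forall>n. nk (c * f n) \<le> 1))"

definition cprod :: "'k::comm_ring_1 ser \<Rightarrow> 'k ser \<Rightarrow> 'k ser" where
  "cprod f g n = (\<Sum>k\<le>n. f k * g (n - k))"

definition twist :: "'k::field \<Rightarrow> int \<Rightarrow> 'k poly \<Rightarrow> 'k poly" where
  "twist u j f = pcompose f [: u powi (- j) - 1, u powi (- j) :]"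

definition omega :: "nat \<Rightarrow> nat \<Rightarrow> 'k::field poly" where
  "omega p n = [:1, 1:] ^ (p ^ n) - 1"

definition xi :: "nat \<Rightarrow> nat \<Rightarrow> 'k::field poly" where
  "xi p n = (if n = 0 then [:0, of_nat p:] else omega p n div omega p (n - 1))"

definition ell0 :: "nat \<Rightarrow> 'k::field \<Rightarrow> int set \<Rightarrow> 'k poly" where
  "ell0 p u S = (\<Prod>j\<in>S. smult (1 / of_nat p) (twist u j (xi p 0)))"

definition xit :: "nat \<Rightarrow> 'k::field \<Rightarrow> nat \<Rightarrow> int set \<Rightarrow> int set \<Rightarrow> 'k poly" where
  "xit p u n J' J = (if n = 0 then ell0 p u J' else
     (THE f. degree f < ((p - 1) * card J' + card J) * p ^ (n - 1) \<and>
        (\<forall>j\<in>J'. f mod twist u j (omega p n) =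
                  smult (1 / of_nat p) (twist u j (xi p n)) mod twist u j (omega p n)) \<and>
        (\<forall>j\<in>J - J'. f mod twist u j (omega p (n - 1)) = 1 mod twist u j (omega p (n - 1)))))"

definition mmul :: "nat \<Rightarrow> (nat \<Rightarrow> nat \<Rightarrow> 'a::comm_ring_1) \<Rightarrow> (nat \<Rightarrow> nat \<Rightarrow> 'a) \<Rightarrow> nat \<Rightarrow> nat \<Rightarrow> 'a" where
  "mmul d A B i j = (\<Sum>k<d. A i k * B k j)"

definition mid :: "nat \<Rightarrow> nat \<Rightarrow> 'a::comm_ring_1" where
  "mid i j = (if i = j then 1 else 0)"

definition meq :: "nat \<Rightarrow> (nat \<Rightarrow> nat \<Rightarrow> 'a) \<Rightarrow> (nat \<Rightarrow> nat \<Rightarrow> 'a) \<Rightarrow> bool" where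
  "meq d A B \<longleftrightarrow> (\<forall>i<d. \<forall>j<d. A i j = B i j)"

definition minv :: "nat \<Rightarrow> (nat \<Rightarrow> nat \<Rightarrow> 'a::comm_ring_1) \<Rightarrow> nat \<Rightarrow> nat \<Rightarrow> 'a" where
  "minv d A = (SOME B. meq d (mmul d A B) mid \<and> meq d (mmul d B A) mid)"

definition minvertible :: "nat \<Rightarrow> (nat \<Rightarrow> nat \<Rightarrow> 'a::comm_ring_1) \<Rightarrow> bool" where
  "minvertible d A \<longleftrightarrow> (\<exists>B. meq d (mmul d A B) mid \<and> meq d (mmul d B A) mid)"

primrec mpow :: "nat \<Rightarrow> (nat \<Rightarrow> nat \<Rightarrow> 'a::comm_ring_1) \<Rightarrow> nat \<Rightarrow> nat \<Rightarrow> nat \<Rightarrow> 'a" where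
  "mpow d A 0 = mid"
| "mpow d A (Suc n) = mmul d A (mpow d A n)"

definition mconst :: "(nat \<Rightarrow> nat \<Rightarrow> 'k) \<Rightarrow> nat \<Rightarrow> nat \<Rightarrow> 'k::zero poly" where
  "mconst A i j = [: A i j :]"

text \<open>D is modelled as k^d with its standard basis (b_k).\<close>
definition Dsp :: "nat \<Rightarrow> (nat \<Rightarrow> 'k::zero) set" where
  "Dsp d = {w. \<forall>i\<ge>d. w i = 0}"

definition mapply :: "nat \<Rightarrow> (nat \<Rightarrow> nat \<Rightarrow> 'k::comm_ring_1) \<Rightarrow> (nat \<Rightarrow> 'k) \<Rightarrow> nat \<Rightarrow> 'k" where
  "mapply d A w a = (if a < d then (\<Sum>b<d. A a b * w b) else 0)"

definition spanv :: "(nat \<Rightarrow> nat \<Rightarrow> 'k::comm_ring_1) \<Rightarrow> nat \<Rightarrow> (nat \<Rightarrow> 'k) set" where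
  "spanv vs k = {w. \<exists>c. w = (\<lambda>a. \<Sum>i<k. c i * vs i a)}"

definition lin_indep :: "(nat \<Rightarrow> nat \<Rightarrow> 'k::comm_ring_1) \<Rightarrow> nat \<Rightarrow> bool" where
  "lin_indep vs k \<longleftrightarrow> (\<forall>c. (\<lambda>a. \<Sum>i<k. c i * vs i a) = (\<lambda>a. 0) \<longrightarrow> (\<forall>i<k. c i = 0))"

definition is_basis :: "nat \<Rightarrow> (nat \<Rightarrow> nat \<Rightarrow> 'k::comm_ring_1) \<Rightarrow> bool" where
  "is_basis d vs \<longleftrightarrow> (\<forall>i<d. vs i \<in> Dsp d) \<and> lin_indep vs d \<and> spanv vs d = Dsp d"

definition subspace_of :: "nat \<Rightarrow> (nat \<Rightarrow> 'k::comm_ring_1) set \<Rightarrow> bool" where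
  "subspace_of d S \<longleftrightarrow> S \<subseteq> Dsp d \<and> (\<lambda>a. 0) \<in> S \<and>
     (\<forall>x\<in>S. \<forall>y\<in>S. (\<lambda>a. x a + y a) \<in> S) \<and> (\<forall>c. \<forall>x\<in>S. (\<lambda>a. c * x a) \<in> S)"

definition sdim :: "(nat \<Rightarrow> 'k::comm_ring_1) set \<Rightarrow> nat" where
  "sdim S = (GREATEST k. \<exists>vs. (\<forall>i<k. vs i \<in> S) \<and> lin_indep vs k)"

definition filtration :: "nat \<Rightarrow> (int \<Rightarrow> (nat \<Rightarrow> 'k::comm_ring_1) set) \<Rightarrow> bool" where
  "filtration d Fil \<longleftrightarrow> (\<forall>i. subspace_of d (Fil i)) \<and> (\<forall>i. Fil (i + 1) \<subseteq> Fil i) \<and>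
     (\<Union>i. Fil i) = Dsp d \<and> (\<Inter>i. Fil i) = {\<lambda>a. 0}"

definition distinct_HT_weights :: "nat \<Rightarrow> (int \<Rightarrow> (nat \<Rightarrow> 'k::comm_ring_1) set) \<Rightarrow> (nat \<Rightarrow> int) \<Rightarrow> bool" where
  "distinct_HT_weights d Fil t \<longleftrightarrow> (\<forall>i j. i < j \<and> j < d \<longrightarrow> t i < t j) \<and>
     (\<forall>i. sdim (Fil i) - sdim (Fil (i + 1)) = (if i \<in> t ` {..<d} then 1 else 0))"

text \<open>refinement, indexed F 1, ..., F d (HT weights are t 0, ..., t (d-1))\<close>
definition refinement :: "nat \<Rightarrow> (nat \<Rightarrow> nat \<Rightarrow> 'k::comm_ring_1) \<Rightarrow> (int \<Rightarrow> (nat \<Rightarrow> 'k) set) \<Rightarrow>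
    (nat \<Rightarrow> int) \<Rightarrow> (nat \<Rightarrow> (nat \<Rightarrow> 'k) set) \<Rightarrow> bool" where
  "refinement d Phi Fil t F \<longleftrightarrow> (\<forall>i\<in>{1..d}.
      subspace_of d (F i) \<and> sdim (F i) = i \<and> (\<forall>w\<in>F i. mapply d Phi w \<in> F i) \<and>
      F i \<inter> Fil (t (i - 1)) \<noteq> {\<lambda>a. 0} \<and> F i \<inter> Fil (t (i - 1) + 1) = {\<lambda>a. 0}) \<and>
     (\<forall>i. 1 \<le> i \<and> i < d \<longrightarrow> F i \<subseteq> F (i + 1)) \<and> F d = Dsp d"

text \<open>matrix of T_n in the standard basis; V i = v_i (columns), so
  T_n = V diag(tilde xi^{]t_i, t_d] in J}_n) V^{-1}\<close>
definition Tmat :: "nat \<Rightarrow> 'k::field \<Rightarrow> nat \<Rightarrow> int set \<Rightarrow> (nat \<Rightarrow> int) \<Rightarrow> (nat \<Rightarrow> nat \<Rightarrow> 'k) \<Rightarrow>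
    nat \<Rightarrow> nat \<Rightarrow> nat \<Rightarrow> 'k poly" where
  "Tmat p u d J t v n a b =
     (\<Sum>i<d. [: v i a :] * xit p u n {t i<..t (d - 1)} J * [: minv d (\<lambda>x y. v y x) i b :])"

text \<open>Zs m = Z_{N-1+m}: Zs 0 = Id, Z_n = phi^{n+1} T_n phi^{-(n+1)} Z_{n-1}\<close>
primrec Zs :: "nat \<Rightarrow> 'k::field \<Rightarrow> nat \<Rightarrow> int set \<Rightarrow> (nat \<Rightarrow> int) \<Rightarrow> (nat \<Rightarrow> nat \<Rightarrow> 'k) \<Rightarrow>
    (nat \<Rightarrow> nat \<Rightarrow> 'k) \<Rightarrow> nat \<Rightarrow> nat \<Rightarrow> nat \<Rightarrow> nat \<Rightarrow> 'k poly" where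
  "Zs p u d J t Phi v N 0 = mid"
| "Zs p u d J t Phi v N (Suc m) =
     mmul d (mmul d (mmul d (mconst (mpow d Phi (N + m + 1))) (Tmat p u d J t v (N + m)))
        (mconst (mpow d (minv d Phi) (N + m + 1)))) (Zs p u d J t Phi v N m)"

text \<open>elements of H tensor D: coordinate vectors (g a) a<d w.r.t. the standard basis\<close>
definition vnorm :: "('k \<Rightarrow> real) \<Rightarrow> nat \<Rightarrow> real \<Rightarrow> (nat \<Rightarrow> 'k ser) \<Rightarrow> ereal" where
  "vnorm nk d \<rho> g = Max ((\<lambda>a. gnorm nk \<rho> (g a)) ` {..<d})"

definition sapply :: "nat \<Rightarrow> (nat \<Rightarrow> nat \<Rightarrow> 'k::comm_ring_1) \<Rightarrow> (nat \<Rightarrow> 'k ser) \<Rightarrow> nat \<Rightarrow> 'k ser" where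
  "sapply d A g a = (\<lambda>k. \<Sum>b<d. A a b * g b k)"

definition has_slope_le :: "nat \<Rightarrow> ('k::field \<Rightarrow> real) \<Rightarrow> nat \<Rightarrow> (nat \<Rightarrow> nat \<Rightarrow> 'k) \<Rightarrow> int \<Rightarrow>
    (nat \<Rightarrow> 'k ser) \<Rightarrow> real \<Rightarrow> bool" where
  "has_slope_le p nk d Phi td g s \<longleftrightarrow> (\<exists>\<rho>. 0 < \<rho> \<and> \<rho> < 1 \<and>
     (SUP n. ereal (real p powr (- (s + real_of_int td) * real n)) *
        vnorm nk d (\<rho> powr (1 / real p ^ n)) (sapply d (mpow d (minv d Phi) n) g)) < \<infinity>)"

definition slope_el :: "nat \<Rightarrow> ('k::field \<Rightarrow> real) \<Rightarrow> nat \<Rightarrow> (nat \<Rightarrow> nat \<Rightarrow> 'k) \<Rightarrow> int \<Rightarrow>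
    (nat \<Rightarrow> 'k ser) \<Rightarrow> ereal" where
  "slope_el p nk d Phi td g = Inf (ereal ` {s. has_slope_le p nk d Phi td g s})"

definition gen_mod :: "('k::field \<Rightarrow> real) \<Rightarrow> nat \<Rightarrow> (nat \<Rightarrow> nat \<Rightarrow> 'k ser) \<Rightarrow> (nat \<Rightarrow> 'k ser) set" where
  "gen_mod nk d Z = {g. \<exists>(r::nat) (lam::nat \<Rightarrow> 'k ser) (w::nat \<Rightarrow> nat \<Rightarrow> 'k). (\<forall>i<r. inLam nk (lam i) \<and> w i \<in> Dsp d) \<and>
      (\<forall>a<d. g a = (\<lambda>k. \<Sum>i<r. cprod (lam i) (\<lambda>n. \<Sum>b<d. Z a b n * w i b) k))}"

definition slope_mod :: "nat \<Rightarrow> ('k::field \<Rightarrow> real) \<Rightarrow> nat \<Rightarrow> (nat \<Rightarrow> nat \<Rightarrow> 'k) \<Rightarrow> int \<Rightarrow>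
    (nat \<Rightarrow> 'k ser) set \<Rightarrow> ereal" where
  "slope_mod p nk d Phi td M = (SUP g\<in>M. slope_el p nk d Phi td g)"

definition monoms :: "nat \<Rightarrow> nat \<Rightarrow> (nat \<times> nat \<Rightarrow> nat) set" where
  "monoms d k = {m. (\<forall>ij. m ij \<noteq> 0 \<longrightarrow> fst ij < snd ij \<and> snd ij < d) \<and>
                   (\<Sum>ij\<in>{..<d} \<times> {..<d}. m ij) \<le> k}"

definition mono_eval :: "nat \<Rightarrow> (nat \<Rightarrow> nat \<Rightarrow> 'k::comm_ring_1) \<Rightarrow> (nat \<times> nat \<Rightarrow> nat) \<Rightarrow> 'k" where
  "mono_eval d lam m = (\<Prod>ij\<in>{..<d} \<times> {..<d}. lam (fst ij) (snd ij) ^ m ij)"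

end

theory Submission
  imports Defs
begin

text \<open>
Put \<open>h = |J|\<close> and \<open>y = (1 + x) ^ (p ^ (n - 1))\<close>. All the moduli defining \<open>xit\<close> at level \<open>n\<close> are polynomials in \<open>y\<close> of
bounded degree: with \<open>a\<^sub>j = u ^ (j * p ^ (n - 1))\<close> they are, up to units, \<open>y - a\<^sub>j\<close> and \<open>y ^ p - a\<^sub>j ^ p\<close>. Hence \<open>xit\<close> is
\<open>1 + B Q\<close> evaluated at \<open>y\<close>, where \<open>B\<close> is the product over \<open>J\<close> of the \<open>y - a\<^sub>j\<close> and \<open>Q = - 1 / B\<close> modulo the product over \<open>J'\<close>
of the cyclotomic factors. The sharp bound \<open>p ^ (|J'| + (h - 1) div (p - 1))\<close> for the Gauss norm of \<open>Q\<close> comes from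
grouping the linear factors \<open>p - 1\<close> at a time: a cyclotomic factor minus such a group is \<open>p\<close> times a unit
of the local ring at \<open>(p, y - 1)\<close>, so that \<open>|J'|\<close> cyclotomic factors and \<open>e\<close> groups generate an ideal containing
\<open>p ^ (|J'| + e - 1)\<close>. Since \<open>B\<close> is divisible by the \<open>h\<close> twists of \<open>\<omega>\<^sub>n\<^sub>-\<^sub>1\<close>, moreover \<open>xit - 1 = O (p ^ (- h n))\<close> on every
disc of radius less than \<open>1\<close>, which beats the factors \<open>(\<alpha>\<^sub>i / \<alpha>\<^sub>j) ^ n\<close> coming from the conjugation by \<open>\<phi> ^ n\<close> as soon
as \<open>h > ord\<^sub>p (\<alpha>\<^sub>j / \<alpha>\<^sub>i)\<close>. In the eigenbasis everything is upper triangular and the entry \<open>(i, j)\<close> has degree at most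
\<open>j - i\<close> in the \<open>\<lambda>\<close>'s. For the slope one splits the product of the \<open>T\<^sub>q\<close> at \<open>q = n\<close>: the first factors are estimated by
their Gauss norms, the others are uniformly close to the identity at radius \<open>\<rho> ^ (1 / p ^ n)\<close>.
\<close>

section \<open>Gauss norms\<close>

text \<open>The slope tolerates no recurring constant: a factor \<open>C\<close> lost at each of the
  first n steps would become \<open>C ^ n\<close>. This shapes three estimates. The norm of
  \<open>xit\<close> enters with its precise exponent, in which \<open>card J'\<close> is t_d - t_i
  and \<open>(h - 1) div (p - 1)\<close> is the term coming from \<open>card J\<close>; divided by
  the norm of an eigenvalue it stays below p to the power slope plus t_d. The entries of the base
  change may cost a constant only off the diagonal, where triangularity allows at most d - 1
  occurrences in a product. The factors beyond q = n may cost a constant only in a number of steps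
  that does not depend on n.

  That the coefficients are independent of the \<lambda>'s is not read off from the limit but built
  in: the entries are expanded in monomials, the recursion for Z_n becomes a linear recursion for
  the coefficients in which \<lambda> no longer occurs, and it is this recursion that is shown to
  converge. As the absolute value is ultrametric, increments tending to 0 are enough for that, and
  bounds pass to the limit unchanged.\<close>

locale padic =
  fixes p :: nat and nk :: "'k::field_char_0 \<Rightarrow> real"
  assumes Qp: "is_Qp p nk" and pprime: "prime p" and podd: "odd p"
begin

section \<open>The ultrametric absolute value of the field and its values on integers\<close>

lemma p_ge3: "p \<ge> 3"
  using prime_ge_2_nat[OF pprime] podd by (cases "p = 2") auto

lemma p_gt1: "real p > 1" and p_pos: "real p > 0" and p_nz: "real p \<noteq> 0"
  using p_ge3 by auto

lemma nk_nonneg [simp]: "nk x \<ge> 0"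
  and nk_eq0 [simp]: "nk x = 0 \<longleftrightarrow> x = 0"
  and nk_mult: "nk (x * y) = nk x * nk y"
  and nk_add: "nk (x + y) \<le> max (nk x) (nk y)"
  and nk_int: "n \<noteq> 0 \<Longrightarrow> nk (of_int n) = real p powr (- real (multiplicity (int p) n))"
  using Qp unfolding is_Qp_def by blast+

lemma nk_complete:
  assumes "\<And>\<epsilon>. \<epsilon> > 0 \<Longrightarrow> \<exists>M. \<forall>m\<ge>M. \<forall>n\<ge>M. nk (X m - X n) < \<epsilon>"
  shows "\<exists>L. \<forall>\<epsilon>>0. \<exists>M::nat. \<forall>n\<ge>M. nk (X n - L) < \<epsilon>"
  using Qp assms unfolding is_Qp_def by blast

lemma nk_0 [simp]: "nk 0 = 0" by simp

lemma nk_pos: "x \<noteq> 0 \<Longrightarrow> nk x > 0"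
  using nk_nonneg[of x] nk_eq0[of x] by linarith

lemma nk_1 [simp]: "nk 1 = 1"
  using nk_mult[of 1 1] nk_pos[of 1] by simp

lemma nk_minus [simp]: "nk (- x) = nk x"
proof -
  have "nk (-1) * nk (-1) = 1" using nk_mult[of "-1" "-1"] by simp
  then have "nk (-1) = 1" using nk_nonneg[of "-1"] by (metis abs_of_nonneg real_sqrt_abs2 real_sqrt_one)
  then show ?thesis using nk_mult[of "-1" x] by simp
qed

lemma nk_diff: "nk (x - y) \<le> max (nk x) (nk y)"
  using nk_add[of x "- y"] by simp

lemma nk_add_le: "nk x \<le> M \<Longrightarrow> nk y \<le> M \<Longrightarrow> nk (x + y) \<le> M"
  using nk_add[of x y] by simp

lemma nk_diff_le: "nk x \<le> M \<Longrightarrow> nk y \<le> M \<Longrightarrow> nk (x - y) \<le> M"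
  using nk_diff[of x y] by simp

lemma nk_diff_commute: "nk (x - y) = nk (y - x)"
  using nk_minus[of "x - y"] by simp

lemma nk_power: "nk (x ^ n) = nk x ^ n"
  by (induction n) (auto simp: nk_mult)

lemma nk_inverse: "nk (inverse x) = inverse (nk x)"
proof (cases "x = 0")
  case False
  then have "nk x * nk (inverse x) = 1" using nk_mult[of x "inverse x"] by simp
  then show ?thesis by (metis inverse_unique)
qed simp

lemma nk_divide: "nk (x / y) = nk x / nk y"
  by (simp add: divide_inverse nk_mult nk_inverse)

lemma nk_prod: "nk (prod f A) = (\<Prod>i\<in>A. nk (f i))"
  by (induction A rule: infinite_finite_induct) (auto simp: nk_mult)

lemma nk_sum:
  assumes "\<And>i. i \<in> A \<Longrightarrow> nk (f i) \<le> M" "0 \<le> M"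
  shows "nk (sum f A) \<le> M"
  using assms
proof (induction A rule: infinite_finite_induct)
  case (insert x F)
  then show ?case using nk_add[of "f x" "sum f F"] by (auto simp: max_def split: if_splits intro: order_trans)
qed auto

lemma nk_of_nat_le1: "nk (of_nat n) \<le> 1"
proof (induction n)
  case (Suc n)
  then show ?case using nk_add[of 1 "of_nat n"] by simp
qed simp

lemma nk_p: "nk (of_nat p) = 1 / real p"
proof -
  have "multiplicity (int p) (int p) = 1"
    by (rule multiplicity_self) (use pprime p_ge3 in \<open>auto simp: prime_gt_1_int dest: prime_gt_1_nat\<close>)
  then show ?thesis
    using nk_int[of "int p"] p_pos by (simp add: powr_minus divide_inverse)
qed

lemma nk_dvd: "p dvd n \<Longrightarrow> nk (of_nat n) \<le> 1 / real p"
  using nk_of_nat_le1 by (auto elim!: dvdE simp: nk_mult nk_p mult_le_cancel_left divide_right_mono)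

text \<open>The Gauss norm at radius r is at most M. Stating bounds instead of computing the
  \<open>ereal\<close> supremum keeps the estimates in real arithmetic, and the same notion serves
  power series and, through \<open>coeff\<close>, polynomials.\<close>

definition bd :: "real \<Rightarrow> real \<Rightarrow> 'k ser \<Rightarrow> bool" where
  "bd r M f \<longleftrightarrow> (\<forall>n. nk (f n) * r ^ n \<le> M)"

abbreviation pbd :: "real \<Rightarrow> real \<Rightarrow> 'k poly \<Rightarrow> bool" where
  "pbd r M f \<equiv> bd r M (coeff f)"

lemma gnorm_le_iff: "gnorm nk r f \<le> ereal M \<longleftrightarrow> bd r M f"
  unfolding gnorm_def bd_def by (simp add: SUP_le_iff)

lemma gnorm_nonneg: "gnorm nk r f \<ge> 0"
proof -
  have "ereal (nk (f 0) * r ^ 0) \<le> gnorm nk r f"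
    unfolding gnorm_def by (rule SUP_upper) simp
  then show ?thesis by (metis mult_1_right nk_nonneg power_0 ereal_less_eq(5) order_trans)
qed

lemma gnorm_tendsto_0_iff:
  "((\<lambda>m. gnorm nk r (F m)) \<longlonglongrightarrow> 0) \<longleftrightarrow> (\<forall>\<epsilon>>0. \<exists>M. \<forall>m\<ge>M. bd r \<epsilon> (F m))"
proof
  assume L: "(\<lambda>m. gnorm nk r (F m)) \<longlonglongrightarrow> 0"
  show "\<forall>\<epsilon>>0. \<exists>M. \<forall>m\<ge>M. bd r \<epsilon> (F m)"
  proof (intro allI impI)
    fix \<epsilon> :: real assume "\<epsilon> > 0"
    then have "eventually (\<lambda>m. gnorm nk r (F m) < ereal \<epsilon>) sequentially"
      using order_tendstoD(2)[OF L, of "ereal \<epsilon>"] by simp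
    then show "\<exists>M. \<forall>m\<ge>M. bd r \<epsilon> (F m)"
      unfolding eventually_sequentially using gnorm_le_iff less_imp_le by blast
  qed
next
  assume R: "\<forall>\<epsilon>>0. \<exists>M. \<forall>m\<ge>M. bd r \<epsilon> (F m)"
  show "(\<lambda>m. gnorm nk r (F m)) \<longlonglongrightarrow> 0"
  proof (rule order_tendstoI)
    fix a :: ereal assume "a < 0"
    then show "\<forall>\<^sub>F m in sequentially. a < gnorm nk r (F m)"
      using gnorm_nonneg less_le_trans by (intro always_eventually) blast
  next
    fix a :: ereal assume "0 < a"
    then obtain \<epsilon> where e: "0 < ereal \<epsilon>" "ereal \<epsilon> < a" by (metis ereal_dense2 less_ereal.simps(1) zero_ereal_def)
    then obtain M where "\<forall>m\<ge>M. bd r \<epsilon> (F m)" using R by auto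
    then show "\<forall>\<^sub>F m in sequentially. gnorm nk r (F m) < a"
      unfolding eventually_sequentially using gnorm_le_iff e by (meson order.strict_trans1)
  qed
qed

lemma bd_nonneg: "bd r M f \<Longrightarrow> 0 \<le> M"
  unfolding bd_def by (metis mult_1_right nk_nonneg order_trans power_0)

lemma bd_mono: "bd r M f \<Longrightarrow> M \<le> M' \<Longrightarrow> bd r M' f"
  unfolding bd_def by (meson order_trans)

lemma bd_radius: "bd r M f \<Longrightarrow> 0 \<le> r' \<Longrightarrow> r' \<le> r \<Longrightarrow> bd r' M f"
  unfolding bd_def by (meson order_trans mult_left_mono nk_nonneg power_mono)

lemma bd_add:
  assumes "bd r M f" "bd r M g" "0 \<le> r" shows "bd r M (\<lambda>n. f n + g n)"
  unfolding bd_def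
proof
  fix n
  have "nk (f n + g n) * r ^ n \<le> max (nk (f n)) (nk (g n)) * r ^ n"
    using assms nk_add by (intro mult_right_mono) auto
  also have "\<dots> \<le> M" using assms unfolding bd_def by (auto simp: max_def)
  finally show "nk (f n + g n) * r ^ n \<le> M" .
qed

lemma bd_uminus: "bd r M f \<Longrightarrow> bd r M (\<lambda>n. - f n)"
  unfolding bd_def by simp

lemma bd_diff: "bd r M f \<Longrightarrow> bd r M g \<Longrightarrow> 0 \<le> r \<Longrightarrow> bd r M (\<lambda>n. f n - g n)"
  using bd_add[of r M f "\<lambda>n. - g n"] bd_uminus by auto

lemma bd_zero: "0 \<le> M \<Longrightarrow> bd r M (\<lambda>n. 0)"
  unfolding bd_def by simp

lemma bd_sum:
  assumes "\<And>i. i \<in> A \<Longrightarrow> bd r M (f i)" "0 \<le> M" "0 \<le> r"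
  shows "bd r M (\<lambda>n. \<Sum>i\<in>A. f i n)"
  using assms by (induction A rule: infinite_finite_induct) (auto intro!: bd_add bd_zero)

lemma bd_scale: "bd r M f \<Longrightarrow> nk c \<le> C \<Longrightarrow> bd r (C * M) (\<lambda>n. c * f n)"
  unfolding bd_def
proof
  fix n assume a: "\<forall>n. nk (f n) * r ^ n \<le> M" "nk c \<le> C"
  have "nk (c * f n) * r ^ n = nk c * (nk (f n) * r ^ n)" by (simp add: nk_mult)
  also have "\<dots> \<le> nk c * M" using a by (intro mult_left_mono) auto
  also have "\<dots> \<le> C * M" using a bd_nonneg[of r M f] by (intro mult_right_mono) (auto simp: bd_def)
  finally show "nk (c * f n) * r ^ n \<le> C * M" .
qed

lemma bd_cprod:
  assumes "bd r M f" "bd r M' g" "0 \<le> r"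
  shows "bd r (M * M') (cprod f g)"
  unfolding bd_def
proof
  fix n
  have M: "0 \<le> M" "0 \<le> M'" using assms bd_nonneg by auto
  have "cprod f g n * 1 = (\<Sum>k\<le>n. f k * g (n - k))" by (simp add: cprod_def)
  show "nk (cprod f g n) * r ^ n \<le> M * M'"
  proof (cases "r = 0")
    case True
    then show ?thesis
    proof (cases n)
      case 0
      have "nk (f 0) \<le> M" "nk (g 0) \<le> M'"
        using assms(1,2)[unfolded bd_def, rule_format, of 0] by auto
      then show ?thesis using 0 M by (auto simp: cprod_def nk_mult intro: mult_mono)
    qed (use True M in auto)
  next
    case False
    then have r: "r > 0" using assms by simp
    have "nk (cprod f g n) \<le> M * M' / r ^ n"
      unfolding cprod_def
    proof (rule nk_sum)
      fix i assume i: "i \<in> {..n}"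
      have "nk (f i * g (n - i)) * r ^ n = (nk (f i) * r ^ i) * (nk (g (n - i)) * r ^ (n - i))"
        using i power_add[of r i "n - i"] by (simp add: nk_mult)
      also have "\<dots> \<le> M * M'"
        using assms M r unfolding bd_def by (intro mult_mono) auto
      finally show "nk (f i * g (n - i)) \<le> M * M' / r ^ n" using r by (simp add: field_simps)
    qed (use M r in auto)
    then show ?thesis using r by (simp add: field_simps)
  qed
qed

lemma coeff_mult_cprod: "coeff (f * g) = cprod (coeff f) (coeff g)"
  by (rule ext) (simp add: cprod_def coeff_mult)

lemma pbd_mult: "pbd r M f \<Longrightarrow> pbd r M' g \<Longrightarrow> 0 \<le> r \<Longrightarrow> pbd r (M * M') (f * g)"
  by (simp add: coeff_mult_cprod bd_cprod)

lemma pbd_add: "pbd r M f \<Longrightarrow> pbd r M g \<Longrightarrow> 0 \<le> r \<Longrightarrow> pbd r M (f + g)"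
  using bd_add[of r M "coeff f" "coeff g"] by (simp add: plus_poly.rep_eq)

lemma pbd_diff: "pbd r M f \<Longrightarrow> pbd r M g \<Longrightarrow> 0 \<le> r \<Longrightarrow> pbd r M (f - g)"
  using bd_diff[of r M "coeff f" "coeff g"] by (simp add: minus_poly.rep_eq)

lemma pbd_minus: "pbd r M f \<Longrightarrow> pbd r M (- f)"
  using bd_uminus[of r M "coeff f"] by (simp add: uminus_poly.rep_eq)

lemma pbd_0: "0 \<le> M \<Longrightarrow> pbd r M 0"
  unfolding bd_def by simp

lemma pbd_1: "1 \<le> M \<Longrightarrow> pbd r M 1"
  unfolding bd_def by (auto simp: coeff_1)

lemma pbd_smult: "pbd r M f \<Longrightarrow> nk c \<le> C \<Longrightarrow> pbd r (C * M) (smult c f)"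
  using bd_scale[of r M "coeff f" c C] by (simp add: smult.rep_eq)

lemma pbd_sum: "(\<And>i. i \<in> A \<Longrightarrow> pbd r M (f i)) \<Longrightarrow> 0 \<le> M \<Longrightarrow> 0 \<le> r \<Longrightarrow> pbd r M (sum f A)"
  by (induction A rule: infinite_finite_induct) (auto intro!: pbd_add pbd_0)

lemma pbd_power: "pbd r M f \<Longrightarrow> 0 \<le> r \<Longrightarrow> pbd r (M ^ n) (f ^ n)"
  by (induction n) (auto intro!: pbd_mult pbd_1)

lemma pbd_prod: "(\<And>i. i \<in> A \<Longrightarrow> pbd r (M i) (f i)) \<Longrightarrow> 0 \<le> r \<Longrightarrow> pbd r (prod M A) (prod f A)"
  by (induction A rule: infinite_finite_induct) (auto intro!: pbd_mult pbd_1)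

lemma pbd_linear: "nk a \<le> M \<Longrightarrow> nk b * r \<le> M \<Longrightarrow> pbd r M [:a, b:]"
  unfolding bd_def
proof
  fix n assume a: "nk a \<le> M" "nk b * r \<le> M"
  then have "0 \<le> M" using nk_nonneg order_trans by blast
  then show "nk (coeff [:a, b:] n) * r ^ n \<le> M"
    using a by (cases n; cases "n - 1") (auto simp: coeff_pCons split: nat.splits)
qed

lemma pbd_const: "nk c \<le> M \<Longrightarrow> pbd r M [:c:]"
  using order_trans[OF nk_nonneg] unfolding bd_def by (auto simp: coeff_pCons split: nat.splits)

lemma pbd_pCons_iff: "pbd 1 M (pCons a f) \<longleftrightarrow> nk a \<le> M \<and> pbd 1 M f"
  unfolding bd_def by (auto simp: coeff_pCons split: nat.splits dest: spec[of _ "Suc _"] spec[of _ 0])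

text \<open>By Horner's scheme only sums and products with Y, of norm at most 1, occur. This turns
  coefficient bounds for a polynomial in y into bounds for the resulting polynomial in x on a
  disc.\<close>

lemma pbd_pcompose:
  assumes "pbd 1 M R" "pbd r 1 Y" "0 \<le> r"
  shows "pbd r M (pcompose R Y)"
  using assms(1)
proof (induction R)
  case (pCons a R)
  then have "nk a \<le> M" "pbd r M (pcompose R Y)" by (auto simp: pbd_pCons_iff)
  then show ?case
    unfolding pcompose_pCons using pbd_mult[OF assms(2), of M] assms(3) by (intro pbd_add pbd_const) auto
qed (auto intro: pbd_0 dest: bd_nonneg)

end

section \<open>Interpolation modulo products of cyclotomic polynomials\<close>

definition comax :: "'a::comm_ring_1 \<Rightarrow> 'a \<Rightarrow> bool" where
  "comax f g \<longleftrightarrow> (\<exists>s t. s * f + t * g = 1)"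

lemma comax_sym: "comax f g \<Longrightarrow> comax g f"
  unfolding comax_def by (metis add.commute)

lemma comax_1: "comax f 1"
  unfolding comax_def by (rule exI[of _ 0]) auto

lemma comax_mult:
  assumes "comax f g" "comax f h" shows "comax f (g * h)"
proof -
  obtain s t where 1: "s * f + t * g = 1" using assms unfolding comax_def by blast
  obtain s' t' where 2: "s' * f + t' * h = 1" using assms unfolding comax_def by blast
  have "(s * s' * f + s * t' * h + t * g * s') * f + (t * t') * (g * h) = (s * f + t * g) * (s' * f + t' * h)"
    by (simp add: algebra_simps)
  then show ?thesis unfolding comax_def 1 2 by auto
qed

lemma comax_prod: "(\<And>i. i \<in> A \<Longrightarrow> comax f (g i)) \<Longrightarrow> comax f (prod g A)"
  by (induction A rule: infinite_finite_induct) (auto intro: comax_mult comax_1)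

lemma comax_dvd_mult:
  assumes "comax f g" "f dvd x" "g dvd x" shows "f * g dvd x"
proof -
  obtain s t where 1: "s * f + t * g = 1" using assms unfolding comax_def by blast
  obtain y z where "x = f * y" "x = g * z" using assms(2,3) unfolding dvd_def by blast
  then have "(f * g) * (s * z + t * y) = s * f * x + t * g * x" by (simp add: algebra_simps)
  also have "\<dots> = x" using 1 by (metis distrib_right mult_1)
  finally show ?thesis by (metis dvd_triv_left)
qed

lemma comax_prod_dvd:
  assumes "finite A" "\<And>i j. i \<in> A \<Longrightarrow> j \<in> A \<Longrightarrow> i \<noteq> j \<Longrightarrow> comax (g i) (g j)" "\<And>i. i \<in> A \<Longrightarrow> g i dvd x"
  shows "prod g A dvd x"
  using assms
proof (induction A rule: finite_induct)
  case (insert i A)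
  then have "comax (g i) (prod g A)" by (intro comax_prod) auto
  then show ?case using insert by (auto intro!: comax_dvd_mult)
qed simp

lemma comax_dvd:
  assumes "comax f g" "f' dvd f" "g' dvd g" shows "comax f' g'"
  using assms unfolding comax_def by (auto elim!: dvdE) (metis mult.assoc mult.commute)

text \<open>Division of f by x - b leaves the constant f(b); being non-zero it can be scaled to 1,
  which gives the Bezout relation.\<close>

lemma comax_linear:
  fixes f :: "'a::field poly"
  assumes "poly f b \<noteq> 0" shows "comax [:- b, 1:] f"
proof -
  have "[:-b, 1:] * synthetic_div f b + [:poly f b:] = f" by (rule synthetic_div_correct')
  then have "f - synthetic_div f b * [:-b, 1:] = [:poly f b:]" by (simp add: algebra_simps)
  then have 1: "[:1 / poly f b:] * (f - synthetic_div f b * [:-b, 1:]) = 1" using assms by (simp add: one_pCons)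
  have "(- (c * q)) * l + c * f = c * (f - q * l)" for c q l :: "'a poly" by (simp add: algebra_simps)
  then have "(- ([:1 / poly f b:] * synthetic_div f b)) * [:-b, 1:] + [:1 / poly f b:] * f = 1"
    unfolding 1[symmetric] by metis
  then show ?thesis unfolding comax_def by blast
qed

section \<open>Division with integral coefficients and congruences modulo p\<close>

context padic
begin

lemma pbd_synthetic_div:
  assumes "nk c \<le> 1" "pbd 1 1 f" shows "pbd 1 1 (synthetic_div f c)" "nk (poly f c) \<le> 1"
proof -
  have "pbd 1 1 (synthetic_div f c) \<and> nk (poly f c) \<le> 1"
    using assms(2)
  proof (induction f)
    case (pCons a f)
    note a = pCons.prems[unfolded pbd_pCons_iff]
    note IH = pCons.IH[OF conjunct2[OF a]]
    have "nk (c * poly f c) \<le> 1 * 1"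
      unfolding nk_mult using assms(1) IH by (intro mult_mono) auto
    then have 1: "nk (a + c * poly f c) \<le> 1" using nk_add[of a "c * poly f c"] a by auto
    have "pbd 1 1 (pCons (poly f c) (synthetic_div f c))"
      using IH by (simp add: pbd_pCons_iff)
    then show ?case using 1 by simp
  qed (auto simp: bd_def)
  then show "pbd 1 1 (synthetic_div f c)" "nk (poly f c) \<le> 1" by auto
qed

text \<open>Long division by a monic integral polynomial: each step subtracts \<open>\<Psi>\<close>
  times a monomial whose coefficient is the leading one of f, so no denominator appears and the
  Gauss norm cannot grow.\<close>

lemma pbd_mod:
  assumes m: "lead_coeff \<Psi> = 1" "pbd 1 1 \<Psi>"
  shows "pbd 1 M f \<Longrightarrow> pbd 1 M (f mod \<Psi>)"
proof (induction "degree f" arbitrary: f rule: less_induct)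
  case less
  show ?case
  proof (cases "degree f < degree \<Psi>")
    case True
    then show ?thesis using less.prems by (simp add: mod_poly_less)
  next
    case False
    show ?thesis
    proof (cases "degree f = 0")
      case True
      then have "degree \<Psi> = 0" using False by simp
      then have "\<Psi> = 1" using m by (metis degree_eq_zeroE lead_coeff_pCons(2) one_pCons)
      then show ?thesis using bd_nonneg[OF less.prems] by (auto simp: bd_def)
    next
      case df: False
      define k where "k = degree f - degree \<Psi>"
      define q where "q = monom (lead_coeff f) k"
      define g where "g = f - q * \<Psi>"
      have lc: "nk (lead_coeff f) \<le> M" using less.prems[unfolded bd_def, rule_format, of "degree f"] by simp
      have q: "pbd 1 M q" unfolding bd_def q_def using lc bd_nonneg[OF less.prems] by auto
      have g: "pbd 1 M g" unfolding g_def
        using pbd_diff[OF less.prems, of "q * \<Psi>"] pbd_mult[OF q m(2)] by simp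
      have f0: "f \<noteq> 0" using df by auto
      have dq: "degree (q * \<Psi>) = degree f"
        using f0 m False unfolding q_def k_def
        by (subst degree_mult_eq) (auto simp: degree_monom_eq)
      have lq: "coeff (q * \<Psi>) (degree f) = lead_coeff f"
        using dq m unfolding q_def by (metis lead_coeff_mult lead_coeff_monom mult_1_right)
      have "degree g < degree f"
        unfolding g_def using df dq lq
        by (metis coeff_diff degree_diff_le eq_iff_diff_eq_0 leading_coeff_0_iff le_less order_refl degree_0 gr0I)
      then have "pbd 1 M (g mod \<Psi>)" using less.hyps g by blast
      moreover have "g mod \<Psi> = f mod \<Psi>" unfolding g_def mod_eq_dvd_iff by simp
      ultimately show ?thesis by simp
    qed
  qed
qed

text \<open>The group 1 + p Z_p, which contains u and all nodes of the interpolation.\<close>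

definition unit1 :: "'k \<Rightarrow> bool" where
  "unit1 b \<longleftrightarrow> nk (b - 1) \<le> 1 / real p"

lemma inv_p: "1 / real p > 0" "1 / real p < 1" "1 / real p \<le> 1" "1 / real p \<ge> 0"
  using p_gt1 by auto

lemma unit1_nk: assumes "unit1 b" shows "nk b = 1"
proof -
  have 1: "nk (b - 1) < 1" using assms inv_p unfolding unit1_def by linarith
  have "nk b \<le> 1" using nk_add[of "b - 1" 1] 1 by simp
  moreover have "1 \<le> nk b"
    using nk_add[of b "1 - b"] 1 nk_diff_commute[of b 1] by auto
  ultimately show ?thesis by simp
qed

lemma unit1_nz: "unit1 b \<Longrightarrow> b \<noteq> 0"
  using unit1_nk by fastforce

lemma unit1_1 [simp]: "unit1 1"
  unfolding unit1_def using p_pos by simp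

lemma unit1_mult: assumes "unit1 a" "unit1 b" shows "unit1 (a * b)"
proof -
  have "a * b - 1 = a * (b - 1) + (a - 1)" by (simp add: algebra_simps)
  then show ?thesis using nk_add[of "a * (b - 1)" "a - 1"] assms unit1_nk[OF assms(1)]
    unfolding unit1_def by (simp only: nk_mult)
qed

lemma unit1_inverse: assumes "unit1 a" shows "unit1 (inverse a)"
proof -
  have "inverse a - 1 = inverse a * (1 - a)" using unit1_nz[OF assms] by (simp add: algebra_simps)
  then show ?thesis using assms unit1_nk[OF assms] nk_diff_commute[of a 1]
    unfolding unit1_def by (simp add: nk_mult nk_inverse)
qed

lemma unit1_power: "unit1 a \<Longrightarrow> unit1 (a ^ n)"
  by (induction n) (auto intro: unit1_mult)

lemma unit1_powi: "unit1 a \<Longrightarrow> unit1 (a powi n)"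
  by (auto simp: power_int_def intro: unit1_power unit1_inverse)

text \<open>Congruence modulo p Z_p[y]. The two sides need not be integral themselves, hence the
  integrality premises of \<open>icong_mult\<close>.\<close>

definition icong :: "'k poly \<Rightarrow> 'k poly \<Rightarrow> bool" where
  "icong f g \<longleftrightarrow> pbd 1 (1 / real p) (f - g)"

lemma icong_refl [simp]: "icong f f"
  unfolding icong_def using inv_p pbd_0 by simp

lemma icong_sym: "icong f g \<Longrightarrow> icong g f"
  unfolding icong_def using pbd_minus[of 1 "1 / real p" "f - g"] by simp

lemma icong_trans: "icong f g \<Longrightarrow> icong g h \<Longrightarrow> icong f h"
  unfolding icong_def using pbd_add[of 1 "1 / real p" "f - g" "g - h"] by simp

lemma icong_mult:
  assumes "icong f g" "icong f' g'" "pbd 1 1 f" "pbd 1 1 g'" shows "icong (f * f') (g * g')"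
proof -
  have "f * f' - g * g' = f * (f' - g') + (f - g) * g'" by (simp add: algebra_simps)
  moreover have "pbd 1 (1 / real p) (f * (f' - g'))"
    using pbd_mult[OF assms(3) assms(2)[unfolded icong_def]] by simp
  moreover have "pbd 1 (1 / real p) ((f - g) * g')"
    using pbd_mult[OF assms(1)[unfolded icong_def] assms(4)] by simp
  ultimately show ?thesis unfolding icong_def using pbd_add by simp
qed

lemma pbd_power1: "pbd 1 1 f \<Longrightarrow> pbd 1 1 (f ^ n)"
  using pbd_power[of 1 1 f n] by simp

lemma pbd_mult1: "pbd 1 1 f \<Longrightarrow> pbd 1 1 g \<Longrightarrow> pbd 1 1 (f * g)"
  using pbd_mult[of 1 1 f 1 g] by simp

lemma pbd_prod1: "(\<And>i. i \<in> A \<Longrightarrow> pbd 1 1 (f i)) \<Longrightarrow> pbd 1 1 (prod f A)"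
  using pbd_prod[of A 1 "\<lambda>_. 1" f] by simp

lemma icong_power: "icong f g \<Longrightarrow> pbd 1 1 f \<Longrightarrow> pbd 1 1 g \<Longrightarrow> icong (f ^ n) (g ^ n)"
  by (induction n) (auto intro!: icong_mult pbd_power1)

lemma icong_prod_power:
  assumes "\<And>i. i \<in> A \<Longrightarrow> icong (f i) g" "\<And>i. i \<in> A \<Longrightarrow> pbd 1 1 (f i)" "pbd 1 1 g"
  shows "icong (prod f A) (g ^ card A)"
  using assms by (induction A rule: infinite_finite_induct) (auto intro!: icong_mult pbd_power1)

section \<open>The cyclotomic factors (y^p - a^p) / (y - a)\<close>

definition cyc :: "'k \<Rightarrow> 'k poly" where
  "cyc a = (\<Sum>i<p. [:a:] ^ (p - Suc i) * [:0, 1:] ^ i)"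

lemma cyc_times: "[:- a, 1:] * cyc a = [:0, 1:] ^ p - [:a ^ p:]"
  using power_diff_sumr2[of "[:0, 1::'k:]" p "[:a:]"] by (simp add: cyc_def poly_const_pow)

lemma coeff_cyc: "coeff (cyc a) i = (if i < p then a ^ (p - Suc i) else 0)"
proof -
  have "cyc a = (\<Sum>i<p. monom (a ^ (p - Suc i)) i)"
    unfolding cyc_def by (simp add: monom_altdef poly_const_pow)
  then show ?thesis by (simp add: coeff_sum)
qed

lemma degree_cyc: "degree (cyc a) = p - 1"
proof -
  have "coeff (cyc a) (p - 1) = 1" using p_ge3 by (simp add: coeff_cyc)
  moreover have "coeff (cyc a) i = 0" if "p - 1 < i" for i using that by (simp add: coeff_cyc)
  ultimately show ?thesis by (metis degree_le le_degree le_antisym zero_neq_one)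
qed

lemma lead_coeff_cyc: "lead_coeff (cyc a) = 1"
  using p_ge3 by (simp add: degree_cyc coeff_cyc)

lemma pbd_cyc: "unit1 a \<Longrightarrow> pbd 1 1 (cyc a)"
  unfolding bd_def by (auto simp: coeff_cyc nk_power unit1_nk)

lemma poly_cyc: "poly (cyc a) b = (\<Sum>i<p. a ^ (p - Suc i) * b ^ i)"
  unfolding cyc_def by (simp add: poly_sum poly_power)

lemma inv_p_sq: "1 / real p ^ 2 = (1 / real p) * (1 / real p)"
  by (simp add: power2_eq_square)

lemma nk_mult_le: "nk x \<le> A \<Longrightarrow> nk y \<le> B \<Longrightarrow> nk (x * y) \<le> A * B"
  unfolding nk_mult by (intro mult_mono) (auto intro: order_trans[OF nk_nonneg])

text \<open>Binomial expansion stopped at first order: the error only picks up multiples of (a -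
  1)^2.\<close>

lemma unit1_power_expand:
  assumes "unit1 a" shows "nk (a ^ m - 1 - of_nat m * (a - 1)) \<le> 1 / real p ^ 2"
proof (induction m)
  case (Suc m)
  have eq: "a ^ Suc m - 1 - of_nat (Suc m) * (a - 1)
     = a * (a ^ m - 1 - of_nat m * (a - 1)) + of_nat m * ((a - 1) * (a - 1))"
    by (simp add: algebra_simps)
  have 1: "nk (a * (a ^ m - 1 - of_nat m * (a - 1))) \<le> 1 / real p ^ 2"
    using Suc unit1_nk[OF assms] by (simp add: nk_mult)
  have 2: "nk (of_nat m * ((a - 1) * (a - 1))) \<le> 1 * (1 / real p ^ 2)"
    unfolding inv_p_sq using assms unfolding unit1_def
    by (intro nk_mult_le nk_of_nat_le1) auto
  show ?case unfolding eq by (intro nk_add_le) (use 1 2 in simp_all)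
qed (use p_pos in simp)

text \<open>To first order the summands of the value are 1 + (p - 1 - i) (a - 1) + i (b - 1). Either
  family of exponents adds up to p (p - 1) / 2, a multiple of p because p is odd, so modulo p^2 the
  linear terms vanish and only the number p of summands remains.\<close>

lemma cyc_at_unit1:
  assumes "unit1 a" "unit1 b" shows "nk (poly (cyc a) b - of_nat p) \<le> 1 / real p ^ 2"
proof -
  let ?r = "\<lambda>i. a ^ (p - Suc i) * b ^ i - 1 - of_nat (p - Suc i) * (a - 1) - of_nat i * (b - 1)"
  have r: "nk (?r i) \<le> 1 / real p ^ 2" for i
  proof -
    let ?m = "p - Suc i"
    have eq: "?r i = a ^ ?m * (b ^ i - 1 - of_nat i * (b - 1))
        + ((a ^ ?m - 1 - of_nat ?m * (a - 1)) + (a ^ ?m - 1) * (of_nat i * (b - 1)))"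
      by (simp add: algebra_simps)
    have 1: "nk (a ^ ?m * (b ^ i - 1 - of_nat i * (b - 1))) \<le> 1 / real p ^ 2"
      using unit1_power_expand[OF assms(2)] unit1_nk[OF assms(1)] by (simp add: nk_mult nk_power)
    have 2: "nk ((a ^ ?m - 1) * (of_nat i * (b - 1))) \<le> (1 / real p) * (1 * (1 / real p))"
      using unit1_power[OF assms(1)] assms(2) unfolding unit1_def
      by (intro nk_mult_le nk_of_nat_le1) auto
    show ?thesis unfolding eq
      by (intro nk_add_le) (use 1 2 unit1_power_expand[OF assms(1), of ?m] in \<open>simp_all add: inv_p_sq\<close>)
  qed
  obtain q where q: "p = 2 * q + 1" using podd by (auto elim: oddE)
  have s1: "(\<Sum>i<p. i) = p * q" unfolding q by (induction q) auto
  have s2: "(\<Sum>i<p. p - Suc i) = p * q"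
    using s1 sum.nat_diff_reindex[of "\<lambda>i. i" p] by simp
  have "poly (cyc a) b - of_nat p
      = (\<Sum>i<p. ?r i) + (of_nat (\<Sum>i<p. p - Suc i) * (a - 1) + of_nat (\<Sum>i<p. i) * (b - 1))"
    unfolding poly_cyc of_nat_sum sum_subtractf sum_distrib_right by simp
  also have "\<dots> = (\<Sum>i<p. ?r i) + of_nat p * of_nat q * ((a - 1) + (b - 1))"
    unfolding s1 s2 by (simp add: algebra_simps)
  finally have eq: "poly (cyc a) b - of_nat p = \<dots>" .
  have 1: "nk (\<Sum>i<p. ?r i) \<le> 1 / real p ^ 2"
    by (intro nk_sum r) auto
  have "nk ((a - 1) + (b - 1)) \<le> 1 / real p"
    using nk_add[of "a - 1" "b - 1"] assms unfolding unit1_def by auto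
  then have 2: "nk (of_nat p * of_nat q * ((a - 1) + (b - 1))) \<le> (1 / real p) * 1 * (1 / real p)"
    by (intro nk_mult_le nk_of_nat_le1) (auto simp: nk_p)
  show ?thesis unfolding eq by (intro nk_add_le) (use 1 2 in \<open>simp_all add: inv_p_sq\<close>)
qed

lemma cyc_at_unit1_nz:
  assumes "unit1 a" "unit1 b" shows "poly (cyc a) b \<noteq> 0"
proof
  assume "poly (cyc a) b = 0"
  then have "1 / real p \<le> 1 / real p ^ 2" using cyc_at_unit1[OF assms] by (simp add: nk_p)
  then have "real p \<le> 1" using p_pos by (simp add: field_simps power2_eq_square)
  then show False using p_gt1 by simp
qed

lemma prime_dvd_binomial: assumes "0 < k" "k < p" shows "p dvd p choose k"
proof -
  have "p * ((p - 1) choose (k - 1)) = (p choose k) * k"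
    using Suc_times_binomial_eq[of "p - 1" "k - 1"] assms by simp
  then have "p dvd (p choose k) * k" by (metis dvd_triv_left)
  moreover have "\<not> p dvd k" using assms by (auto dest: dvd_imp_le)
  ultimately show ?thesis using pprime by (simp add: prime_dvd_mult_iff)
qed

text \<open>Modulo p the inner entries of row p of Pascal's triangle vanish, so neighbours in row p
  - 1 are opposite.\<close>

lemma binomial_pm1: "i < p \<Longrightarrow> nk (of_nat ((p - 1) choose i) - (-1) ^ i) \<le> 1 / real p"
proof (induction i)
  case (Suc i)
  have "p choose Suc i = ((p - 1) choose i) + ((p - 1) choose Suc i)"
    using p_ge3 by (metis binomial_Suc_Suc Suc_diff_1 prime_gt_0_nat pprime)
  then have "of_nat ((p - 1) choose Suc i) - (-1) ^ Suc i
     = of_nat (p choose Suc i) - (of_nat ((p - 1) choose i) - (-1) ^ i :: 'k)" by simp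
  moreover have "nk (of_nat (p choose Suc i)) \<le> 1 / real p"
    using prime_dvd_binomial[of "Suc i"] Suc.prems by (intro nk_dvd) auto
  ultimately show ?case using nk_diff_le Suc by (metis Suc_lessD)
qed (use p_pos in simp)

abbreviation zz :: "'k poly" where "zz \<equiv> [:- 1, 1:]"

lemma pbd_zz: "pbd 1 1 zz"
  by (rule pbd_linear) auto

text \<open>Modulo p the coefficients of \<open>cyc a\<close> all become 1. So do those of (y -
  1)^(p - 1): the sign of the binomial coefficient modulo p cancels the sign of the power of -1, as
  p - 1 is even.\<close>

lemma icong_cyc: assumes "unit1 a" shows "icong (cyc a) (zz ^ (p - 1))"
  unfolding icong_def bd_def
proof
  fix i
  show "nk (coeff (cyc a - zz ^ (p - 1)) i) * 1 ^ i \<le> 1 / real p"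
  proof (cases "i < p")
    case True
    have ev: "even (p - 1)" using podd by simp
    then have "(-1::'k) ^ (p - 1 - i) = (-1) ^ i"
    proof -
      have "even (p - 1 - i) \<longleftrightarrow> even i" using ev True by (subst even_diff_nat) auto
      then show ?thesis by (simp add: minus_one_power_iff)
    qed
    then have "coeff (zz ^ (p - 1)) i = of_nat ((p - 1) choose i) * (-1) ^ i"
      using True by (subst coeff_linear_poly_power) auto
    moreover have "(-1::'k) ^ i * (-1) ^ i = 1" by (metis left_minus_one_mult_self mult.right_neutral)
    ultimately have "coeff (cyc a - zz ^ (p - 1)) i
        = (a ^ (p - Suc i) - 1) - (-1) ^ i * (of_nat ((p - 1) choose i) - (-1) ^ i)"
      using True by (simp add: coeff_cyc right_diff_distrib mult.commute)
    moreover have "nk (a ^ (p - Suc i) - 1) \<le> 1 / real p"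
      using unit1_power[OF assms] unfolding unit1_def by simp
    moreover have "nk ((-1) ^ i * (of_nat ((p - 1) choose i) - (-1) ^ i)) \<le> 1 / real p"
      using binomial_pm1[OF True] by (simp add: nk_mult nk_power)
    ultimately show ?thesis
      using nk_diff[of "a ^ (p - Suc i) - 1" "(-1) ^ i * (of_nat ((p - 1) choose i) - (-1) ^ i)"] by simp
  next
    case False
    have "coeff (zz ^ (p - 1)) i = 0"
      using False degree_linear_power[of "-1::'k" "p - 1"] p_ge3 by (intro coeff_eq_0) auto
    then show ?thesis using False p_pos by (simp add: coeff_cyc)
  qed
qed

section \<open>Polynomials invertible at the maximal ideal (p, y - 1), and powers of p in
  ideals\<close>

definition unitlike :: "'k poly \<Rightarrow> bool" where
  "unitlike G \<longleftrightarrow> pbd 1 1 G \<and> unit1 (poly G 1)"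

lemma unitlike_mult: "unitlike F \<Longrightarrow> unitlike G \<Longrightarrow> unitlike (F * G)"
  unfolding unitlike_def by (auto intro: pbd_mult1 unit1_mult)

lemma unitlike_1: "unitlike 1"
  unfolding unitlike_def by (auto intro: pbd_1)

text \<open>Abstracts the products of p - 1 factors y - b with b in 1 + p Z_p. Modulo p they look
  like the cyclotomic factors, but their value at 1 is divisible by p^2, whereas
  \<open>cyc a\<close> is Eisenstein in y - 1 and takes there a value of norm exactly 1/p. This
  contrast is what \<open>cyc_minus_eisen\<close> exploits.\<close>

definition eisen :: "'k poly \<Rightarrow> bool" where
  "eisen C \<longleftrightarrow> pbd 1 1 C \<and> icong C (zz ^ (p - 1)) \<and> nk (poly C 1) \<le> 1 / real p ^ 2"

text \<open>Both polynomials are (y - 1)^(p - 1) modulo p, so p divides their difference. At 1 they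
  are p and 0 modulo p^2, so the quotient is 1 modulo p there.\<close>

lemma cyc_minus_eisen:
  assumes "unit1 a" "eisen C"
  shows "\<exists>g. unitlike g \<and> smult (of_nat p) g = cyc a - C"
proof -
  define g where "g = smult (1 / of_nat p) (cyc a - C)"
  have nkp: "nk (1 / of_nat p) = real p" by (simp add: nk_divide nk_p)
  have "icong (cyc a) C"
    using icong_trans[OF icong_cyc[OF assms(1)] icong_sym] assms(2) unfolding eisen_def by blast
  then have 1: "pbd 1 1 g"
    using pbd_smult[of 1 "1 / real p" "cyc a - C" "1 / of_nat p" "real p"] nkp p_pos
    unfolding icong_def g_def by simp
  have "poly g 1 - 1 = (1 / of_nat p) * ((poly (cyc a) 1 - of_nat p) - poly C 1)"
    unfolding g_def using p_nz by (simp add: field_simps)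
  moreover have "nk ((poly (cyc a) 1 - of_nat p) - poly C 1) \<le> 1 / real p ^ 2"
    using nk_diff_le[of "poly (cyc a) 1 - of_nat p"] cyc_at_unit1[OF assms(1) unit1_1] assms(2)
    unfolding eisen_def by blast
  ultimately have "nk (poly g 1 - 1) \<le> real p * (1 / real p ^ 2)"
    using nk_mult_le nkp by (metis order_refl)
  then have "unit1 (poly g 1)" unfolding unit1_def inv_p_sq using p_pos by simp
  moreover have "smult (of_nat p) g = cyc a - C" unfolding g_def using p_nz by simp
  ultimately show ?thesis using 1 unfolding unitlike_def by blast
qed

text \<open>Write F for a new cyclotomic factor, C for a new group, P and D for the products already
  treated. By induction p^n G1 lies in (P, C D) and p^n G2 in (F P, D). As F - C = p g with g
  \<open>unitlike\<close>, the element p^(n+1) g G1 G2 = F G2 (p^n G1) - C G1 (p^n G2) lies in (F P,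
  C D), so that adding F and C costs a single factor p.\<close>

lemma ideal_power_p:
  assumes "finite S" "\<And>j. j \<in> S \<Longrightarrow> unit1 (a j)" "\<And>i. eisen (C i)"
  shows "\<exists>G X Y. unitlike G \<and> pbd 1 1 X \<and> pbd 1 1 Y \<and>
     smult (of_nat p ^ (card S + e - 1)) G = X * (\<Prod>j\<in>S. cyc (a j)) + Y * (\<Prod>i<e. C i)"
  using assms(1,2)
proof (induction S arbitrary: e rule: finite_induct)
  case empty
  \<comment> \<open>An empty product is 1, so the ideal is the whole ring; this also covers e = 0,
    where the exponent is truncated.\<close>
  have "pbd 1 1 [:of_nat p ^ (e - 1) :: 'k:]"
    by (intro pbd_const) (metis nk_of_nat_le1 of_nat_power)
  then have "unitlike 1 \<and> pbd 1 1 [:of_nat p ^ (e - 1) :: 'k:] \<and> pbd 1 1 0 \<and>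
    smult (of_nat p ^ (card {} + e - 1)) 1 = [:of_nat p ^ (e - 1) :: 'k:] * (\<Prod>j\<in>{}. cyc (a j)) + 0 * (\<Prod>i<e. C i)"
    using unitlike_1 pbd_0 by simp
  then show ?case by blast
next
  case (insert j S)
  note IHS = insert.IH
  show ?case
  proof (induction e)
    case 0
    have "pbd 1 1 [:of_nat p ^ (card (insert j S) - 1) :: 'k:]"
      by (intro pbd_const) (metis nk_of_nat_le1 of_nat_power)
    then have "unitlike 1 \<and> pbd 1 1 0 \<and> pbd 1 1 [:of_nat p ^ (card (insert j S) - 1) :: 'k:] \<and>
      smult (of_nat p ^ (card (insert j S) + 0 - 1)) 1 = 0 * (\<Prod>j\<in>insert j S. cyc (a j))
         + [:of_nat p ^ (card (insert j S) - 1) :: 'k:] * (\<Prod>i<0. C i)"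
      using unitlike_1 pbd_0 by simp
    then show ?case by blast
  next
    case (Suc e)
    let ?n = "card S + e"
    let ?P = "\<Prod>j\<in>S. cyc (a j)" and ?D = "\<Prod>i<e. C i"
    obtain G1 X1 Y1 where 1: "unitlike G1" "pbd 1 1 X1" "pbd 1 1 Y1"
      "smult (of_nat p ^ ?n) G1 = X1 * ?P + Y1 * (C e * ?D)"
      using IHS[of "Suc e"] insert.prems by (auto simp: mult.commute)
    obtain G2 X2 Y2 where 2: "unitlike G2" "pbd 1 1 X2" "pbd 1 1 Y2"
      "smult (of_nat p ^ ?n) G2 = X2 * (cyc (a j) * ?P) + Y2 * ?D"
      using Suc insert.hyps by auto
    obtain g where g: "unitlike g" "smult (of_nat p) g = cyc (a j) - C e"
      using cyc_minus_eisen[of "a j" "C e"] insert.prems assms(3) by auto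
    have "smult (of_nat p ^ (card (insert j S) + Suc e - 1)) (g * G1 * G2)
        = smult (of_nat p) g * smult (of_nat p ^ ?n) (G1 * G2)"
      using insert.hyps by (simp add: mult_ac)
    also have "\<dots> = cyc (a j) * G2 * smult (of_nat p ^ ?n) G1 - C e * G1 * smult (of_nat p ^ ?n) G2"
      unfolding g by (simp add: algebra_simps smult_diff_right)
    also have "\<dots> = (G2 * X1 - C e * G1 * X2) * (cyc (a j) * ?P) + (G2 * cyc (a j) * Y1 - G1 * Y2) * (C e * ?D)"
      unfolding 1(4) 2(4) by (simp add: algebra_simps)
    finally have eq: "smult (of_nat p ^ (card (insert j S) + Suc e - 1)) (g * G1 * G2)
      = (G2 * X1 - C e * G1 * X2) * (\<Prod>j\<in>insert j S. cyc (a j)) + (G2 * cyc (a j) * Y1 - G1 * Y2) * (\<Prod>i<Suc e. C i)"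
      using insert.hyps by (simp add: mult.commute)
    have "unitlike (g * G1 * G2)" using 1 2 g unitlike_mult by blast
    moreover have "pbd 1 1 (G2 * X1 - C e * G1 * X2)"
      using 1 2 assms(3) unfolding unitlike_def eisen_def by (auto intro!: pbd_diff pbd_mult1)
    moreover have "pbd 1 1 (G2 * cyc (a j) * Y1 - G1 * Y2)"
      using 1 2 pbd_cyc insert.prems unfolding unitlike_def by (auto intro!: pbd_diff pbd_mult1)
    ultimately show ?case using eq by blast
  qed
qed

text \<open>Modulo p and \<open>\<Psi>\<close>, G is 1 minus a nilpotent element: X = 1 - G is a
  multiple of y - 1 modulo p, and (y - 1)^D is congruent to \<open>\<Psi>\<close>. Hence a finite
  geometric series inverts G up to a multiple of p, and the norm of f is controlled by that of G f
  up to an error smaller by the factor p.\<close>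

lemma unitlike_isometry:
  assumes \<Psi>: "lead_coeff \<Psi> = 1" "pbd 1 1 \<Psi>" "icong \<Psi> (zz ^ D)"
    and G: "unitlike G" and M: "pbd 1 M ((G * f) mod \<Psi>)"
  shows "pbd 1 M (f mod \<Psi>)"
proof -
  define f0 where "f0 = f mod \<Psi>"
  define X where "X = 1 - G"
  define A where "A = synthetic_div X 1"
  have Xi: "pbd 1 1 X" unfolding X_def using G unfolding unitlike_def by (auto intro!: pbd_diff pbd_1)
  have Ai: "pbd 1 1 A" unfolding A_def by (rule pbd_synthetic_div) (use Xi in auto)
  have "zz * A + [:poly X 1:] = X" unfolding A_def using synthetic_div_correct'[of 1 X] by simp
  then have "X - zz * A = [:1 - poly G 1:]" unfolding X_def by (simp add: algebra_simps)
  moreover have "nk (1 - poly G 1) \<le> 1 / real p"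
    using G nk_diff_commute[of 1] unfolding unitlike_def unit1_def by auto
  ultimately have "icong X (zz * A)" unfolding icong_def using pbd_const by metis
  then have "icong (X ^ D) ((zz * A) ^ D)" using Xi Ai pbd_zz by (intro icong_power pbd_mult1)
  moreover have "icong ((zz * A) ^ D) (\<Psi> * A ^ D)"
    unfolding power_mult_distrib using \<Psi> Ai pbd_zz by (intro icong_mult icong_sym[OF \<Psi>(3)] icong_refl pbd_power1)
  ultimately have V: "pbd 1 (1 / real p) (X ^ D - \<Psi> * A ^ D)" using icong_trans unfolding icong_def by blast
  define V where "V = X ^ D - \<Psi> * A ^ D"
  define Sg where "Sg = (\<Sum>i<D. X ^ i)"
  have Sgi: "pbd 1 1 Sg" unfolding Sg_def by (intro pbd_sum pbd_power1 Xi) auto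
  have "G * Sg = 1 - X ^ D"
    using one_diff_power_eq[of X D] unfolding X_def Sg_def by simp
  then have "Sg * (G * f) = (1 - X ^ D) * f" by (metis mult.assoc mult.commute)
  then have "Sg * (G * f) + V * f = f - \<Psi> * A ^ D * f" unfolding V_def by (simp add: algebra_simps)
  then have "f mod \<Psi> = (Sg * (G * f) + V * f) mod \<Psi>" by (simp add: mod_eq_dvd_iff)
  also have "\<dots> = (Sg * ((G * f) mod \<Psi>) + V * f0) mod \<Psi>"
    unfolding f0_def by (metis mod_add_cong mod_mult_right_eq)
  finally have f0: "f0 = (Sg * ((G * f) mod \<Psi>) + V * f0) mod \<Psi>" unfolding f0_def .
  have step: "pbd 1 (max M (M' / real p)) f0" if "pbd 1 M' f0" for M'
  proof -
    have "pbd 1 (1 * M) (Sg * ((G * f) mod \<Psi>))" by (intro pbd_mult Sgi M) auto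
    moreover have "pbd 1 ((1 / real p) * M') (V * f0)" using V that unfolding V_def by (intro pbd_mult) auto
    ultimately have "pbd 1 (max M (M' / real p)) (Sg * ((G * f) mod \<Psi>) + V * f0)"
      by (auto intro!: pbd_add elim: bd_mono)
    then show ?thesis using f0 pbd_mod[OF \<Psi>(1,2)] by metis
  qed
  \<comment> \<open>For the exact norm of \<open>f0\<close>, attained at some coefficient, the
    improvement just proved is only possible if this norm is at most M.\<close>
  define M' where "M' = Max ((\<lambda>i. nk (coeff f0 i)) ` {..degree f0})"
  have M0: "0 \<le> M" using M bd_nonneg by blast
  have "M' \<in> (\<lambda>i. nk (coeff f0 i)) ` {..degree f0}" unfolding M'_def by (rule Max_in) auto
  then obtain i where i: "M' = nk (coeff f0 i)" by blast
  have b: "pbd 1 M' f0" unfolding bd_def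
  proof
    fix n show "nk (coeff f0 n) * 1 ^ n \<le> M'"
    proof (cases "n \<le> degree f0")
      case True then show ?thesis unfolding M'_def by (auto intro!: Max_ge)
    next
      case False then show ?thesis using i by (simp add: coeff_eq_0)
    qed
  qed
  have "M' \<le> max M (M' / real p)"
    using step[OF b, unfolded bd_def, rule_format, of i] i by simp
  moreover have "M' / real p < M'" if "M' > 0" using that p_gt1 by (simp add: field_simps)
  ultimately have "M' \<le> M" using M0 by (cases "M' > 0") auto
  then show ?thesis using b bd_mono unfolding f0_def by blast
qed

text \<open>The value at 1 is a product of p - 1 multiples of p, and p - 1 \<ge> 2.\<close>

lemma eisen_linear_prod:
  assumes "finite A" "card A = p - 1" "\<And>l. l \<in> A \<Longrightarrow> unit1 (b l)"
  shows "eisen (\<Prod>l\<in>A. [:- b l, 1:])"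
proof -
  have i: "pbd 1 1 [:- b l, 1:]" if "l \<in> A" for l
    using assms(3)[OF that] unit1_nk by (intro pbd_linear) auto
  have "icong [:- b l, 1:] zz" if "l \<in> A" for l
    using assms(3)[OF that] unfolding icong_def unit1_def by (auto intro!: pbd_const simp: nk_diff_commute)
  then have 1: "icong (\<Prod>l\<in>A. [:- b l, 1:]) (zz ^ (p - 1))"
    using icong_prod_power[of A "\<lambda>l. [:- b l, 1:]" zz] i pbd_zz assms(2) by auto
  have "nk (poly (\<Prod>l\<in>A. [:- b l, 1:]) 1) = (\<Prod>l\<in>A. nk (1 - b l))"
    by (simp add: poly_prod nk_prod)
  also have "\<dots> \<le> (\<Prod>l\<in>A. 1 / real p)"
    using assms(3) unfolding unit1_def by (intro prod_mono) (auto simp: nk_diff_commute)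
  also have "\<dots> = (1 / real p) ^ (p - 1)" using assms(2) by simp
  also have "\<dots> \<le> (1 / real p) ^ 2" using p_ge3 inv_p by (intro power_decreasing) auto
  finally show ?thesis unfolding eisen_def using 1 pbd_prod1[of A] i by (auto simp: power_divide)
qed

text \<open>If p^n G lies in the ideal of \<open>\<Psi>\<close> and the product of the groups, and
  \<open>Q0\<close> inverts this product modulo \<open>\<Psi>\<close>, then p^n G \<open>Q0\<close>
  is congruent to an integral polynomial, and \<open>unitlike_isometry\<close> removes G. So the
  power of p found in \<open>ideal_power_p\<close> bounds the denominator of the inverse.\<close>

lemma interpolation_bound:
  fixes a :: "int \<Rightarrow> 'k"
  assumes a: "\<And>j. unit1 (a j)" and J: "J = {jl..jr}" "card J \<ge> 1" and J': "J' \<subseteq> J"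
  shows "\<exists>Q. pbd 1 (real p ^ (card J' + (card J - 1) div (p - 1))) Q \<and> (Q = 0 \<or> degree Q < (p - 1) * card J') \<and>
     (\<forall>j\<in>J'. cyc (a j) dvd 1 + (\<Prod>i\<in>J. [:- a i, 1:]) * Q)"
proof -
  define h where "h = card J"
  \<comment> \<open>The number of groups of p - 1 factors needed to cover J, that is h / (p - 1)
    rounded up.\<close>
  define e where "e = (h - 1) div (p - 1) + 1"
  \<comment> \<open>The nodes are numbered from \<open>jl\<close> and continue beyond
    \<open>jr\<close>, so that the last group is complete; the surplus factors make up
    \<open>B'\<close>.\<close>
  define b where "b l = a (jl + int l)" for l
  define C where "C i = (\<Prod>l\<in>{i * (p - 1)..<i * (p - 1) + (p - 1)}. [:- b l, 1:])" for i
  define \<Psi> where "\<Psi> = (\<Prod>j\<in>J'. cyc (a j))"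
  have fJ: "finite J" "finite J'" using J J' by (auto intro: finite_subset)
  have h: "h = nat (jr - jl + 1)" unfolding h_def J by simp
  have eisenC: "eisen (C i)" for i unfolding C_def by (rule eisen_linear_prod) (auto simp: b_def a)
  have Call: "(\<Prod>i<e. C i) = (\<Prod>l<e * (p - 1). [:- b l, 1:])"
    unfolding C_def by (rule prod.nat_group)
  have he: "h \<le> e * (p - 1)"
  proof -
    have "h - 1 = (h - 1) div (p - 1) * (p - 1) + (h - 1) mod (p - 1)" by (rule div_mult_mod_eq[symmetric])
    moreover have "(h - 1) mod (p - 1) < p - 1" using p_ge3 by simp
    moreover have "e * (p - 1) = (h - 1) div (p - 1) * (p - 1) + (p - 1)" unfolding e_def by simp
    ultimately show ?thesis by linarith
  qed
  define B where "B = (\<Prod>i\<in>J. [:- a i, 1:])"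
  define B' where "B' = (\<Prod>l\<in>{h..<e * (p - 1)}. [:- b l, 1:])"
  have "(\<Prod>l<h. [:- b l, 1:]) = B"
    unfolding B_def J(1) b_def
    by (rule prod.reindex_bij_witness[of _ "\<lambda>i. nat (i - jl)" "\<lambda>l. jl + int l"]) (use h in auto)
  then have CB: "(\<Prod>i<e. C i) = B * B'"
    unfolding Call B'_def using he
    by (metis (no_types, lifting) atLeast0LessThan prod.atLeastLessThan_concat zero_le)
  have linb: "pbd 1 1 [:- b l, 1:]" for l using a unit1_nk by (intro pbd_linear) (auto simp: b_def)
  have B'i: "pbd 1 1 B'" unfolding B'_def by (intro pbd_prod1 linb)
  have \<Psi>m: "lead_coeff \<Psi> = 1" unfolding \<Psi>_def by (simp add: lead_coeff_prod lead_coeff_cyc)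
  have \<Psi>i: "pbd 1 1 \<Psi>" unfolding \<Psi>_def by (intro pbd_prod1 pbd_cyc a)
  have cyc_nz: "cyc x \<noteq> 0" for x using lead_coeff_cyc[of x] by auto
  have \<Psi>d: "degree \<Psi> = (p - 1) * card J'"
    unfolding \<Psi>_def by (subst degree_prod_sum_eq) (auto simp: degree_cyc cyc_nz)
  have \<Psi>z: "icong \<Psi> (zz ^ ((p - 1) * card J'))"
    unfolding \<Psi>_def power_mult by (intro icong_prod_power pbd_power1 pbd_zz pbd_cyc icong_cyc a)
  have "comax [:- b l, 1:] \<Psi>" for l
    unfolding \<Psi>_def by (intro comax_prod comax_linear cyc_at_unit1_nz) (auto simp: a b_def)
  then have "comax \<Psi> (\<Prod>i<e. C i)" unfolding Call by (intro comax_prod) (auto intro: comax_sym)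
  then obtain s Q0 where sQ: "s * \<Psi> + Q0 * (\<Prod>i<e. C i) = 1" unfolding comax_def by blast
  define n where "n = card J' + e - 1"
  have n: "n = card J' + (card J - 1) div (p - 1)" unfolding n_def e_def h_def by simp
  obtain G X Y where GXY: "unitlike G" "pbd 1 1 X" "pbd 1 1 Y"
    "smult (of_nat p ^ n) G = X * \<Psi> + Y * (\<Prod>i<e. C i)"
    using ideal_power_p[of J' a C e] fJ a eisenC unfolding \<Psi>_def n_def by blast
  have "G * smult (of_nat p ^ n) Q0 = smult (of_nat p ^ n) G * Q0" by simp
  also have "\<dots> = (X * Q0) * \<Psi> + Y * (Q0 * (\<Prod>i<e. C i))" unfolding GXY(4) by (simp add: algebra_simps)
  also have "Q0 * (\<Prod>i<e. C i) = 1 - s * \<Psi>" using sQ by (simp add: algebra_simps)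
  finally have "G * smult (of_nat p ^ n) Q0 - Y = \<Psi> * (X * Q0 - Y * s)" by (simp add: algebra_simps)
  then have "(G * smult (of_nat p ^ n) Q0) mod \<Psi> = Y mod \<Psi>" unfolding mod_eq_dvd_iff by simp
  then have "pbd 1 1 ((smult (of_nat p ^ n) Q0) mod \<Psi>)"
    using unitlike_isometry[OF \<Psi>m \<Psi>i \<Psi>z GXY(1)] pbd_mod[OF \<Psi>m \<Psi>i GXY(3)] by simp
  then have "pbd 1 1 (smult (of_nat p ^ n) (Q0 mod \<Psi>))" by (simp add: mod_smult_left)
  then have "pbd 1 (real p ^ n * 1) (smult (1 / of_nat p ^ n) (smult (of_nat p ^ n) (Q0 mod \<Psi>)))"
    by (rule pbd_smult) (simp add: nk_divide nk_power nk_p power_divide)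
  then have Q0b: "pbd 1 (real p ^ n) (Q0 mod \<Psi>)" using p_nz by simp
  \<comment> \<open>As \<open>Q0\<close> inverts \<open>B * B'\<close>, the product
    \<open>B' * Q0\<close> inverts B alone. Reduction modulo \<open>\<Psi>\<close> gives the degree
    bound, and the sign makes 1 + B Q vanish modulo \<open>\<Psi>\<close>.\<close>
  define Q where "Q = - ((B' * (Q0 mod \<Psi>)) mod \<Psi>)"
  have Qb: "pbd 1 (real p ^ n) Q"
    unfolding Q_def using pbd_minus pbd_mod[OF \<Psi>m \<Psi>i] pbd_mult[OF B'i Q0b] by simp
  have \<Psi>0: "\<Psi> \<noteq> 0" using \<Psi>m by auto
  have Qd: "Q = 0 \<or> degree Q < (p - 1) * card J'"
    unfolding Q_def \<Psi>d[symmetric] using degree_mod_less[OF \<Psi>0] by (metis degree_minus neg_equal_0_iff_equal)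
  have "\<Psi> dvd Q + B' * Q0"
  proof -
    have "\<Psi> dvd B' * (Q0 mod \<Psi>) - B' * Q0" by (metis mod_eq_dvd_iff mod_mult_right_eq)
    moreover have "\<Psi> dvd (B' * (Q0 mod \<Psi>)) mod \<Psi> - B' * (Q0 mod \<Psi>)" by (metis mod_eq_dvd_iff mod_mod_trivial)
    ultimately have "\<Psi> dvd (B' * (Q0 mod \<Psi>) - B' * Q0) + ((B' * (Q0 mod \<Psi>)) mod \<Psi> - B' * (Q0 mod \<Psi>))" by (rule dvd_add)
    then show ?thesis unfolding Q_def by (subst dvd_minus_iff[symmetric]) (simp add: algebra_simps)
  qed
  then have "\<Psi> dvd B * (Q + B' * Q0) + s * \<Psi>" by simp
  moreover have "B * (Q + B' * Q0) + s * \<Psi> = 1 + B * Q"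
    using sQ unfolding CB by (simp add: algebra_simps)
  ultimately have "\<Psi> dvd 1 + B * Q" by simp
  then have "\<forall>j\<in>J'. cyc (a j) dvd 1 + B * Q"
    unfolding \<Psi>_def using fJ by (meson dvd_prodI dvd_trans)
  then show ?thesis using Qb Qd unfolding n B_def by blast
qed

end

section \<open>The polynomials \<open>xit\<close>\<close>

locale padic_gen = padic p nk for p and nk :: "'k::field_char_0 \<Rightarrow> real" +
  fixes u :: 'k
  assumes u: "top_gen p nk u"
begin

lemma unit1_u: "unit1 u"
  using u unfolding top_gen_def unit1_def by blast

lemma u_nz: "u \<noteq> 0"
  using unit1_nz unit1_u by blast

text \<open>If u had finite order its powers would form a finite set, and density would force all of
  1 + p Z_p into it, although the elements 1 + p n are infinitely many.\<close>

lemma u_powi_neq_1: assumes "K \<noteq> 0" shows "u powi K \<noteq> 1"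
proof
  assume K: "u powi K = 1"
  define S where "S = (\<lambda>r. u powi r) ` {0..<\<bar>K\<bar>}"
  have pw: "u powi n \<in> S" for n
  proof -
    have "n = K * (n div K) + n mod K" by simp
    then have 1: "u powi n = u powi (n mod K)"
      using K u_nz by (metis mult_1 power_int_1_left power_int_add power_int_mult)
    have 2: "u powi (n mod \<bar>K\<bar>) = u powi n"
    proof (cases "K > 0")
      case True then show ?thesis using 1 by simp
    next
      case False
      have "n = \<bar>K\<bar> * (n div \<bar>K\<bar>) + n mod \<bar>K\<bar>" by simp
      moreover have "u powi \<bar>K\<bar> = 1" using K False by (simp add: power_int_minus)
      ultimately show ?thesis
        using u_nz by (metis mult_1 power_int_1_left power_int_add power_int_mult)
    qed
    show ?thesis unfolding S_def 2[symmetric] using assms by auto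
  qed
  have fS: "finite S" unfolding S_def by simp
  have in_S: "x \<in> S" if x: "unit1 x" for x
  proof (rule ccontr)
    assume nx: "x \<notin> S"
    \<comment> \<open>At most the distance from x to the finite set of powers, so density
      contradicts it.\<close>
    define \<epsilon> where "\<epsilon> = Min (insert 1 ((\<lambda>s. nk (s - x)) ` S))"
    have "\<epsilon> > 0" unfolding \<epsilon>_def using fS nx by (auto intro!: nk_pos)
    then obtain n :: int where "nk (u powi n - x) < \<epsilon>"
      using u x unfolding top_gen_def unit1_def by blast
    moreover have "\<epsilon> \<le> nk (u powi n - x)" unfolding \<epsilon>_def using fS pw[of n] by (auto intro!: Min_le)
    ultimately show False by simp
  qed
  have "unit1 (1 + of_nat p * of_nat n)" for n
    unfolding unit1_def using nk_dvd[of "p * n"] by simp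
  then have "range (\<lambda>n. 1 + of_nat p * of_nat n :: 'k) \<subseteq> S" using in_S by blast
  moreover have "inj (\<lambda>n. 1 + of_nat p * of_nat n :: 'k)" using p_nz by (auto intro!: injI)
  ultimately show False using fS finite_imageD finite_subset infinite_UNIV_nat by blast
qed

section \<open>The variable y and the twisted moduli\<close>

abbreviation Yy :: "nat \<Rightarrow> 'k poly" where "Yy n \<equiv> [:1, 1:] ^ (p ^ n)"

text \<open>Indices are shifted by one against the level: \<open>Yy n\<close> and
  \<open>aa n j\<close> serve \<open>xit\<close> at level \<open>Suc n\<close>. Twisting by j
  divides \<open>Yy n\<close> by \<open>aa n j\<close>.\<close>

definition aa :: "nat \<Rightarrow> int \<Rightarrow> 'k" where "aa n j = u powi (j * int p ^ n)"

lemma unit1_aa: "unit1 (aa n j)"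
  unfolding aa_def by (intro unit1_powi unit1_u)

lemma aa_nz: "aa n j \<noteq> 0"
  using unit1_aa unit1_nz by blast

lemma aa_Suc: "aa (Suc n) j = aa n j ^ p"
  unfolding aa_def by (simp add: power_int_mult[symmetric] mult_ac flip: power_int_of_nat)

lemma aa_inj: assumes "i \<noteq> j" shows "aa n i \<noteq> aa n j"
proof
  assume "aa n i = aa n j"
  then have "u powi (i * int p ^ n - j * int p ^ n) = 1"
    unfolding aa_def using u_nz by (simp add: power_int_diff)
  then show False
    using u_powi_neq_1[of "i * int p ^ n - j * int p ^ n"] assms p_ge3 by (auto simp flip: left_diff_distrib)
qed

lemma pcompose_power: "pcompose (f ^ n) g = pcompose f g ^ n" for f :: "'a::comm_semiring_1 poly"
  by (induction n) (auto simp: pcompose_mult pcompose_1)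

lemma twist_Y: "pcompose (Yy n) [:u powi (- j) - 1, u powi (- j):] = smult (inverse (aa n j)) (Yy n)"
proof -
  have "pcompose [:1, 1:] [:u powi (- j) - 1, u powi (- j):] = smult (u powi (- j)) [:1, 1:]"
    by (simp add: pcompose_pCons)
  moreover have "(u powi (- j)) ^ (p ^ n) = inverse (aa n j)"
    unfolding aa_def by (simp add: power_int_mult power_int_minus power_inverse power_int_inverse flip: power_int_of_nat)
  ultimately show ?thesis unfolding pcompose_power by (simp only: smult_power)
qed

lemma twist_omega: "twist u j (omega p n) = smult (inverse (aa n j)) (Yy n) - 1"
  unfolding twist_def omega_def by (simp add: pcompose_diff pcompose_1 twist_Y)

lemma twist_omega_aa: "smult (aa n j) (twist u j (omega p n)) = pcompose [:- aa n j, 1:] (Yy n)"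
  unfolding twist_omega using aa_nz by (simp add: smult_diff_right pcompose_pCons one_pCons)

lemma twist_omega_Suc_aa:
  "smult (aa (Suc n) j) (twist u j (omega p (Suc n))) = pcompose ([:- aa n j, 1:] * cyc (aa n j)) (Yy n)"
  unfolding twist_omega_aa cyc_times
  by (simp add: aa_Suc pcompose_pCons pcompose_diff pcompose_power mult.commute flip: power_mult)

lemma degree_Y: "degree (Yy n) = p ^ n"
  by (rule degree_linear_power)

lemma degree_twist_omega: "degree (twist u j (omega p n)) = p ^ n"
proof -
  have "degree (smult (aa n j) (twist u j (omega p n))) = p ^ n"
    unfolding twist_omega_aa by (simp add: degree_pcompose degree_Y)
  then show ?thesis using aa_nz by simp
qed

lemma twist_omega_nz: "twist u j (omega p n) \<noteq> 0"
  using degree_twist_omega[of j n] p_ge3 by (metis degree_0 not_numeral_le_zero power_eq_0_iff)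

lemma xi_Suc: "xi p (Suc n) = pcompose (cyc 1) (Yy n :: 'k poly)"
proof -
  have t0: "twist u 0 f = f" for f :: "'k poly" unfolding twist_def by simp
  have a0: "aa m 0 = 1" for m unfolding aa_def by simp
  have 1: "omega p n = pcompose [:-1, 1:] (Yy n :: 'k poly)" using twist_omega_aa[of n 0] by (simp add: t0 a0)
  have "omega p (Suc n) = omega p n * pcompose (cyc 1) (Yy n :: 'k poly)"
    using twist_omega_Suc_aa[of n 0] unfolding t0 a0 1 pcompose_mult by simp
  moreover have "omega p n \<noteq> (0 :: 'k poly)" using twist_omega_nz[of 0 n] by (simp add: t0)
  ultimately show ?thesis unfolding xi_def by simp
qed

definition cycn :: "'k \<Rightarrow> 'k poly" where
  "cycn a = smult (1 / (of_nat p * a ^ (p - 1))) (cyc a)"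

lemma twist_xi_Suc: "smult (1 / of_nat p) (twist u j (xi p (Suc n))) = pcompose (cycn (aa n j)) (Yy n)"
proof -
  let ?a = "aa n j"
  have "twist u j (xi p (Suc n)) = pcompose (cyc 1) (pcompose [:0, inverse ?a:] (Yy n))"
    unfolding xi_Suc twist_def by (simp add: pcompose_assoc[symmetric] twist_Y pcompose_pCons mult.commute)
  also have "\<dots> = pcompose (pcompose (cyc 1) [:0, inverse ?a:]) (Yy n)" by (rule pcompose_assoc)
  also have "pcompose (cyc 1) [:0, inverse ?a:] = smult (1 / ?a ^ (p - 1)) (cyc ?a)"
  proof (rule poly_eqI)
    fix i
    have "inverse ?a ^ i = ?a ^ (p - Suc i) / ?a ^ (p - 1)" if "i < p"
    proof -
      have "p - 1 = (p - Suc i) + i" using that by simp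
      then show ?thesis using aa_nz[of n j] by (simp add: power_add field_simps)
    qed
    then show "coeff (pcompose (cyc 1) [:0, inverse ?a:]) i = coeff (smult (1 / ?a ^ (p - 1)) (cyc ?a)) i"
      by (simp add: coeff_pcompose_linear coeff_cyc)
  qed
  finally show ?thesis unfolding cycn_def by (simp add: pcompose_smult mult.commute)
qed

text \<open>Because of this normalisation the values prescribed for j in J' and for j in J - J'
  agree on the linear factor y - a: the single condition of being 1 modulo B covers both.\<close>

lemma poly_cycn: assumes "a \<noteq> 0" shows "poly (cycn a) a = 1"
proof -
  have "a ^ (p - Suc i) * a ^ i = a ^ (p - 1)" if "i < p" for i
    using that by (simp flip: power_add)
  then have "poly (cyc a) a = of_nat p * a ^ (p - 1)" by (simp add: poly_cyc)
  then show ?thesis unfolding cycn_def using assms p_nz by simp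
qed

text \<open>Both are a scalar multiple of the same power of 1 + x, minus 1. The scalars differ since
  u has infinite order, so a combination is a non-zero constant.\<close>

lemma comax_twist_omega: assumes "i \<noteq> j" shows "comax (twist u i (omega p n)) (twist u j (omega p n))"
proof -
  let ?c = "1 / (aa n j - aa n i)"
  have c: "aa n j - aa n i \<noteq> 0" using aa_inj[OF assms] by (metis eq_iff_diff_eq_0)
  have "[:aa n i * ?c:] * twist u i (omega p n) + [:- aa n j * ?c:] * twist u j (omega p n) = [:?c * (aa n j - aa n i):]"
    unfolding twist_omega using aa_nz[of n i] aa_nz[of n j]
    by (simp add: smult_diff_right one_pCons right_diff_distrib)
  then show ?thesis unfolding comax_def using c by (metis nonzero_eq_divide_eq one_pCons)
qed

lemma twist_omega_dvd_Suc: "twist u j (omega p n) dvd twist u j (omega p (Suc n))"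
proof -
  have "smult (aa n j) (twist u j (omega p n)) dvd smult (aa (Suc n) j) (twist u j (omega p (Suc n)))"
    unfolding twist_omega_aa[of n] twist_omega_Suc_aa pcompose_mult by simp
  then show ?thesis using aa_nz by (simp add: smult_dvd_iff dvd_smult_iff)
qed

lemma pcompose_dvd: "f dvd g \<Longrightarrow> pcompose f h dvd pcompose g h" for f g h :: "'a::comm_semiring_1 poly"
  by (auto elim!: dvdE simp: pcompose_mult)

text \<open>The uniqueness half of the Chinese remainder theorem: each modulus divides a twisted
  \<open>omega p (Suc n)\<close>, so the moduli are pairwise comaximal, and their degrees add up to
  exactly the degree bound.\<close>

lemma xit_unique:
  assumes J: "finite J" "J' \<subseteq> J" "card J \<ge> 1"
    and f: "degree f < ((p - 1) * card J' + card J) * p ^ n"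
      "\<And>j. j \<in> J' \<Longrightarrow> f mod twist u j (omega p (Suc n)) = F j mod twist u j (omega p (Suc n))"
      "\<And>j. j \<in> J - J' \<Longrightarrow> f mod twist u j (omega p n) = 1 mod twist u j (omega p n)"
    and g: "degree g < ((p - 1) * card J' + card J) * p ^ n"
      "\<And>j. j \<in> J' \<Longrightarrow> g mod twist u j (omega p (Suc n)) = F j mod twist u j (omega p (Suc n))"
      "\<And>j. j \<in> J - J' \<Longrightarrow> g mod twist u j (omega p n) = 1 mod twist u j (omega p n)"
  shows "f = g"
proof (rule ccontr)
  assume "f \<noteq> g"
  then have fg: "f - g \<noteq> 0" by simp
  define M where "M j = (if j \<in> J' then twist u j (omega p (Suc n)) else twist u j (omega p n))" for j
  have Mdvd: "M j dvd twist u j (omega p (Suc n))" for j unfolding M_def using twist_omega_dvd_Suc by auto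
  have "prod M J dvd f - g"
  proof (rule comax_prod_dvd)
    show "comax (M i) (M j)" if "i \<noteq> j" for i j
      using comax_dvd[OF comax_twist_omega[OF that, of "Suc n"]] Mdvd by blast
    show "M j dvd f - g" if "j \<in> J" for j
      unfolding M_def using that f g by (auto simp: mod_eq_dvd_iff[symmetric])
  qed (use J in auto)
  then have "degree (prod M J) \<le> degree (f - g)" using fg by (rule dvd_imp_degree_le)
  moreover have "degree (f - g) < ((p - 1) * card J' + card J) * p ^ n"
    using f(1) g(1) by (rule degree_diff_less)
  moreover have "degree (prod M J) = (\<Sum>j\<in>J. degree (M j))"
    by (rule degree_prod_sum_eq) (simp add: M_def twist_omega_nz)
  moreover have "(\<Sum>j\<in>J. degree (M j)) = ((p - 1) * card J' + card J) * p ^ n"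
  proof -
    have "(\<Sum>j\<in>J. degree (M j)) = (\<Sum>j\<in>J. p ^ n + (if j \<in> J' then (p - 1) * p ^ n else 0))"
      by (rule sum.cong) (use p_ge3 in \<open>auto simp: M_def degree_twist_omega algebra_simps\<close>)
    also have "\<dots> = card J * p ^ n + (\<Sum>j\<in>J \<inter> J'. (p - 1) * p ^ n)"
      unfolding sum.inter_restrict[OF J(1)] sum.distrib by simp
    also have "J \<inter> J' = J'" using J by blast
    finally show ?thesis by (simp add: algebra_simps)
  qed
  ultimately show False by simp
qed

text \<open>In the variable y the modulus for j in J' splits into y - a and \<open>cyc a\<close>, on
  which the prescribed values are 1 and 0; the other moduli are y - a with value 1. So a polynomial
  in y is wanted that is 1 modulo B and 0 modulo the cyclotomic factors, as 1 + B Q is.\<close>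

lemma xit_Suc:
  assumes J: "J = {jl..jr}" "card J \<ge> 1" and J': "J' \<subseteq> J"
  shows "\<exists>Q. pbd 1 (real p ^ (card J' + (card J - 1) div (p - 1))) Q \<and>
    xit p u (Suc n) J' J = pcompose (1 + (\<Prod>i\<in>J. [:- aa n i, 1:]) * Q) (Yy n)"
proof -
  obtain Q where Q: "pbd 1 (real p ^ (card J' + (card J - 1) div (p - 1))) Q"
    "Q = 0 \<or> degree Q < (p - 1) * card J'"
    "\<forall>j\<in>J'. cyc (aa n j) dvd 1 + (\<Prod>i\<in>J. [:- aa n i, 1:]) * Q"
    using interpolation_bound[of "aa n", OF unit1_aa J J'] by blast
  define B where "B = (\<Prod>i\<in>J. [:- aa n i, 1:])"
  define R where "R = 1 + B * Q"
  define f where "f = pcompose R (Yy n)"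
  have fJ: "finite J" using J by simp
  have dB: "degree B = card J"
    unfolding B_def by (subst degree_prod_sum_eq) auto
  have degR: "degree R < (p - 1) * card J' + card J"
  proof (cases "Q = 0")
    case True then show ?thesis unfolding R_def using J(2) by simp
  next
    case False
    have "degree (B * Q) < (p - 1) * card J' + card J"
      using False Q(2) dB degree_mult_le[of B Q] by linarith
    then show ?thesis unfolding R_def using J(2) by (intro degree_add_less) auto
  qed
  have Lcyc: "comax [:- aa n j, 1:] (cyc (aa n j))" for j
    by (intro comax_linear cyc_at_unit1_nz unit1_aa)
  have LB: "[:- aa n j, 1:] dvd B" if "j \<in> J" for j unfolding B_def by (rule dvd_prodI[OF fJ that])
  have 1: "degree f < ((p - 1) * card J' + card J) * p ^ n"
    unfolding f_def degree_pcompose degree_Y using degR p_ge3 by simp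
  have 2: "f mod twist u j (omega p (Suc n)) = smult (1 / of_nat p) (twist u j (xi p (Suc n))) mod twist u j (omega p (Suc n))"
    if j: "j \<in> J'" for j
  proof -
    have "[:- aa n j, 1:] dvd cycn (aa n j) - 1"
      by (subst poly_eq_0_iff_dvd[symmetric]) (simp add: poly_cycn aa_nz)
    moreover have "[:- aa n j, 1:] dvd R - 1" unfolding R_def using LB J' j by auto
    ultimately have "[:- aa n j, 1:] dvd (R - 1) - (cycn (aa n j) - 1)" using dvd_diff by blast
    then have a: "[:- aa n j, 1:] dvd R - cycn (aa n j)" by simp
    have b: "cyc (aa n j) dvd R - cycn (aa n j)"
      using Q(3) j unfolding R_def B_def cycn_def by (intro dvd_diff) (auto intro: dvd_smult)
    have "pcompose ([:- aa n j, 1:] * cyc (aa n j)) (Yy n) dvd pcompose (R - cycn (aa n j)) (Yy n)"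
      by (intro pcompose_dvd comax_dvd_mult Lcyc a b)
    then show ?thesis
      unfolding twist_omega_Suc_aa[symmetric] mod_eq_dvd_iff twist_xi_Suc f_def
      using aa_nz by (simp add: smult_dvd_iff pcompose_diff)
  qed
  have 3: "f mod twist u j (omega p n) = 1 mod twist u j (omega p n)" if j: "j \<in> J - J'" for j
  proof -
    have "[:- aa n j, 1:] dvd R - 1" unfolding R_def using LB j by auto
    then have "pcompose [:- aa n j, 1:] (Yy n) dvd pcompose (R - 1) (Yy n)" by (rule pcompose_dvd)
    then show ?thesis
      unfolding twist_omega_aa[symmetric] mod_eq_dvd_iff f_def
      using aa_nz by (simp add: smult_dvd_iff pcompose_diff pcompose_1)
  qed
  have "xit p u (Suc n) J' J = f"
    unfolding xit_def diff_Suc_1 if_not_P[OF Suc_not_Zero]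
  proof (rule the_equality)
    show "degree f < ((p - 1) * card J' + card J) * p ^ n \<and>
      (\<forall>j\<in>J'. f mod twist u j (omega p (Suc n)) =
                  smult (1 / of_nat p) (twist u j (xi p (Suc n))) mod twist u j (omega p (Suc n))) \<and>
      (\<forall>j\<in>J - J'. f mod twist u j (omega p n) = 1 mod twist u j (omega p n))"
      using 1 2 3 by blast
  qed (rule xit_unique[OF fJ J' J(2) _ _ _ 1 2 3], blast+)
  then show ?thesis using Q(1) unfolding f_def R_def B_def by blast
qed

section \<open>Norms of \<open>xit\<close> on the unit disc and on smaller discs\<close>

lemma pbd_Y: "pbd 1 1 (Yy n)"
  by (intro pbd_power1 pbd_linear) auto

lemma p_power_ge1: "1 \<le> real p ^ n"
  using p_gt1 by (intro one_le_power) simp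

lemma ell0_bound: "pbd 1 1 (ell0 p u S)"
  unfolding ell0_def
proof (rule pbd_prod1)
  fix j
  have e: "smult (1 / of_nat p) (twist u j (xi p 0)) = [:u powi (- j) - 1, u powi (- j):]"
    unfolding twist_def xi_def using p_nz by (simp add: pcompose_pCons)
  have un: "unit1 (u powi (- j))" by (intro unit1_powi unit1_u)
  have "nk (u powi (- j) - 1) \<le> 1" using un inv_p(3) unfolding unit1_def by (rule order_trans)
  then show "pbd 1 1 (smult (1 / of_nat p) (twist u j (xi p 0)))"
    unfolding e using unit1_nk[OF un] by (intro pbd_linear) simp_all
qed

lemma xit_bound:
  assumes J: "J = {jl..jr}" "card J \<ge> 1" and J': "J' \<subseteq> J"
  shows "pbd 1 (real p ^ (card J' + (card J - 1) div (p - 1))) (xit p u n J' J)"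
proof (cases n)
  case 0
  then show ?thesis using bd_mono[OF ell0_bound p_power_ge1] by (simp add: xit_def)
next
  case (Suc m)
  obtain Q where Q: "pbd 1 (real p ^ (card J' + (card J - 1) div (p - 1))) Q"
    "xit p u (Suc m) J' J = pcompose (1 + (\<Prod>i\<in>J. [:- aa m i, 1:]) * Q) (Yy m)"
    using xit_Suc[OF assms] by blast
  have "pbd 1 1 (\<Prod>i\<in>J. [:- aa m i, 1:])"
    using unit1_nk[OF unit1_aa] by (intro pbd_prod1 pbd_linear) auto
  then have "pbd 1 (real p ^ (card J' + (card J - 1) div (p - 1))) ((\<Prod>i\<in>J. [:- aa m i, 1:]) * Q)"
    using pbd_mult[of 1 1 "\<Prod>i\<in>J. [:- aa m i, 1:]", OF _ Q(1)] by simp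
  then show ?thesis unfolding Suc Q(2)
    by (intro pbd_pcompose pbd_Y pbd_add pbd_1 p_power_ge1) auto
qed

text \<open>The radii \<rho>^(1/p^k) of the definition of slope, for \<rho> = 1/p. At radius
  \<open>rr k\<close> the bound for the twists of \<open>omega p n\<close> changes its law at n = k,
  where it reaches 1/p.\<close>

definition rr :: "nat \<Rightarrow> real" where "rr k = (1 / real p) powr (1 / real p ^ k)"

lemma rr_pos: "rr k > 0" and rr_lt1: "rr k < 1"
proof -
  show "rr k > 0" unfolding rr_def using p_pos by simp
  show "rr k < 1" unfolding rr_def using p_gt1 powr_less_mono2[of "1 / real p ^ k" "1 / real p" 1] by simp
qed

text \<open>In the binomial expansion the terms strictly between the first and the last are
  divisible by p, so the norm is bounded by the larger of M / p and M^p.\<close>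

lemma pbd_one_plus_power:
  fixes X :: "'k poly"
  assumes "pbd r M X" "0 \<le> r" "M \<le> 1" "M / real p \<le> M'" "M ^ p \<le> M'"
  shows "pbd r M' ((1 + X) ^ p - 1)"
proof -
  have M: "0 \<le> M" by (rule bd_nonneg[OF assms(1)])
  have "(1 + X) ^ p = (\<Sum>i\<le>p. of_nat (p choose i) * X ^ i)"
    using binomial_ring[of X 1 p] by (simp add: add.commute)
  also have "\<dots> = (\<Sum>i\<in>insert 0 {1..p}. of_nat (p choose i) * X ^ i)"
    by (rule sum.cong) auto
  also have "\<dots> = 1 + (\<Sum>i\<in>{1..p}. of_nat (p choose i) * X ^ i)" by simp
  also have "(\<Sum>i\<in>{1..p}. of_nat (p choose i) * X ^ i) = (\<Sum>i\<in>{1..p}. smult (of_nat (p choose i)) (X ^ i))"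
    by (rule sum.cong) (simp_all add: of_nat_poly)
  finally have eq: "(1 + X) ^ p - 1 = (\<Sum>i\<in>{1..p}. smult (of_nat (p choose i)) (X ^ i))" by simp
  show ?thesis unfolding eq
  proof (rule pbd_sum)
    fix i assume i: "i \<in> {1..p}"
    note Xi = pbd_power[OF assms(1,2), of i]
    show "pbd r M' (smult (of_nat (p choose i)) (X ^ i))"
    proof (cases "i = p")
      case True
      then show ?thesis using bd_mono[OF Xi, of M'] assms(5) by simp
    next
      case False
      then have "nk (of_nat (p choose i)) \<le> 1 / real p" using i by (intro nk_dvd prime_dvd_binomial) auto
      then have b: "pbd r (1 / real p * M ^ i) (smult (of_nat (p choose i)) (X ^ i))" using Xi by (intro pbd_smult)
      have "1 / real p * M ^ i \<le> 1 / real p * M ^ 1"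
        using i M assms(3) by (intro mult_left_mono power_decreasing) auto
      then have "1 / real p * M ^ i \<le> M'" using assms(4) by simp
      then show ?thesis by (rule bd_mono[OF b])
    qed
  next
    show "0 \<le> M'" using assms(5) M zero_le_power[of M p] by linarith
  qed (rule assms(2))
qed

lemma twist_omega_Suc: "twist u j (omega p (Suc n)) = (1 + twist u j (omega p n)) ^ p - 1"
  unfolding twist_def omega_def
  by (simp add: pcompose_diff pcompose_1 pcompose_power mult.commute flip: power_mult)

text \<open>Up to level k the p-th power term dominates: repeated p-th powers carry the bound
  \<open>rr k\<close> at level 0 to 1/p at level k.\<close>

lemma twist_omega_bound_le:
  assumes "n \<le> k" shows "pbd (rr k) ((1 / real p) powr (1 / real p ^ (k - n))) (twist u j (omega p n))"
  using assms
proof (induction n)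
  case 0
  have un: "unit1 (u powi (- j))" by (intro unit1_powi unit1_u)
  have eq: "twist u j (omega p 0) = [:u powi (- j) - 1, u powi (- j):]"
    unfolding twist_def omega_def by (simp add: pcompose_pCons one_pCons)
  have "1 / real p ^ k \<le> 1" using p_power_ge1 p_pos by simp
  then have "(1 / real p) powr 1 \<le> rr k"
    unfolding rr_def using p_gt1 by (intro powr_mono') auto
  then have "1 / real p \<le> rr k" using p_pos by simp
  then show ?case unfolding eq using un unit1_nk[OF un] unfolding rr_def[symmetric]
    by (intro pbd_linear) (auto simp: unit1_def)
next
  case (Suc n)
  let ?M = "(1 / real p) powr (1 / real p ^ (k - n))"
  have kn: "k - n = Suc (k - Suc n)" using Suc.prems by simp
  have e: "1 / real p ^ (k - Suc n) = real p * (1 / real p ^ (k - n))" unfolding kn using p_pos by simp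
  have Mp: "?M ^ p = (1 / real p) powr (1 / real p ^ (k - Suc n))"
  proof -
    have "?M ^ p = ?M powr real p" by (rule powr_realpow[symmetric]) (use p_pos in simp)
    also have "\<dots> = (1 / real p) powr ((1 / real p ^ (k - n)) * real p)" by (rule powr_powr)
    finally show ?thesis unfolding e by (simp only: mult.commute)
  qed
  have "?M / real p = (1 / real p) powr (1 + 1 / real p ^ (k - n))"
    using p_pos by (simp add: powr_add)
  also have "\<dots> \<le> (1 / real p) powr (1 / real p ^ (k - Suc n))"
  proof (rule powr_mono')
    \<comment> \<open>The inequality M / p \<le> M^p on the level of exponents; it rests on k - n
      \<ge> 1.\<close>
    have "(real p - 1) * (1 / real p ^ (k - n)) \<le> 1"
    proof -
      have "real p * 1 \<le> real p * real p ^ (k - Suc n)"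
        using p_power_ge1[of "k - Suc n"] p_pos by (intro mult_left_mono) auto
      then have "real p - 1 \<le> real p ^ (k - n)" unfolding kn by simp
      then show ?thesis using p_pos by (simp add: divide_le_eq)
    qed
    then show "1 / real p ^ (k - Suc n) \<le> 1 + 1 / real p ^ (k - n)" unfolding e by (simp add: diff_divide_distrib)
  qed (use p_gt1 in auto)
  finally have Md: "?M / real p \<le> (1 / real p) powr (1 / real p ^ (k - Suc n))" .
  have M1: "?M \<le> 1" using p_gt1 by (intro powr_le1) auto
  show ?case unfolding twist_omega_Suc
    using Suc rr_pos[of k] M1 Md Mp by (intro pbd_one_plus_power[where M = ?M]) auto
qed

text \<open>From level k on the bound is at most 1/p, the terms divisible by p dominate, and each
  level gains a factor p.\<close>

lemma twist_omega_bound: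
  assumes "k \<le> n" shows "pbd (rr k) (1 / real p ^ (n - k + 1)) (twist u j (omega p n))"
  using assms
proof (induction n rule: dec_induct)
  case base
  show ?case using twist_omega_bound_le[of k k] p_pos by simp
next
  case (step n)
  let ?M = "1 / real p ^ (n - k + 1)"
  have M: "0 \<le> ?M" "?M \<le> 1" using p_power_ge1[of "n - k + 1"] p_pos by (simp_all del: power_Suc)
  have sk: "Suc n - k + 1 = Suc (n - k + 1)" using step by simp
  have "?M ^ p \<le> ?M ^ 2" using M p_ge3 by (intro power_decreasing) auto
  also have "\<dots> \<le> ?M / real p"
    using p_power_ge1[of "n - k"] p_pos by (simp add: power2_eq_square field_simps)
  finally have "?M ^ p \<le> ?M / real p" .
  moreover have e: "1 / real p ^ (Suc n - k + 1) = ?M / real p" unfolding sk by simp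
  ultimately show ?case unfolding twist_omega_Suc e
    by (intro pbd_one_plus_power[OF step.IH _ M(2)]) (use rr_pos[of k] in simp_all)
qed

text \<open>Each of the h factors y - a of B is a twisted omega up to a unit and contributes 1 /
  p^(m - k). The constant is the same for all k, m and J', which is what splitting the product at a
  variable point requires.\<close>

lemma xit_minus_1_bound:
  assumes J: "J = {jl..jr}" "card J \<ge> 1" and J': "J' \<subseteq> J" and k: "k \<le> m"
  shows "pbd (rr k) (real p ^ (card J + (card J - 1) div (p - 1)) * (1 / real p ^ (m - k)) ^ card J) (xit p u m J' J - 1)"
proof (cases m)
  case 0
  have "pbd 1 (real p ^ (card J + (card J - 1) div (p - 1))) (ell0 p u J' - 1)"
    by (intro pbd_diff pbd_1 bd_mono[OF ell0_bound] p_power_ge1) simp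
  then show ?thesis using 0 k rr_pos[of k] rr_lt1[of k]
    by (auto simp: xit_def intro: bd_radius)
next
  case (Suc n)
  obtain Q where Q: "pbd 1 (real p ^ (card J' + (card J - 1) div (p - 1))) Q"
    "xit p u (Suc n) J' J = pcompose (1 + (\<Prod>i\<in>J. [:- aa n i, 1:]) * Q) (Yy n)"
    using xit_Suc[OF J J'] by blast
  have eq: "xit p u m J' J - 1 = (\<Prod>i\<in>J. pcompose [:- aa n i, 1:] (Yy n)) * pcompose Q (Yy n)"
    unfolding Suc Q(2) pcompose_add pcompose_1 pcompose_mult pcompose_prod by simp
  have Yr: "pbd (rr k) 1 (Yy n)" using bd_radius[OF pbd_Y] rr_pos[of k] rr_lt1[of k] by simp
  have L: "pbd (rr k) (1 / real p ^ (m - k)) (pcompose [:- aa n i, 1:] (Yy n))" for i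
  proof (cases "k \<le> n")
    case True
    have "m - k = n - k + 1" using True Suc by simp
    then show ?thesis
      unfolding twist_omega_aa[symmetric]
      using pbd_smult[OF twist_omega_bound[OF True], of "aa n i" 1] unit1_nk[OF unit1_aa] by simp
  next
    \<comment> \<open>Here k = m, no gain is claimed, and integrality suffices.\<close>
    case False
    then have "m - k = 0" using Suc by simp
    moreover have "pbd 1 1 [:- aa n i, 1:]" using unit1_nk[OF unit1_aa] by (intro pbd_linear) auto
    ultimately show ?thesis using Yr rr_pos[of k] by (auto intro!: pbd_pcompose)
  qed
  have "pbd (rr k) ((\<Prod>i\<in>J. 1 / real p ^ (m - k)) * real p ^ (card J' + (card J - 1) div (p - 1)))
    ((\<Prod>i\<in>J. pcompose [:- aa n i, 1:] (Yy n)) * pcompose Q (Yy n))"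
    using rr_pos[of k] by (intro pbd_mult pbd_prod L pbd_pcompose Q(1) Yr) auto
  moreover have "card J' \<le> card J" using J J' by (intro card_mono) auto
  then have "real p ^ (card J' + (card J - 1) div (p - 1)) \<le> real p ^ (card J + (card J - 1) div (p - 1))"
    using p_gt1 by (intro power_increasing) auto
  then have "(\<Prod>i\<in>J. 1 / real p ^ (m - k)) * real p ^ (card J' + (card J - 1) div (p - 1))
     \<le> real p ^ (card J + (card J - 1) div (p - 1)) * (1 / real p ^ (m - k)) ^ card J"
    by (subst mult.commute) (auto intro!: mult_mono)
  ultimately show ?thesis unfolding eq by (rule bd_mono)
qed

end

section \<open>Polynomial dependence, limits and growth\<close>

definition madd :: "(nat \<times> nat \<Rightarrow> nat) \<Rightarrow> (nat \<times> nat \<Rightarrow> nat) \<Rightarrow> nat \<times> nat \<Rightarrow> nat" where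
  "madd m1 m2 = (\<lambda>ij. m1 ij + m2 ij)"

lemma monomsI:
  "(\<And>ij. m ij \<noteq> 0 \<Longrightarrow> fst ij < snd ij \<and> snd ij < d) \<Longrightarrow> (\<Sum>ij\<in>{..<d} \<times> {..<d}. m ij) \<le> k \<Longrightarrow> m \<in> monoms d k"
  unfolding monoms_def by blast

lemma monomsD:
  assumes "m \<in> monoms d k"
  shows "m ij \<noteq> 0 \<Longrightarrow> fst ij < snd ij \<and> snd ij < d" "(\<Sum>ij\<in>{..<d} \<times> {..<d}. m ij) \<le> k"
  using assms unfolding monoms_def by blast+

lemma finite_monoms: "finite (monoms d k)"
proof (rule finite_subset)
  show "monoms d k \<subseteq> {f. \<forall>x. (x \<in> {..<d} \<times> {..<d} \<longrightarrow> f x \<in> {..k}) \<and> (x \<notin> {..<d} \<times> {..<d} \<longrightarrow> f x = 0)}"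
  proof (intro subsetI CollectI allI conjI impI)
    fix m x assume m: "m \<in> monoms d k"
    show "m x \<in> {..k}" if x: "x \<in> {..<d} \<times> {..<d}"
    proof -
      have "m x \<le> (\<Sum>ij\<in>{..<d} \<times> {..<d}. m ij)" by (rule member_le_sum[OF x]) simp_all
      then show ?thesis using monomsD(2)[OF m] by simp
    qed
    show "m x = 0" if "x \<notin> {..<d} \<times> {..<d}"
    proof (rule ccontr)
      assume "m x \<noteq> 0"
      then show False using monomsD(1)[OF m, of x] that by (cases x) auto
    qed
  qed
  show "finite {f. \<forall>x. (x \<in> {..<d} \<times> {..<d} \<longrightarrow> f x \<in> {..k}) \<and> (x \<notin> {..<d} \<times> {..<d} \<longrightarrow> f x = (0::nat))}"
    by (rule finite_set_of_finite_funs) simp_all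
qed

lemma monoms_mono: "k \<le> k' \<Longrightarrow> monoms d k \<subseteq> monoms d k'"
  unfolding monoms_def using order_trans by blast

lemma madd_monoms:
  assumes "m1 \<in> monoms d k1" "m2 \<in> monoms d k2" shows "madd m1 m2 \<in> monoms d (k1 + k2)"
proof (rule monomsI)
  fix ij assume "madd m1 m2 ij \<noteq> 0"
  then have "m1 ij \<noteq> 0 \<or> m2 ij \<noteq> 0" unfolding madd_def by simp
  then show "fst ij < snd ij \<and> snd ij < d" using monomsD(1)[OF assms(1)] monomsD(1)[OF assms(2)] by blast
next
  show "(\<Sum>ij\<in>{..<d} \<times> {..<d}. madd m1 m2 ij) \<le> k1 + k2"
    unfolding madd_def sum.distrib by (rule add_mono[OF monomsD(2)[OF assms(1)] monomsD(2)[OF assms(2)]])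
qed

lemma zero_monoms: "(\<lambda>_. 0) \<in> monoms d k"
  unfolding monoms_def by simp

lemma mono_eval_madd: "mono_eval d lam (madd m1 m2) = mono_eval d lam m1 * mono_eval d lam m2"
  unfolding mono_eval_def madd_def by (simp add: power_add prod.distrib)

lemma mono_eval_zero: "mono_eval d lam (\<lambda>_. 0) = 1"
  unfolding mono_eval_def by simp

text \<open>Sorts a product of two expansions by the combined monomial. The ring is left open
  because the values are scalars in \<open>ispoly_mult\<close> and polynomials in x in
  \<open>Ym_expand\<close>.\<close>

lemma convolution_expand:
  fixes e f g :: "'i \<Rightarrow> 'r::comm_ring_1"
  assumes fin: "finite M1" "finite M2" "finite M"
    and cl: "\<And>m1 m2. m1 \<in> M1 \<Longrightarrow> m2 \<in> M2 \<Longrightarrow> op m1 m2 \<in> M"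
    and e: "\<And>m1 m2. e (op m1 m2) = e m1 * e m2"
  shows "(\<Sum>m1\<in>M1. e m1 * f m1) * (\<Sum>m2\<in>M2. e m2 * g m2)
    = (\<Sum>m\<in>M. e m * (\<Sum>m2\<in>M2. (\<Sum>m1\<in>{m1\<in>M1. op m1 m2 = m}. f m1) * g m2))"
proof -
  have "(\<Sum>m\<in>M. e m * (\<Sum>m2\<in>M2. (\<Sum>m1\<in>{m1\<in>M1. op m1 m2 = m}. f m1) * g m2))
     = (\<Sum>m\<in>M. \<Sum>m2\<in>M2. \<Sum>m1\<in>{m1\<in>M1. op m1 m2 = m}. (e m1 * f m1) * (e m2 * g m2))"
    unfolding sum_distrib_left sum_distrib_right
    by (intro sum.cong refl) (auto simp: e mult_ac)
  also have "\<dots> = (\<Sum>m2\<in>M2. \<Sum>m\<in>M. \<Sum>m1\<in>{m1\<in>M1. op m1 m2 = m}. (e m1 * f m1) * (e m2 * g m2))"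
    by (rule sum.swap)
  also have "\<dots> = (\<Sum>m2\<in>M2. \<Sum>m1\<in>M1. (e m1 * f m1) * (e m2 * g m2))"
    by (rule sum.cong[OF refl], rule sum.group) (use fin cl in auto)
  also have "\<dots> = (\<Sum>m1\<in>M1. e m1 * f m1) * (\<Sum>m2\<in>M2. e m2 * g m2)"
    unfolding sum_product by (rule sum.swap)
  finally show ?thesis by simp
qed

section \<open>Polynomial functions of a unipotent matrix\<close>

definition unipotent :: "nat \<Rightarrow> (nat \<Rightarrow> nat \<Rightarrow> 'a::comm_ring_1) \<Rightarrow> bool" where
  "unipotent d lam \<longleftrightarrow> (\<forall>i<d. lam i i = 1) \<and> (\<forall>i j. j < i \<and> i < d \<longrightarrow> lam i j = 0)"

lemma unipotentD:
  assumes "unipotent d lam"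
  shows "i < d \<Longrightarrow> lam i i = 1" "j < i \<Longrightarrow> i < d \<Longrightarrow> lam i j = 0"
  using assms unfolding unipotent_def by blast+

text \<open>The coefficients are quantified before the matrix, and this order expresses that they do
  not depend on \<open>lam\<close>. On unipotent matrices the diagonal and lower entries count as
  constants.\<close>

definition ispoly :: "nat \<Rightarrow> nat \<Rightarrow> ((nat \<Rightarrow> nat \<Rightarrow> 'a::comm_ring_1) \<Rightarrow> 'a) \<Rightarrow> bool" where
  "ispoly d w f \<longleftrightarrow> (\<exists>c. \<forall>lam. unipotent d lam \<longrightarrow> f lam = (\<Sum>m\<in>monoms d w. mono_eval d lam m * c m))"

lemma ispolyI:
  assumes "\<And>lam. unipotent d lam \<Longrightarrow> f lam = (\<Sum>m\<in>monoms d w. mono_eval d lam m * c m)" shows "ispoly d w f"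
  unfolding ispoly_def using assms by (intro exI[of _ c] allI impI)

lemma ispolyE:
  assumes "ispoly d w f"
  obtains c where "\<And>lam. unipotent d lam \<Longrightarrow> f lam = (\<Sum>m\<in>monoms d w. mono_eval d lam m * c m)"
  using assms unfolding ispoly_def by metis

lemma ispoly_cong:
  assumes "\<And>lam. unipotent d lam \<Longrightarrow> f lam = g lam" "ispoly d w g" shows "ispoly d w f"
  using assms(2) by (rule ispolyE) (rule ispolyI, simp add: assms(1))

lemma sum_monoms_delta:
  assumes "m0 \<in> monoms d w"
  shows "(\<Sum>m\<in>monoms d w. g m * (if m = m0 then a else 0)) = g m0 * (a :: 'a::comm_ring_1)"
proof -
  have "(\<Sum>m\<in>monoms d w. g m * (if m = m0 then a else 0)) = (\<Sum>m\<in>monoms d w. if m = m0 then g m * a else 0)"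
    by (rule sum.cong) simp_all
  also have "\<dots> = g m0 * a" using assms by (simp only: sum.delta[OF finite_monoms] if_True)
  finally show ?thesis .
qed

lemma ispoly_const: "ispoly d w (\<lambda>_. a)"
  by (rule ispolyI[where c = "\<lambda>m. if m = (\<lambda>_. 0) then a else 0"])
    (simp only: sum_monoms_delta[OF zero_monoms] mono_eval_zero mult_1)

lemma ispoly_add: assumes "ispoly d w f" "ispoly d w g" shows "ispoly d w (\<lambda>lam. f lam + g lam)"
proof -
  obtain c where c: "\<And>lam. unipotent d lam \<Longrightarrow> f lam = (\<Sum>m\<in>monoms d w. mono_eval d lam m * c m)"
    using ispolyE[OF assms(1)] by blast
  obtain c' where c': "\<And>lam. unipotent d lam \<Longrightarrow> g lam = (\<Sum>m\<in>monoms d w. mono_eval d lam m * c' m)"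
    using ispolyE[OF assms(2)] by blast
  show ?thesis
    by (rule ispolyI[where c = "\<lambda>m. c m + c' m"]) (simp only: c c' distrib_left sum.distrib)
qed

lemma ispoly_sum:
  assumes "finite A" "\<And>i. i \<in> A \<Longrightarrow> ispoly d w (f i)"
  shows "ispoly d w (\<lambda>lam. \<Sum>i\<in>A. f i lam)"
  using assms
proof (induction A rule: finite_induct)
  case empty
  then show ?case using ispoly_const[of d w 0] by simp
next
  case (insert i A)
  then have "ispoly d w (\<lambda>lam. f i lam + (\<Sum>i\<in>A. f i lam))" by (intro ispoly_add) simp_all
  then show ?case using insert by simp
qed

lemma ispoly_mult: assumes "ispoly d w f" "ispoly d w' g" shows "ispoly d (w + w') (\<lambda>lam. f lam * g lam)"
proof -
  obtain c where c: "\<And>lam. unipotent d lam \<Longrightarrow> f lam = (\<Sum>m\<in>monoms d w. mono_eval d lam m * c m)"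
    using ispolyE[OF assms(1)] by blast
  obtain c' where c': "\<And>lam. unipotent d lam \<Longrightarrow> g lam = (\<Sum>m\<in>monoms d w'. mono_eval d lam m * c' m)"
    using ispolyE[OF assms(2)] by blast
  have "(\<Sum>m1\<in>monoms d w. mono_eval d lam m1 * c m1) * (\<Sum>m2\<in>monoms d w'. mono_eval d lam m2 * c' m2)
    = (\<Sum>m\<in>monoms d (w + w'). mono_eval d lam m *
       (\<Sum>m2\<in>monoms d w'. (\<Sum>m1\<in>{m1\<in>monoms d w. madd m1 m2 = m}. c m1) * c' m2))" for lam
    by (rule convolution_expand) (rule finite_monoms madd_monoms mono_eval_madd; assumption?)+
  then show ?thesis
    by (intro ispolyI[where c = "\<lambda>m. \<Sum>m2\<in>monoms d w'. (\<Sum>m1\<in>{m1\<in>monoms d w. madd m1 m2 = m}. c m1) * c' m2"])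
      (simp only: c c')
qed

lemma ispoly_var: assumes "i < j" "j < d" shows "ispoly d (Suc w) (\<lambda>lam. lam i j)"
proof -
  define m0 where "m0 = (\<lambda>ij. if ij = (i, j) then 1 else 0 :: nat)"
  have ij: "(i, j) \<in> {..<d} \<times> {..<d}" using assms by auto
  have m0: "m0 \<in> monoms d (Suc w)"
  proof (rule monomsI)
    show "(\<Sum>x\<in>{..<d} \<times> {..<d}. m0 x) \<le> Suc w" unfolding m0_def by (simp add: sum.delta)
  qed (use assms in \<open>auto simp: m0_def split: if_splits\<close>)
  have "mono_eval d lam m0 = (\<Prod>x\<in>{..<d} \<times> {..<d}. if x = (i, j) then lam i j else 1)" for lam :: "nat \<Rightarrow> nat \<Rightarrow> 'a"
    unfolding mono_eval_def m0_def by (intro prod.cong) auto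
  then have e: "mono_eval d lam m0 = lam i j" for lam :: "nat \<Rightarrow> nat \<Rightarrow> 'a"
    using ij by (simp add: prod.delta)
  show ?thesis
    by (rule ispolyI[where c = "\<lambda>m. if m = m0 then 1 else 0"]) (simp only: sum_monoms_delta[OF m0] e mult_1_right)
qed

text \<open>Measuring degrees by the distance j - i from the diagonal is additive in products of
  triangular matrices, so products of any length stay within degree d - 1.\<close>

lemma ispoly_entry: assumes "i \<le> j" "j < d" shows "ispoly d (j - i) (\<lambda>lam. lam i j)"
proof (cases "i = j")
  case True
  show ?thesis
    by (rule ispoly_cong[OF _ ispoly_const[of d "j - i" 1]]) (use True assms unipotentD(1) in blast)
next
  case False
  then obtain w where "j - i = Suc w" using assms by (cases "j - i") auto
  moreover have "i < j" using False assms by simp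
  ultimately show ?thesis using ispoly_var[of i j d w] assms(2) by simp
qed

section \<open>Matrices compared on the indices below d, inverses and conjugation\<close>

lemma minv_inverse:
  assumes "minvertible d A" shows "meq d (mmul d A (minv d A)) mid" "meq d (mmul d (minv d A) A) mid"
proof -
  have "meq d (mmul d A (minv d A)) mid \<and> meq d (mmul d (minv d A) A) mid"
    using someI_ex[OF assms[unfolded minvertible_def]] unfolding minv_def .
  then show "meq d (mmul d A (minv d A)) mid" "meq d (mmul d (minv d A) A) mid" by (rule conjunct1, rule conjunct2)
qed

lemma mmul_assoc: "mmul d (mmul d A B) C = mmul d A (mmul d B C)"
proof (intro ext)
  fix i j
  have "mmul d (mmul d A B) C i j = (\<Sum>k<d. \<Sum>l<d. A i l * B l k * C k j)"
    unfolding mmul_def by (simp add: sum_distrib_right)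
  also have "\<dots> = (\<Sum>l<d. \<Sum>k<d. A i l * B l k * C k j)" by (rule sum.swap)
  also have "\<dots> = mmul d A (mmul d B C) i j"
    unfolding mmul_def by (simp add: sum_distrib_left mult.assoc)
  finally show "mmul d (mmul d A B) C i j = mmul d A (mmul d B C) i j" .
qed

lemma meq_refl [simp]: "meq d A A" unfolding meq_def by simp
lemma meq_sym: "meq d A B \<Longrightarrow> meq d B A" unfolding meq_def by simp
lemma meq_trans: "meq d A B \<Longrightarrow> meq d B C \<Longrightarrow> meq d A C" unfolding meq_def by simp
lemma meq_mmul: "meq d A A' \<Longrightarrow> meq d B B' \<Longrightarrow> meq d (mmul d A B) (mmul d A' B')"
  unfolding meq_def mmul_def by simp
lemma mmul_mid_left: "meq d (mmul d mid A) A"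
proof -
  have "(\<Sum>k<d. mid i k * A k j) = (\<Sum>k<d. if k = i then A k j else 0)" for i j
    by (intro sum.cong) (auto simp: mid_def)
  then show ?thesis unfolding meq_def mmul_def by simp
qed
lemma mmul_mid_right: "meq d (mmul d A mid) A"
proof -
  have "(\<Sum>k<d. A i k * mid k j) = (\<Sum>k<d. if k = j then A i k else 0)" for i j
    by (intro sum.cong) (auto simp: mid_def)
  then show ?thesis unfolding meq_def mmul_def by simp
qed

text \<open>The left inverse of a unipotent matrix, solved column by column. Unlike the choice made
  in \<open>minv\<close>, the recursion exhibits the entries as polynomials in those of
  \<open>lam\<close>.\<close>

fun uinv :: "(nat \<Rightarrow> nat \<Rightarrow> 'a::comm_ring_1) \<Rightarrow> nat \<Rightarrow> nat \<Rightarrow> 'a" where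
  "uinv lam k j = mid k j - (\<Sum>l<j. uinv lam k l * lam l j)"

declare uinv.simps [simp del]

lemma uinv_lower: "j < k \<Longrightarrow> uinv lam k j = 0"
proof (induction j rule: less_induct)
  case (less j)
  have "(\<Sum>l<j. uinv lam k l * lam l j) = 0"
    by (rule sum.neutral) (use less in simp)
  then show ?case using uinv.simps[of lam k j] less.prems by (simp add: mid_def)
qed

lemma uinv_diag: "uinv lam k k = 1"
proof -
  have "(\<Sum>l<k. uinv lam k l * lam l k) = 0"
    by (rule sum.neutral) (simp add: uinv_lower)
  then show ?thesis using uinv.simps[of lam k k] by (simp add: mid_def)
qed

lemma uinv_left_inverse:
  assumes U: "unipotent d lam" shows "meq d (mmul d (uinv lam) lam) mid"
  unfolding meq_def mmul_def
proof (intro allI impI)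
  fix k j assume kj: "k < d" "j < d"
  have "(\<Sum>l<d. uinv lam k l * lam l j) = (\<Sum>l<Suc j. uinv lam k l * lam l j)"
    by (rule sum.mono_neutral_right) (use unipotentD(2)[OF U] kj in auto)
  also have "\<dots> = mid k j" using unipotentD(1)[OF U kj(2)] uinv.simps[of lam k j] by simp
  finally show "(\<Sum>l<d. uinv lam k l * lam l j) = mid k j" .
qed

text \<open>In the recursion the degrees l - k and j - l of the two factors add up to j - k.\<close>

lemma ispoly_uinv: "k \<le> j \<Longrightarrow> j < d \<Longrightarrow> ispoly d (j - k) (\<lambda>lam :: nat \<Rightarrow> nat \<Rightarrow> 'a::comm_ring_1. uinv lam k j)"
proof (induction j rule: less_induct)
  case (less j)
  have 1: "uinv lam k j = mid k j + (\<Sum>l\<in>{k..<j}. (-1) * (uinv lam k l * lam l j))" for lam :: "nat \<Rightarrow> nat \<Rightarrow> 'a"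
  proof -
    have "(\<Sum>l<j. uinv lam k l * lam l j) = (\<Sum>l\<in>{k..<j}. uinv lam k l * lam l j)"
      by (rule sum.mono_neutral_right) (use uinv_lower[of _ k lam] in auto)
    then show ?thesis using uinv.simps[of lam k j] by (simp add: sum_negf)
  qed
  have "ispoly d (j - k) (\<lambda>lam :: nat \<Rightarrow> nat \<Rightarrow> 'a. (-1) * (uinv lam k l * lam l j))" if l: "l \<in> {k..<j}" for l
  proof -
    have "ispoly d (0 + ((l - k) + (j - l))) (\<lambda>lam :: nat \<Rightarrow> nat \<Rightarrow> 'a. (-1) * (uinv lam k l * lam l j))"
      using l less.prems by (intro ispoly_mult ispoly_const less.IH ispoly_entry) auto
    then show ?thesis using l by simp
  qed
  then have "ispoly d (j - k) (\<lambda>lam :: nat \<Rightarrow> nat \<Rightarrow> 'a. mid k j + (\<Sum>l\<in>{k..<j}. (-1) * (uinv lam k l * lam l j)))"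
    by (intro ispoly_add ispoly_const ispoly_sum) simp
  then show ?case by (rule ispoly_cong[rotated]) (rule 1)
qed

definition dg :: "(nat \<Rightarrow> 'a::comm_ring_1) \<Rightarrow> nat \<Rightarrow> nat \<Rightarrow> 'a" where
  "dg f i j = (if i = j then f i else 0)"

lemma mmul_dg_left: "i < d \<Longrightarrow> mmul d (dg f) A i j = f i * A i j"
proof -
  assume i: "i < d"
  have "(\<Sum>k<d. dg f i k * A k j) = (\<Sum>k<d. if k = i then f i * A i j else 0)"
    by (rule sum.cong) (auto simp: dg_def)
  then show ?thesis unfolding mmul_def using i by simp
qed

lemma mmul_dg_right: "j < d \<Longrightarrow> mmul d A (dg f) i j = A i j * f j"
proof -
  assume j: "j < d"
  have "(\<Sum>k<d. A i k * dg f k j) = (\<Sum>k<d. if k = j then A i j * f j else 0)"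
    by (rule sum.cong) (auto simp: dg_def)
  then show ?thesis unfolding mmul_def using j by simp
qed

text \<open>Conjugation, with the inverse as a separate argument, so that the two matrices can
  exchange their roles and both can be lifted to constant polynomials.\<close>

definition cnj :: "nat \<Rightarrow> (nat \<Rightarrow> nat \<Rightarrow> 'a::comm_ring_1) \<Rightarrow> (nat \<Rightarrow> nat \<Rightarrow> 'a) \<Rightarrow> (nat \<Rightarrow> nat \<Rightarrow> 'a) \<Rightarrow> nat \<Rightarrow> nat \<Rightarrow> 'a" where
  "cnj d E E' A = mmul d (mmul d E A) E'"

lemma cnj_meq: "meq d A B \<Longrightarrow> meq d (cnj d E E' A) (cnj d E E' B)"
  unfolding cnj_def by (intro meq_mmul meq_refl)

lemma cnj_mid: "meq d (mmul d E E') mid \<Longrightarrow> meq d (cnj d E E' mid) mid"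
  unfolding cnj_def by (rule meq_trans[OF meq_mmul[OF mmul_mid_right meq_refl]])

lemma cnj_mult:
  assumes "meq d (mmul d E' E) mid" "meq d X (cnj d E E' A)" "meq d Y (cnj d E E' B)"
  shows "meq d (mmul d X Y) (cnj d E E' (mmul d A B))"
proof -
  have "meq d (mmul d X Y) (mmul d (cnj d E E' A) (cnj d E E' B))" by (rule meq_mmul[OF assms(2,3)])
  also have "mmul d (cnj d E E' A) (cnj d E E' B) = mmul d (mmul d (mmul d E A) (mmul d E' E)) (mmul d B E')"
    unfolding cnj_def by (simp only: mmul_assoc)
  finally have "meq d (mmul d X Y) (mmul d (mmul d (mmul d E A) (mmul d E' E)) (mmul d B E'))" .
  moreover have "meq d \<dots> (mmul d (mmul d (mmul d E A) mid) (mmul d B E'))"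
    by (intro meq_mmul meq_refl assms(1))
  moreover have "meq d \<dots> (mmul d (mmul d E A) (mmul d B E'))"
    by (intro meq_mmul meq_refl mmul_mid_right)
  moreover have "mmul d (mmul d E A) (mmul d B E') = cnj d E E' (mmul d A B)"
    unfolding cnj_def by (simp only: mmul_assoc)
  ultimately show ?thesis using meq_trans by metis
qed

lemma cnj_mpow:
  assumes "meq d (mmul d E' E) mid" "meq d (mmul d E E') mid" "meq d X (cnj d E E' (dg f))"
  shows "meq d (mpow d X n) (cnj d E E' (dg (\<lambda>i. f i ^ n)))"
proof (induction n)
  case 0
  have "meq d mid (dg (\<lambda>i. f i ^ 0))" unfolding meq_def mid_def dg_def by simp
  then have "meq d (cnj d E E' mid) (cnj d E E' (dg (\<lambda>i. f i ^ 0)))" by (rule cnj_meq)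
  then show ?case using meq_trans[OF meq_sym[OF cnj_mid[OF assms(2)]]] by simp
next
  case (Suc n)
  have "meq d (mmul d (dg f) (dg (\<lambda>i. f i ^ n))) (dg (\<lambda>i. f i ^ Suc n))"
    unfolding meq_def by (simp add: mmul_dg_left dg_def)
  from meq_trans[OF cnj_mult[OF assms(1,3) Suc] cnj_meq[OF this]] show ?case by simp
qed

lemma left_right_inverse:
  assumes "meq d (mmul d L A) mid" "meq d (mmul d A R) mid" shows "meq d L R"
proof -
  have "meq d L (mmul d L (mmul d A R))"
    by (rule meq_trans[OF meq_sym[OF mmul_mid_right] meq_mmul[OF meq_refl meq_sym[OF assms(2)]]])
  moreover have "meq d (mmul d L (mmul d A R)) R"
    unfolding mmul_assoc[symmetric] by (rule meq_trans[OF meq_mmul[OF assms(1) meq_refl] mmul_mid_left])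
  ultimately show ?thesis by (rule meq_trans)
qed

lemma sum_pCons: "(\<Sum>k\<in>A. [:f k:]) = [:\<Sum>k\<in>A. f k:]"
  by (induction A rule: infinite_finite_induct) auto

lemma mmul_mconst: "mmul d (mconst A) (mconst B) = mconst (mmul d A B)"
  by (intro ext) (simp add: mmul_def mconst_def sum_pCons mult.commute)

lemma mconst_mid: "mconst mid = (mid :: nat \<Rightarrow> nat \<Rightarrow> 'a::comm_ring_1 poly)"
  by (intro ext) (simp add: mconst_def mid_def one_pCons)

lemma meq_mconst: "meq d A B \<Longrightarrow> meq d (mconst A) (mconst B)"
  unfolding meq_def mconst_def by simp

lemma cnj_mconst: "cnj d (mconst E) (mconst E') (mconst A) = mconst (cnj d E E' A)"
  unfolding cnj_def mmul_mconst ..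

text \<open>Writing the standard basis vectors in the given basis yields a right inverse R. Then V
  (R V) = V, and the linear independence of the columns of V turns this into R V = 1.\<close>

lemma is_basis_invertible:
  fixes vs :: "nat \<Rightarrow> nat \<Rightarrow> 'a::field"
  assumes "is_basis d vs" shows "minvertible d (\<lambda>x y. vs y x)"
proof -
  define V where "V = (\<lambda>x y. vs y x)"
  have "\<exists>c. (\<lambda>a. mid a b) = (\<lambda>a. \<Sum>i<d. c i * vs i a)" if "b < d" for b
  proof -
    have "(\<lambda>a. mid a b :: 'a) \<in> Dsp d" unfolding Dsp_def mid_def using that by auto
    then show ?thesis using assms unfolding is_basis_def spanv_def by blast
  qed
  then have "\<forall>b. \<exists>c. b < d \<longrightarrow> (\<lambda>a. mid a b) = (\<lambda>a. \<Sum>i<d. c i * vs i a)" by blast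
  from choice[OF this] obtain W where W: "\<And>b. b < d \<Longrightarrow> (\<lambda>a. mid a b) = (\<lambda>a. \<Sum>i<d. W b i * vs i a)" by blast
  define R where "R = (\<lambda>i b. W b i)"
  have VR: "meq d (mmul d V R) mid"
    unfolding meq_def mmul_def V_def R_def using W[THEN fun_cong] by (simp add: mult.commute)
  have "mmul d R V i b = mid i b" if ib: "i < d" "b < d" for i b
  proof -
    have "meq d (mmul d V (mmul d R V)) V"
      unfolding mmul_assoc[symmetric] by (rule meq_trans[OF meq_mmul[OF VR meq_refl] mmul_mid_left])
    then have 1: "(\<Sum>i<d. V a i * mmul d R V i b) = V a b" if "a < d" for a
      unfolding meq_def mmul_def[of d V] using that ib by blast
    have 2: "(\<Sum>i<d. V a i * mid i b) = V a b" if "a < d" for a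
      using mmul_mid_right[of d V] that ib unfolding meq_def mmul_def by blast
    have "(\<lambda>a. \<Sum>i<d. (mmul d R V i b - mid i b) * vs i a) = (\<lambda>a. 0)"
    proof
      fix a
      show "(\<Sum>i<d. (mmul d R V i b - mid i b) * vs i a) = 0"
      proof (cases "a < d")
        case True
        have "(\<Sum>i<d. (mmul d R V i b - mid i b) * vs i a) = (\<Sum>i<d. V a i * mmul d R V i b) - (\<Sum>i<d. V a i * mid i b)"
          unfolding sum_subtractf[symmetric] V_def by (rule sum.cong) (simp_all add: algebra_simps)
        then show ?thesis using 1[OF True] 2[OF True] by simp
      next
        case False
        then have "vs i a = 0" if "i < d" for i using assms that unfolding is_basis_def Dsp_def by auto
        then show ?thesis by simp
      qed
    qed
    then have "mmul d R V i b - mid i b = 0"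
      using assms ib(1) unfolding is_basis_def lin_indep_def by (meson)
    then show ?thesis by simp
  qed
  then have "meq d (mmul d R V) mid" unfolding meq_def by blast
  then show ?thesis using VR unfolding minvertible_def V_def by blast
qed

section \<open>Convergence of sequences of polynomials to elements of H\<close>

context padic
begin

lemma poly_bounded: assumes "0 \<le> r" shows "\<exists>C. pbd r C f"
proof
  show "pbd r (\<Sum>i\<le>degree f. nk (coeff f i) * r ^ i) f"
    unfolding bd_def
  proof
    fix n
    show "nk (coeff f n) * r ^ n \<le> (\<Sum>i\<le>degree f. nk (coeff f i) * r ^ i)"
    proof (cases "n \<le> degree f")
      case True
      then show ?thesis using assms by (intro member_le_sum) auto
    next
      case False
      then show ?thesis using assms by (auto simp: coeff_eq_0 intro!: sum_nonneg)
    qed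
  qed
qed

lemma pbd_telescope:
  assumes "\<And>m. m \<ge> M \<Longrightarrow> pbd r \<epsilon> (X (Suc m) - X m)" "0 \<le> r" "0 \<le> \<epsilon>" "M \<le> m" "m \<le> m'"
  shows "pbd r \<epsilon> (X m' - X m)"
  using assms(5)
proof (induction m' rule: dec_induct)
  case base then show ?case using assms(3) by (simp add: bd_zero)
next
  case (step k)
  have "pbd r \<epsilon> ((X (Suc k) - X k) + (X k - X m))"
    by (rule pbd_add[OF assms(1) step.IH assms(2)]) (use step assms(4) in linarith)
  moreover have "(X (Suc k) - X k) + (X k - X m) = X (Suc k) - X m" by simp
  ultimately show ?case by metis
qed

text \<open>In the ultrametric setting increments tending to 0 make a Cauchy sequence. The
  coefficients converge by completeness, and the limit lies in H because on every disc it is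
  arbitrarily close to a polynomial.\<close>

lemma poly_sequence_limit:
  fixes X :: "nat \<Rightarrow> 'k poly"
  assumes X: "\<And>r \<epsilon>. 0 < r \<Longrightarrow> r < 1 \<Longrightarrow> 0 < \<epsilon> \<Longrightarrow> \<exists>M. \<forall>m\<ge>M. pbd r \<epsilon> (X (Suc m) - X m)"
  shows "\<exists>L. inH nk L \<and> (\<forall>r \<epsilon>. 0 < r \<longrightarrow> r < 1 \<longrightarrow> 0 < \<epsilon> \<longrightarrow> (\<exists>M. \<forall>m\<ge>M. bd r \<epsilon> (\<lambda>n. coeff (X m) n - L n)))"
proof -
  have C: "\<exists>M. \<forall>m\<ge>M. \<forall>m'\<ge>M. pbd r \<epsilon> (X m' - X m)" if "0 < r" "r < 1" "0 < \<epsilon>" for r \<epsilon>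
  proof -
    obtain M where M: "\<forall>m\<ge>M. pbd r \<epsilon> (X (Suc m) - X m)" using X[OF \<open>0 < r\<close> \<open>r < 1\<close> \<open>0 < \<epsilon>\<close>] by blast
    have 1: "pbd r \<epsilon> (X m' - X m)" if "M \<le> m" "m \<le> m'" for m m'
      using pbd_telescope[of M r \<epsilon> X m m'] M that \<open>0 < r\<close> \<open>0 < \<epsilon>\<close> by auto
    have "pbd r \<epsilon> (X m' - X m)" if "M \<le> m" "M \<le> m'" for m m'
    proof (cases "m \<le> m'")
      case False
      then show ?thesis using pbd_minus[OF 1[of m' m]] that by simp
    qed (use 1 that in auto)
    then show ?thesis by blast
  qed
  have "\<exists>L. \<forall>\<epsilon>>0. \<exists>M::nat. \<forall>m\<ge>M. nk (coeff (X m) n - L) < \<epsilon>" for n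
  proof (rule nk_complete)
    fix \<epsilon> :: real assume e: "\<epsilon> > 0"
    \<comment> \<open>A single radius recovers the individual coefficients; 1/2 is taken, and
      \<open>\<delta>\<close> undoes the weight (1/2)^n.\<close>
    define \<delta> where "\<delta> = \<epsilon> / 2 * (1 / 2) ^ n"
    have "\<delta> > 0" unfolding \<delta>_def using e by simp
    then obtain M where M: "\<forall>m\<ge>M. \<forall>m'\<ge>M. pbd (1/2) \<delta> (X m' - X m)" using C[of "1/2" \<delta>] by auto
    have "nk (coeff (X m) n - coeff (X m') n) < \<epsilon>" if "m \<ge> M" "m' \<ge> M" for m m'
    proof -
      have "nk (coeff (X m - X m') n) * (1/2) ^ n \<le> \<epsilon> / 2 * (1 / 2) ^ n"
        using M that unfolding bd_def \<delta>_def by blast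
      then have "nk (coeff (X m - X m') n) \<le> \<epsilon> / 2" by (simp add: power_divide field_simps)
      then show ?thesis using e by simp
    qed
    then show "\<exists>M. \<forall>m\<ge>M. \<forall>m'\<ge>M. nk (coeff (X m) n - coeff (X m') n) < \<epsilon>" by blast
  qed
  then obtain L where L: "\<And>n \<epsilon>. \<epsilon> > 0 \<Longrightarrow> \<exists>M::nat. \<forall>m\<ge>M. nk (coeff (X m) n - L n) < \<epsilon>" by metis
  have conv: "\<exists>M. \<forall>m\<ge>M. bd r \<epsilon> (\<lambda>n. coeff (X m) n - L n)" if r: "0 < r" "r < 1" "0 < \<epsilon>" for r \<epsilon>
  proof -
    obtain M where M: "\<forall>m\<ge>M. \<forall>m'\<ge>M. pbd r \<epsilon> (X m' - X m)" using C r by blast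
    have "nk (coeff (X m) n - L n) * r ^ n \<le> \<epsilon>" if m: "m \<ge> M" for m n
    proof -
      have d: "\<epsilon> / r ^ n > 0" using r by simp
      obtain M' where M': "\<forall>m\<ge>M'. nk (coeff (X m) n - L n) < \<epsilon> / r ^ n" using L[OF d] by blast
      \<comment> \<open>An index large enough for both estimates. It depends on n, but the resulting
        threshold for m does not.\<close>
      define m' where "m' = max M M'"
      have 1: "nk (coeff (X m') n - L n) \<le> \<epsilon> / r ^ n" using M' unfolding m'_def by (meson less_imp_le max.cobounded2)
      have "nk (coeff (X m - X m') n) * r ^ n \<le> \<epsilon>" using M m unfolding bd_def m'_def by (meson max.cobounded1)
      then have 2: "nk (coeff (X m) n - coeff (X m') n) \<le> \<epsilon> / r ^ n" using r by (simp add: field_simps)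
      have "nk ((coeff (X m) n - coeff (X m') n) + (coeff (X m') n - L n)) \<le> \<epsilon> / r ^ n"
        by (rule nk_add_le[OF 2 1])
      then show ?thesis using r by (simp add: field_simps)
    qed
    then show ?thesis unfolding bd_def by blast
  qed
  have "inH nk L" unfolding inH_def
  proof (intro allI impI LIMSEQ_I)
    fix r e :: real assume r: "0 < r \<and> r < 1" and e: "0 < e"
    obtain M where "bd r (e / 2) (\<lambda>n. coeff (X M) n - L n)" using conv[of r "e / 2"] r e by auto
    then have b: "nk (coeff (X M) n - L n) * r ^ n \<le> e / 2" for n unfolding bd_def by blast
    have "norm (nk (L n) * r ^ n - 0) < e" if "n \<ge> Suc (degree (X M))" for n
      using b[of n] that r e by (simp add: coeff_eq_0)
    then show "\<exists>no. \<forall>n\<ge>no. norm (nk (L n) * r ^ n - 0) < e" by blast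
  qed
  then show ?thesis using conv by blast
qed

text \<open>Once the perturbations have norm at most 1 the vectors stop growing, by the ultrametric
  inequality. The increments are then a fixed bound times perturbations that tend to 0.\<close>

lemma perturbed_recursion_cauchy:
  fixes x :: "nat \<Rightarrow> 'i \<Rightarrow> 'k poly"
  assumes I: "finite I"
    and rec: "\<And>n i. i \<in> I \<Longrightarrow> x (Suc n) i = x n i + (\<Sum>j\<in>I. E n i j * x n j)"
    and E: "\<And>\<epsilon>. 0 < \<epsilon> \<Longrightarrow> \<exists>M. \<forall>n\<ge>M. \<forall>i\<in>I. \<forall>j\<in>I. pbd r \<epsilon> (E n i j)"
    and r: "0 < r" and e: "0 < \<epsilon>" and i: "i \<in> I"
  shows "\<exists>M. \<forall>m\<ge>M. pbd r \<epsilon> (x (Suc m) i - x m i)"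
proof -
  obtain M0 where M0: "\<forall>n\<ge>M0. \<forall>i\<in>I. \<forall>j\<in>I. pbd r 1 (E n i j)" using E[of 1] by auto
  have "\<forall>i. \<exists>c. pbd r c (x M0 i)" using poly_bounded[OF less_imp_le[OF r]] by (intro allI)
  from choice[OF this] obtain c where c: "\<And>i. pbd r (c i) (x M0 i)" by blast
  define C where "C = 1 + (\<Sum>i\<in>I. c i)"
  have c0: "0 \<le> c i" for i using c bd_nonneg by blast
  have cC: "c i \<le> C" if "i \<in> I" for i
    unfolding C_def using member_le_sum[of i I c] that c0 I by auto
  have C1: "C \<ge> 1" unfolding C_def using c0 by (simp add: sum_nonneg)
  have xC: "\<forall>i\<in>I. pbd r C (x n i)" if "M0 \<le> n" for n
    using that
  proof (induction n rule: dec_induct)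
    case base
    then show ?case using c cC by (blast intro: bd_mono)
  next
    case (step n)
    show ?case
    proof
      fix i assume i: "i \<in> I"
      have "pbd r C (E n i j * x n j)" if "j \<in> I" for j
        using pbd_mult[of r 1 "E n i j" C "x n j"] M0 step that i r by auto
      then show "pbd r C (x (Suc n) i)"
        unfolding rec[OF i] using step i r C1 by (intro pbd_add pbd_sum) auto
    qed
  qed
  obtain M1 where M1: "\<forall>n\<ge>M1. \<forall>i\<in>I. \<forall>j\<in>I. pbd r (\<epsilon> / C) (E n i j)" using E[of "\<epsilon> / C"] e C1 by auto
  have "pbd r \<epsilon> (x (Suc m) i - x m i)" if "m \<ge> max M0 M1" for m
  proof -
    have "pbd r \<epsilon> (E m i j * x m j)" if "j \<in> I" for j
      using pbd_mult[of r "\<epsilon> / C" "E m i j" C "x m j"] M1 xC[of m] that \<open>m \<ge> max M0 M1\<close> i r C1 by auto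
    then have "pbd r \<epsilon> (\<Sum>j\<in>I. E m i j * x m j)" using e r by (intro pbd_sum) auto
    then show ?thesis unfolding rec[OF i] by simp
  qed
  then show ?thesis by blast
qed

end

section \<open>Growth of products of triangular matrices\<close>

context padic_gen
begin

text \<open>Up to step \<open>q = n\<close> the Gauss norm on the unit disc suffices: each step costs a factor \<open>\<sigma>\<close>, and an
  off-diagonal entry, which contributes the extra factor \<open>C\<close>, can occur at most \<open>d - 1\<close> times
  (hence the weights \<open>C ^ (d - i)\<close>). Beyond \<open>q = n\<close> the factors at radius \<open>rr n\<close> tend
  geometrically to the identity, uniformly in \<open>q - n\<close>.\<close>

lemma slope_estimate:
  fixes Y :: "nat \<Rightarrow> nat \<Rightarrow> nat \<Rightarrow> 'k poly" and T :: "nat \<Rightarrow> nat \<Rightarrow> nat \<Rightarrow> 'k poly"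
    and \<tau> :: "nat \<Rightarrow> real"
  assumes \<alpha>: "\<And>i. i < d \<Longrightarrow> \<alpha> i \<noteq> 0"
    and T0: "\<And>q i j. j < i \<Longrightarrow> i < d \<Longrightarrow> T q i j = 0"
    and TA: "\<And>q i j. i \<le> j \<Longrightarrow> j < d \<Longrightarrow> pbd 1 (\<tau> i * (if i = j then 1 else C)) (T q i j)"
    and C: "C \<ge> 1" and \<tau>: "\<And>i. 0 \<le> \<tau> i"
    and S: "\<And>i j. i \<le> j \<Longrightarrow> j < d \<Longrightarrow> \<tau> i / nk (\<alpha> j) \<le> \<sigma>" and \<sigma>: "0 < \<sigma>"
    and TB: "\<And>k q i j. k \<le> q \<Longrightarrow> i \<le> j \<Longrightarrow> j < d \<Longrightarrow> pbd (rr k) (K * (1 / real p ^ (q - k)) ^ h) (T q i j - mid i j)"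
    and K: "K \<ge> 1"
    and \<theta>: "0 < \<theta>" "\<theta> < 1" "\<And>i j. i \<le> j \<Longrightarrow> j < d \<Longrightarrow> nk (\<alpha> i / \<alpha> j) \<le> \<theta> * real p ^ h"
    and Y0: "\<And>i b. i < d \<Longrightarrow> b < d \<Longrightarrow> Y 0 i b = mid i b"
    and YS: "\<And>m i b. i < d \<Longrightarrow> b < d \<Longrightarrow>
       Y (Suc m) i b = (\<Sum>j<d. smult ((\<alpha> i / \<alpha> j) ^ (N + m + 1)) (T (N + m) i j) * Y m j b)"
  shows "\<exists>c\<ge>0. \<forall>n m i b. i < d \<longrightarrow> b < d \<longrightarrow> n \<le> N + m \<longrightarrow> pbd (rr n) (c * \<sigma> ^ n * nk (\<alpha> i) ^ n) (Y m i b)"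
proof -
  have na: "0 < nk (\<alpha> i)" if "i < d" for i using \<alpha>[OF that] nk_pos by blast
  \<comment> \<open>Accounts for the product starting at N: the identity at step 0 has to satisfy a
    bound that already contains \<open>nk (\<alpha> i) ^ N\<close>.\<close>
  define C0 where "C0 = (\<Sum>i<d. (1 / nk (\<alpha> i)) ^ N)"
  have C0i: "1 \<le> C0 * nk (\<alpha> i) ^ N" if "i < d" for i
  proof -
    have "(1 / nk (\<alpha> i)) ^ N \<le> C0" unfolding C0_def using that by (intro member_le_sum) auto
    then have "(1 / nk (\<alpha> i)) ^ N * nk (\<alpha> i) ^ N \<le> C0 * nk (\<alpha> i) ^ N" by (intro mult_right_mono) auto
    moreover have "(1 / nk (\<alpha> i)) ^ N * nk (\<alpha> i) ^ N = 1"
      using \<alpha>[OF that] unfolding power_mult_distrib[symmetric] by simp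
    ultimately show ?thesis by metis
  qed
  have C0: "0 \<le> C0" unfolding C0_def by (simp add: sum_nonneg)
  have mid1: "pbd r 1 (mid i b)" for r i b
    unfolding mid_def by (auto intro: pbd_1 pbd_0)
  have phase1: "pbd 1 (C0 * \<sigma> ^ m * nk (\<alpha> i) ^ (N + m) * C ^ (d - i)) (Y m i b)" if "i < d" "b < d" for m i b
    using that
  proof (induction m arbitrary: i)
    case 0
    have "1 * 1 \<le> (C0 * nk (\<alpha> i) ^ N) * C ^ (d - i)"
      using C0i[OF 0(1)] C by (intro mult_mono one_le_power) auto
    then show ?case using bd_mono[OF mid1] 0 by (simp add: Y0)
  next
    case (Suc m)
    let ?q = "N + m"
    show ?case unfolding YS[OF Suc.prems]
    proof (rule pbd_sum)
      show nn: "0 \<le> C0 * \<sigma> ^ Suc m * nk (\<alpha> i) ^ (N + Suc m) * C ^ (d - i)" using C0 \<sigma> C by simp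
      fix j assume "j \<in> {..<d}"
      then have j: "j < d" by simp
      show "pbd 1 (C0 * \<sigma> ^ Suc m * nk (\<alpha> i) ^ (N + Suc m) * C ^ (d - i))
        (smult ((\<alpha> i / \<alpha> j) ^ (N + m + 1)) (T (N + m) i j) * Y m j b)"
      proof (cases "j < i")
        case True
        then show ?thesis using T0 Suc.prems nn by (simp add: pbd_0)
      next
        case False
        then have ij: "i \<le> j" by simp
        define w where "w = (if i = j then 1 else C)"
        have w: "w * C ^ (d - j) \<le> C ^ (d - i)"
        proof (cases "i = j")
          case False
          then have "Suc (d - j) \<le> d - i" using ij j by simp
          then have "C ^ Suc (d - j) \<le> C ^ (d - i)" using C by (intro power_increasing) auto
          then show ?thesis unfolding w_def using False by simp
        qed (simp add: w_def)
        have b: "pbd 1 ((nk (\<alpha> i / \<alpha> j) ^ (?q + 1) * (\<tau> i * w)) * (C0 * \<sigma> ^ m * nk (\<alpha> j) ^ ?q * C ^ (d - j)))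
          (smult ((\<alpha> i / \<alpha> j) ^ (N + m + 1)) (T (N + m) i j) * Y m j b)"
          unfolding w_def
          by (intro pbd_mult pbd_smult TA ij j Suc.IH Suc.prems nk_power[THEN eq_refl] zero_le_one)
        \<comment> \<open>The powers of \<open>nk (\<alpha> j)\<close> cancel against the induction
          hypothesis up to one factor \<open>1 / nk (\<alpha> j)\<close>; together with
          \<open>\<tau> i\<close> it is the cost of a step, at most \<open>\<sigma>\<close>.\<close>
        have r: "nk (\<alpha> i / \<alpha> j) ^ (?q + 1) * nk (\<alpha> j) ^ ?q = nk (\<alpha> i) ^ (?q + 1) * (1 / nk (\<alpha> j))"
          using \<alpha>[OF j] by (simp add: nk_divide power_divide)
        have "(nk (\<alpha> i / \<alpha> j) ^ (?q + 1) * (\<tau> i * w)) * (C0 * \<sigma> ^ m * nk (\<alpha> j) ^ ?q * C ^ (d - j))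
           = (C0 * \<sigma> ^ m) * (nk (\<alpha> i / \<alpha> j) ^ (?q + 1) * nk (\<alpha> j) ^ ?q) * (\<tau> i * (w * C ^ (d - j)))"
          by (simp only: mult_ac)
        also have "\<dots> = (C0 * \<sigma> ^ m * nk (\<alpha> i) ^ (?q + 1)) * ((\<tau> i / nk (\<alpha> j)) * (w * C ^ (d - j)))"
          unfolding r by simp
        also have "\<dots> \<le> (C0 * \<sigma> ^ m * nk (\<alpha> i) ^ (?q + 1)) * (\<sigma> * C ^ (d - i))"
          using S[OF ij j] w C0 \<sigma> \<tau> C
          by (intro mult_left_mono mult_mono) (auto simp: w_def)
        also have "\<dots> = C0 * \<sigma> ^ Suc m * nk (\<alpha> i) ^ (N + Suc m) * C ^ (d - i)" by (simp add: mult_ac)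
        finally show ?thesis by (rule bd_mono[OF b])
      qed
    qed simp
  qed
  \<comment> \<open>For the finitely many n < N the splitting point lies before the first factor, so
    the second phase starts from the identity; \<open>C1\<close> absorbs these cases.\<close>
  define D where "D z = 1 / (\<sigma> ^ fst z * nk (\<alpha> (snd z)) ^ fst z)" for z
  define C1 where "C1 = C0 * C ^ d / \<sigma> ^ N + (\<Sum>z\<in>{..<N} \<times> {..<d}. D z)"
  have D0: "0 \<le> D z" for z unfolding D_def using \<sigma> by simp
  have C00: "0 \<le> C0 * C ^ d / \<sigma> ^ N" using C0 C \<sigma> by simp
  have C1a: "C0 * C ^ d / \<sigma> ^ N \<le> C1" unfolding C1_def using sum_nonneg[of "{..<N} \<times> {..<d}" D] D0 by simp
  have C1b: "1 \<le> C1 * \<sigma> ^ n * nk (\<alpha> i) ^ n" if "n < N" "i < d" for n i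
  proof -
    have "D (n, i) \<le> (\<Sum>z\<in>{..<N} \<times> {..<d}. D z)"
      by (rule member_le_sum) (use that D0 in simp_all)
    then have "D (n, i) \<le> C1" unfolding C1_def using C00 by linarith
    moreover have pos: "0 < \<sigma> ^ n * nk (\<alpha> i) ^ n" using \<sigma> na[OF that(2)] by (intro mult_pos_pos zero_less_power)
    ultimately have "D (n, i) * (\<sigma> ^ n * nk (\<alpha> i) ^ n) \<le> C1 * (\<sigma> ^ n * nk (\<alpha> i) ^ n)" by (intro mult_right_mono) simp_all
    moreover have "D (n, i) * (\<sigma> ^ n * nk (\<alpha> i) ^ n) = 1" unfolding D_def fst_conv snd_conv 
      by (rule nonzero_eq_divide_eq[THEN iffD1, OF _ refl]) (use pos in linarith)
    ultimately show ?thesis by (simp only: mult.assoc)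
  qed
  have C1: "0 \<le> C1" by (rule order_trans[OF C00 C1a])
  have start: "pbd (rr n) (C1 * \<sigma> ^ n * nk (\<alpha> i) ^ n) (Y (n - N) i b)" if ib: "i < d" "b < d" for n i b
  proof (cases "N \<le> n")
    case True
    have e: "N + (n - N) = n" using True by simp
    have "C ^ (d - i) \<le> C ^ d" by (rule power_increasing) (use C in simp_all)
    then have "C0 * \<sigma> ^ (n - N) * nk (\<alpha> i) ^ n * C ^ (d - i) \<le> C0 * \<sigma> ^ (n - N) * nk (\<alpha> i) ^ n * C ^ d"
      by (rule mult_left_mono) (use C0 \<sigma> in simp)
    also have "\<dots> = (C0 * C ^ d / \<sigma> ^ N) * \<sigma> ^ n * nk (\<alpha> i) ^ n"
    proof -
      have "\<sigma> ^ n = \<sigma> ^ N * \<sigma> ^ (n - N)" unfolding power_add[symmetric] e ..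
      then show ?thesis using \<sigma> by simp
    qed
    also have "\<dots> \<le> C1 * \<sigma> ^ n * nk (\<alpha> i) ^ n"
      by (intro mult_right_mono C1a) (use \<sigma> in simp_all)
    finally have "pbd 1 (C1 * \<sigma> ^ n * nk (\<alpha> i) ^ n) (Y (n - N) i b)"
      by (rule bd_mono[OF phase1[OF ib, of "n - N", unfolded e]])
    then show ?thesis by (rule bd_radius) (use rr_pos[of n] rr_lt1[of n] in simp_all)
  next
    case False
    then have "Y (n - N) i b = mid i b" using Y0[OF ib] by simp
    then show ?thesis using bd_mono[OF mid1 C1b[of n i]] ib(1) False by simp
  qed
  define K' where "K' = K * real p ^ h"
  have K'1: "1 \<le> K'" unfolding K'_def using mult_mono[of 1 K 1 "real p ^ h"] K p_power_ge1[of h] by simp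
  have K'0: "0 \<le> K'" using K'1 by linarith
  have \<sigma>0: "0 \<le> \<sigma>" using \<sigma> by linarith
  have K0: "0 \<le> K" using K by linarith
  \<comment> \<open>Only the first L steps past n can enlarge the bound; afterwards the power of
    \<open>\<theta>\<close> outweighs \<open>K'\<close>. The number L does not depend on n.\<close>
  obtain L where L: "K' * \<theta> ^ L \<le> 1"
  proof -
    have "(\<lambda>L. K' * \<theta> ^ L) \<longlonglongrightarrow> K' * 0" using \<theta> by (intro tendsto_intros LIMSEQ_realpow_zero) auto
    then have "eventually (\<lambda>L. K' * \<theta> ^ L < 1) sequentially" by (intro order_tendstoD(2)) auto
    then obtain L where "K' * \<theta> ^ L < 1" unfolding eventually_sequentially by blast
    then show ?thesis by (intro that[of L]) simp
  qed
  have phase2: "pbd (rr n) (C1 * K' ^ min (N + m - n) L * \<sigma> ^ n * nk (\<alpha> i) ^ n) (Y m i b)"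
    if "n - N \<le> m" "i < d" "b < d" for n m i b
    using that
  proof (induction m arbitrary: i rule: dec_induct)
    case base
    have "C1 * 1 \<le> C1 * K' ^ min (N + (n - N) - n) L" by (intro mult_left_mono one_le_power C1 K'1)
    then have "C1 * \<sigma> ^ n * nk (\<alpha> i) ^ n \<le> C1 * K' ^ min (N + (n - N) - n) L * \<sigma> ^ n * nk (\<alpha> i) ^ n"
      by (intro mult_right_mono zero_le_power \<sigma>0 nk_nonneg) simp
    then show ?case by (rule bd_mono[OF start[OF base]])
  next
    case (step m)
    let ?q = "N + m" and ?e = "min (N + m - n) L" and ?e' = "min (N + Suc m - n) L"
    define A where "A = C1 * K' ^ ?e' * \<sigma> ^ n * nk (\<alpha> i) ^ n"
    have nq: "n \<le> ?q" using step(1) by simp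
    have A0: "0 \<le> A" unfolding A_def by (intro mult_nonneg_nonneg zero_le_power C1 K'0 \<sigma>0 nk_nonneg)
    have "pbd (rr n) A (Y m i b)"
    proof (rule bd_mono[OF step.IH[OF step.prems]])
      have "?e \<le> ?e'" by simp
      then have "K' ^ ?e \<le> K' ^ ?e'" by (rule power_increasing[OF _ K'1])
      then show "C1 * K' ^ ?e * \<sigma> ^ n * nk (\<alpha> i) ^ n \<le> A"
        unfolding A_def by (intro mult_right_mono mult_left_mono C1 \<sigma>0 zero_le_power nk_nonneg)
    qed
    moreover have "pbd (rr n) A (\<Sum>j<d. smult ((\<alpha> i / \<alpha> j) ^ (?q + 1)) (T ?q i j - mid i j) * Y m j b)"
    proof (rule pbd_sum)
      fix j assume "j \<in> {..<d}"
      then have j: "j < d" by simp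
      show "pbd (rr n) A (smult ((\<alpha> i / \<alpha> j) ^ (?q + 1)) (T ?q i j - mid i j) * Y m j b)"
      proof (cases "j < i")
        case True
        then show ?thesis using T0 step.prems A0 by (simp add: pbd_0 mid_def)
      next
        case False
        then have ij: "i \<le> j" by simp
        have b: "pbd (rr n) ((nk (\<alpha> i / \<alpha> j) ^ (?q + 1) * (K * (1 / real p ^ (?q - n)) ^ h)) *
            (C1 * K' ^ ?e * \<sigma> ^ n * nk (\<alpha> j) ^ n)) (smult ((\<alpha> i / \<alpha> j) ^ (?q + 1)) (T ?q i j - mid i j) * Y m j b)"
          by (intro pbd_mult pbd_smult TB nq ij j step.IH step.prems nk_power[THEN eq_refl] less_imp_le[OF rr_pos])
        \<comment> \<open>The first q - n powers of the ratio are beaten by the decay of T - 1, a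
          single one goes into \<open>K'\<close>, and the last n turn
          \<open>nk (\<alpha> j) ^ n\<close> into \<open>nk (\<alpha> i) ^ n\<close>.\<close>
        have qe: "?q + 1 = (?q - n) + 1 + n" using nq by simp
        have "nk (\<alpha> i / \<alpha> j) ^ (?q + 1) = nk (\<alpha> i / \<alpha> j) ^ (?q - n) * nk (\<alpha> i / \<alpha> j) * nk (\<alpha> i / \<alpha> j) ^ n"
          unfolding qe power_add power_one_right ..
        also have "\<dots> \<le> (\<theta> * real p ^ h) ^ (?q - n) * real p ^ h * (nk (\<alpha> i) / nk (\<alpha> j)) ^ n"
        proof -
          have "nk (\<alpha> i / \<alpha> j) \<le> 1 * real p ^ h"
            using \<theta>(2) \<theta>(3)[OF ij j] p_power_ge1[of h]
            by (intro order_trans[OF \<theta>(3)[OF ij j]] mult_right_mono) auto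
          then have "nk (\<alpha> i / \<alpha> j) \<le> real p ^ h" by simp
          then show ?thesis
            by (intro mult_mono power_mono \<theta>(3)[OF ij j]) (use \<theta>(1) nk_divide[of "\<alpha> i" "\<alpha> j"] in simp_all)
        qed
        finally have 1: "nk (\<alpha> i / \<alpha> j) ^ (?q + 1) \<le> \<dots>" .
        have "(nk (\<alpha> i / \<alpha> j) ^ (?q + 1) * (K * (1 / real p ^ (?q - n)) ^ h)) * (C1 * K' ^ ?e * \<sigma> ^ n * nk (\<alpha> j) ^ n)
          \<le> (((\<theta> * real p ^ h) ^ (?q - n) * real p ^ h * (nk (\<alpha> i) / nk (\<alpha> j)) ^ n) * (K * (1 / real p ^ (?q - n)) ^ h))
              * (C1 * K' ^ ?e * \<sigma> ^ n * nk (\<alpha> j) ^ n)"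
          by (intro mult_right_mono 1 mult_nonneg_nonneg zero_le_power K0 C1 K'0 \<sigma>0 nk_nonneg divide_nonneg_nonneg of_nat_0_le_iff zero_le_one)
        also have "\<dots> = C1 * (K' * \<theta> ^ (?q - n) * K' ^ ?e) * \<sigma> ^ n * nk (\<alpha> i) ^ n"
        proof -
          have "(real p ^ h) ^ (?q - n) * (1 / real p ^ (?q - n)) ^ h = 1"
          proof -
            have "(real p ^ h) ^ (?q - n) = (real p ^ (?q - n)) ^ h" by (simp only: power_mult[symmetric] mult.commute)
            then show ?thesis using p_pos by (simp add: power_divide)
          qed
          moreover have "(nk (\<alpha> i) / nk (\<alpha> j)) ^ n * nk (\<alpha> j) ^ n = nk (\<alpha> i) ^ n"
            using \<alpha>[OF j] by (simp add: power_divide)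
          moreover have "(((\<theta> * real p ^ h) ^ (?q - n) * real p ^ h * (nk (\<alpha> i) / nk (\<alpha> j)) ^ n) * (K * (1 / real p ^ (?q - n)) ^ h))
              * (C1 * K' ^ ?e * \<sigma> ^ n * nk (\<alpha> j) ^ n)
            = C1 * ((K * real p ^ h) * \<theta> ^ (?q - n) * K' ^ ?e) * \<sigma> ^ n *
               ((nk (\<alpha> i) / nk (\<alpha> j)) ^ n * nk (\<alpha> j) ^ n) * ((real p ^ h) ^ (?q - n) * (1 / real p ^ (?q - n)) ^ h)"
            unfolding power_mult_distrib by (simp only: mult_ac)
          ultimately show ?thesis unfolding K'_def by simp
        qed
        also have "\<dots> \<le> A"
        proof -
          have "K' * \<theta> ^ (?q - n) * K' ^ ?e \<le> K' ^ ?e'"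
          proof (cases "?q - n < L")
            case True
            then have e': "?e' = Suc ?e" using nq by simp
            have "\<theta> ^ (?q - n) \<le> 1" using \<theta> by (intro power_le_one) auto
            then have "K' * \<theta> ^ (?q - n) * K' ^ ?e \<le> K' * 1 * K' ^ ?e"
              by (intro mult_right_mono mult_left_mono zero_le_power K'0)
            then show ?thesis unfolding e' by simp
          next
            case False
            then have e': "?e' = ?e" using nq by simp
            have "K' * \<theta> ^ (?q - n) \<le> K' * \<theta> ^ L"
              using False \<theta> K'1 by (intro mult_left_mono power_decreasing) auto
            then have "K' * \<theta> ^ (?q - n) \<le> 1" using L by simp
            then have "K' * \<theta> ^ (?q - n) * K' ^ ?e \<le> 1 * K' ^ ?e" by (intro mult_right_mono zero_le_power K'0)
            then show ?thesis unfolding e' by simp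
          qed
          then show ?thesis unfolding A_def by (intro mult_right_mono mult_left_mono C1 \<sigma>0 zero_le_power nk_nonneg)
        qed
        finally show ?thesis by (rule bd_mono[OF b])
      qed
    qed (use A0 rr_pos[of n] in auto)
    ultimately have "pbd (rr n) A (Y m i b + (\<Sum>j<d. smult ((\<alpha> i / \<alpha> j) ^ (?q + 1)) (T ?q i j - mid i j) * Y m j b))"
      using rr_pos[of n] by (intro pbd_add) auto
    moreover have "Y m i b + (\<Sum>j<d. smult ((\<alpha> i / \<alpha> j) ^ (?q + 1)) (T ?q i j - mid i j) * Y m j b) = Y (Suc m) i b"
    proof -
      have "(\<Sum>j<d. smult ((\<alpha> i / \<alpha> j) ^ (?q + 1)) (mid i j) * Y m j b) = (\<Sum>j<d. if j = i then Y m j b else 0)"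
        using \<alpha> by (intro sum.cong) (auto simp: mid_def)
      also have "\<dots> = Y m i b" using step.prems by simp
      finally show ?thesis unfolding YS[OF step.prems]
        by (simp add: smult_diff_right left_diff_distrib sum_subtractf)
    qed
    ultimately show ?case unfolding A_def by simp
  qed
  have "pbd (rr n) (C1 * K' ^ L * \<sigma> ^ n * nk (\<alpha> i) ^ n) (Y m i b)" if "i < d" "b < d" "n \<le> N + m" for n m i b
  proof (rule bd_mono[OF phase2])
    have "K' ^ min (N + m - n) L \<le> K' ^ L" using K'1 by (intro power_increasing) auto
    then show "C1 * K' ^ min (N + m - n) L * \<sigma> ^ n * nk (\<alpha> i) ^ n \<le> C1 * K' ^ L * \<sigma> ^ n * nk (\<alpha> i) ^ n"
      by (intro mult_right_mono mult_left_mono C1 \<sigma>0 zero_le_power nk_nonneg)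
  qed (use that in auto)
  moreover have "0 \<le> C1 * K' ^ L" by (intro mult_nonneg_nonneg zero_le_power C1 K'0)
  ultimately show ?thesis by blast
qed

end

section \<open>The matrices \<open>Z\<^sub>n\<close> in the eigenbasis\<close>

text \<open>Besides p, the field and u, exactly the data on which the coefficients may depend.
  Whatever is defined here without an argument \<open>lam\<close> is therefore common to all modules
  with these data; the bases and \<phi> enter in a later locale.\<close>

locale refinement_datum = padic_gen p nk u for p and nk :: "'k::field_char_0 \<Rightarrow> real" and u +
  fixes N d :: nat and jl jr :: int and \<alpha> :: "nat \<Rightarrow> 'k" and t :: "nat \<Rightarrow> int"
  assumes d: "d \<ge> 1"
    and tmono: "\<forall>i j. i < j \<and> j < d \<longrightarrow> t i < t j"
    and Jsub: "{t 0<..t (d - 1)} \<subseteq> {jl..jr}"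
    and Jbig: "\<forall>i j. i \<le> j \<and> j < d \<longrightarrow> real (card {jl..jr}) > ordp p nk (\<alpha> j / \<alpha> i)"
    and \<alpha>_nz: "i < d \<Longrightarrow> \<alpha> i \<noteq> 0"
begin

abbreviation "h \<equiv> card {jl..jr}"
abbreviation "\<beta> \<equiv> (h - 1) div (p - 1)"
abbreviation "xk q k \<equiv> xit p u q {t k<..t (d - 1)} {jl..jr}"

text \<open>The strict inequality for the size of J at i = j, where the valuation is 0.\<close>

lemma h_ge1: "h \<ge> 1"
proof -
  have "ordp p nk (\<alpha> 0 / \<alpha> 0) = 0" unfolding ordp_def using \<alpha>_nz[of 0] d by simp
  then have "real h > 0" using Jbig[rule_format, of 0 0] d by simp
  then show ?thesis by simp
qed

lemma t_le: "i \<le> j \<Longrightarrow> j < d \<Longrightarrow> t i \<le> t j"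
  using tmono by (cases "i = j") (auto intro: less_imp_le)

lemma sub_J: "k < d \<Longrightarrow> {t k<..t (d - 1)} \<subseteq> {jl..jr}"
  using Jsub t_le[of 0 k] by auto

lemma xk_bound: "k < d \<Longrightarrow> pbd 1 (real p ^ (nat (t (d - 1) - t k) + \<beta>)) (xk q k)"
  using xit_bound[OF refl h_ge1 sub_J, of k q] by simp

lemma xk_minus_1_bound:
  "k < d \<Longrightarrow> n \<le> q \<Longrightarrow> pbd (rr n) (real p ^ (h + \<beta>) * (1 / real p ^ (q - n)) ^ h) (xk q k - 1)"
  using xit_minus_1_bound[OF refl h_ge1 sub_J, of k n q] by simp

lemma ratio_lt: assumes "i \<le> j" "j < d" shows "nk (\<alpha> i / \<alpha> j) < real p ^ h"
proof -
  have nz: "\<alpha> i \<noteq> 0" "\<alpha> j \<noteq> 0" using assms \<alpha>_nz by auto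
  then have pos: "0 < nk (\<alpha> i / \<alpha> j)" by (intro nk_pos) simp
  have "nk (\<alpha> j / \<alpha> i) = inverse (nk (\<alpha> i / \<alpha> j))" by (simp add: nk_divide)
  then have "ordp p nk (\<alpha> j / \<alpha> i) = log (real p) (nk (\<alpha> i / \<alpha> j))"
    unfolding ordp_def using pos p_gt1 by (simp add: log_inverse)
  then have "log (real p) (nk (\<alpha> i / \<alpha> j)) < real h" using Jbig assms by metis
  then have "nk (\<alpha> i / \<alpha> j) < real p powr real h" using pos p_gt1 by (simp add: log_less_iff)
  then show ?thesis using p_pos by (simp add: powr_realpow)
qed

text \<open>The ratios are finitely many, so the strict inequality assumed for the size of J leaves
  a uniform gap; this gap drives the convergence.\<close>

lemma theta_exists:
  "\<exists>\<theta>>0. \<theta> < 1 \<and> (\<forall>i j. i \<le> j \<longrightarrow> j < d \<longrightarrow> nk (\<alpha> i / \<alpha> j) \<le> \<theta> * real p ^ h)"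
proof -
  define S where "S = {(i, j). i \<le> j \<and> j < d}"
  have fS: "finite S" unfolding S_def by (rule finite_subset[of _ "{..<d} \<times> {..<d}"]) auto
  define \<theta> where "\<theta> = Max (insert (1/2) ((\<lambda>(i, j). nk (\<alpha> i / \<alpha> j) / real p ^ h) ` S))"
  have 1: "1 / 2 \<le> \<theta>" unfolding \<theta>_def using fS by (intro Max_ge) auto
  have "\<theta> < 1" unfolding \<theta>_def
  proof (subst Max_less_iff)
    show "\<forall>x\<in>insert (1/2) ((\<lambda>(i, j). nk (\<alpha> i / \<alpha> j) / real p ^ h) ` S). x < 1"
      using ratio_lt p_pos unfolding S_def by (auto simp: divide_less_eq)
  qed (use fS in auto)
  moreover have "nk (\<alpha> i / \<alpha> j) \<le> \<theta> * real p ^ h" if "i \<le> j" "j < d" for i j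
  proof -
    have "nk (\<alpha> i / \<alpha> j) / real p ^ h \<le> \<theta>"
      unfolding \<theta>_def using fS that by (intro Max_ge) (auto simp: S_def intro!: image_eqI[of _ _ "(i, j)"])
    then show ?thesis using p_pos by (simp add: divide_le_eq)
  qed
  ultimately show ?thesis using 1 by (intro exI[of _ \<theta>]) auto
qed

text \<open>In the eigenbasis T_q is \<open>lam\<close> times a diagonal matrix times the inverse of
  \<open>lam\<close>, and these products are the weights of the diagonal entries. They vanish unless
  a \<le> k \<le> j, and then the degrees k - a and j - k add up to j - a.\<close>

lemma entry_coeffs_exist:
  "\<exists>s. \<forall>a j k. a \<le> j \<longrightarrow> j < d \<longrightarrow> k < d \<longrightarrow> (\<forall>lam :: nat \<Rightarrow> nat \<Rightarrow> 'k. unipotent d lam \<longrightarrow>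
     lam a k * uinv lam k j = (\<Sum>m\<in>monoms d (j - a). mono_eval d lam m * s a j k m))"
proof -
  have "\<exists>c. \<forall>lam :: nat \<Rightarrow> nat \<Rightarrow> 'k. unipotent d lam \<longrightarrow>
     lam a k * uinv lam k j = (\<Sum>m\<in>monoms d (j - a). mono_eval d lam m * c m)"
    if "a \<le> j" "j < d" "k < d" for a j k
  proof -
    have "ispoly d (j - a) (\<lambda>lam :: nat \<Rightarrow> nat \<Rightarrow> 'k. lam a k * uinv lam k j)"
    proof (cases "a \<le> k \<and> k \<le> j")
      case True
      then have e: "j - a = (k - a) + (j - k)" by simp
      show ?thesis unfolding e
        by (intro ispoly_mult ispoly_entry ispoly_uinv) (use True that in auto)
    next
      case False
      show ?thesis
      proof (rule ispoly_cong[OF _ ispoly_const[of d "j - a" 0]])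
        fix lam :: "nat \<Rightarrow> nat \<Rightarrow> 'k" assume U: "unipotent d lam"
        show "lam a k * uinv lam k j = 0"
        proof (cases "k < a")
          case True
          then show ?thesis using unipotentD(2)[OF U, of k a] that by simp
        next
          case False
          then have "j < k" using \<open>\<not> (a \<le> k \<and> k \<le> j)\<close> by simp
          then show ?thesis by (simp add: uinv_lower)
        qed
      qed
    qed
    then show ?thesis unfolding ispoly_def .
  qed
  then show ?thesis by metis
qed

text \<open>One choice for all unipotent \<open>lam\<close> at once, made before any module is
  fixed.\<close>

definition scoef :: "nat \<Rightarrow> nat \<Rightarrow> nat \<Rightarrow> (nat \<times> nat \<Rightarrow> nat) \<Rightarrow> 'k" where
  "scoef = (SOME s. \<forall>a j k. a \<le> j \<longrightarrow> j < d \<longrightarrow> k < d \<longrightarrow> (\<forall>lam :: nat \<Rightarrow> nat \<Rightarrow> 'k. unipotent d lam \<longrightarrow>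
     lam a k * uinv lam k j = (\<Sum>m\<in>monoms d (j - a). mono_eval d lam m * s a j k m)))"

lemma scoef:
  assumes "a \<le> j" "j < d" "k < d" "unipotent d lam"
  shows "lam a k * uinv lam k j = (\<Sum>m\<in>monoms d (j - a). mono_eval d lam m * scoef a j k m)"
  using someI_ex[OF entry_coeffs_exist] assms unfolding scoef_def by blast

definition Tq :: "(nat \<Rightarrow> nat \<Rightarrow> 'k) \<Rightarrow> nat \<Rightarrow> nat \<Rightarrow> nat \<Rightarrow> 'k poly" where
  "Tq lam q i j = (\<Sum>k<d. smult (lam i k * uinv lam k j) (xk q k))"

text \<open>The matrix of Z_{N+m-1} in the eigenbasis, where conjugation by a power of \<phi>
  multiplies the entry (i, j) by that power of \<open>\<alpha> i / \<alpha> j\<close>.\<close>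

primrec Ym :: "(nat \<Rightarrow> nat \<Rightarrow> 'k) \<Rightarrow> nat \<Rightarrow> nat \<Rightarrow> nat \<Rightarrow> 'k poly" where
  "Ym lam 0 = mid"
| "Ym lam (Suc m) = (\<lambda>i b. \<Sum>j<d. smult ((\<alpha> i / \<alpha> j) ^ (N + m + 1)) (Tq lam (N + m) i j) * Ym lam m j b)"

text \<open>The coefficient of the monomial \<open>m\<close> in the entry \<open>(a, j)\<close> of the conjugate of \<open>T\<^sub>q - 1\<close>, and the
  matrix through which it acts on the coefficients of the \<open>b\<close>-th column of \<open>Z\<^sub>n\<close>; that column
  is recorded by the coefficients indexed by \<open>idx b\<close>.\<close>

definition eps :: "nat \<Rightarrow> nat \<Rightarrow> nat \<Rightarrow> (nat \<times> nat \<Rightarrow> nat) \<Rightarrow> 'k poly" where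
  "eps q a j m = smult ((\<alpha> a / \<alpha> j) ^ (q + 1)) (\<Sum>k<d. smult (scoef a j k m) (xk q k - 1))"

definition idx :: "nat \<Rightarrow> (nat \<times> (nat \<times> nat \<Rightarrow> nat)) set" where
  "idx b = Sigma {..b} (\<lambda>j. monoms d (b - j))"

definition EE :: "nat \<Rightarrow> nat \<times> (nat \<times> nat \<Rightarrow> nat) \<Rightarrow> nat \<times> (nat \<times> nat \<Rightarrow> nat) \<Rightarrow> 'k poly" where
  "EE q x y = (if fst x \<le> fst y then
     \<Sum>m1\<in>{m1\<in>monoms d (fst y - fst x). madd m1 (snd y) = snd x}. eps q (fst x) (fst y) m1 else 0)"

primrec cc :: "nat \<Rightarrow> nat \<Rightarrow> nat \<times> (nat \<times> nat \<Rightarrow> nat) \<Rightarrow> 'k poly" where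
  "cc b 0 = (\<lambda>x. if x = (b, \<lambda>_. 0) then 1 else 0)"
| "cc b (Suc n) = (\<lambda>x. cc b n x + (\<Sum>y\<in>idx b. EE (N + n) x y * cc b n y))"

lemma finite_idx: "finite (idx b)"
  unfolding idx_def by (intro finite_SigmaI finite_monoms) simp

text \<open>With k fixed such that r \<le> \<open>rr k\<close>, the decay p^(-h (q - k)) of
  \<open>xit\<close> - 1 cancels all but p^(h (k + 1)) of the growth p^(h (q + 1)) allowed to the
  eigenvalue ratios, and the power of \<open>\<theta>\<close> remains.\<close>

lemma eps_small:
  assumes r: "0 < r" "r < 1" and e: "0 < \<epsilon>"
  shows "\<exists>M. \<forall>q\<ge>M. \<forall>a j m. a \<le> j \<longrightarrow> j < d \<longrightarrow> m \<in> monoms d (j - a) \<longrightarrow> pbd r \<epsilon> (eps q a j m)"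
proof -
  \<comment> \<open>The radii \<open>rr k\<close> tend to 1, so one of them exceeds r.\<close>
  have "(\<lambda>k. (1 / real p) powr ((1 / real p) ^ k)) \<longlonglongrightarrow> (1 / real p) powr 0"
    using p_gt1 by (intro tendsto_powr tendsto_const LIMSEQ_realpow_zero) auto
  then have "eventually (\<lambda>k. r < (1 / real p) powr ((1 / real p) ^ k)) sequentially"
    using r p_pos by (intro order_tendstoD(1)) auto
  then obtain k where "r < (1 / real p) powr ((1 / real p) ^ k)" unfolding eventually_sequentially by blast
  then have rk: "r \<le> rr k" unfolding rr_def by (simp add: power_divide)
  obtain \<theta> where \<theta>: "\<theta> > 0" "\<theta> < 1" "\<And>i j. i \<le> j \<Longrightarrow> j < d \<Longrightarrow> nk (\<alpha> i / \<alpha> j) \<le> \<theta> * real p ^ h"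
    using theta_exists by blast
  define A where "A = {..<d} \<times> {..<d} \<times> {..<d} \<times> monoms d d"
  define Sm where "Sm = (\<Sum>(a, j, k, m)\<in>A. nk (scoef a j k m))"
  have fA: "finite A" unfolding A_def by (intro finite_cartesian_product finite_monoms) auto
  have Sm0: "0 \<le> Sm" unfolding Sm_def by (rule sum_nonneg) (auto split: prod.split)
  have Sm: "nk (scoef a j k m) \<le> Sm" if "a < d" "j < d" "k < d" "m \<in> monoms d d" for a j k m
  proof -
    have "(\<lambda>(a, j, k, m). nk (scoef a j k m)) (a, j, k, m) \<le> Sm"
      unfolding Sm_def by (rule member_le_sum[OF _ _ fA]) (use that in \<open>auto simp: A_def\<close>)
    then show ?thesis by simp
  qed
  define K where "K = Sm * real p ^ (h + \<beta>)"
  have K0: "0 \<le> K" unfolding K_def using Sm0 by simp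
  have "(\<lambda>q. K * real p ^ (h * Suc k) * \<theta> ^ (q + 1)) \<longlonglongrightarrow> K * real p ^ (h * Suc k) * 0"
    using \<theta> by (intro tendsto_mult tendsto_const LIMSEQ_ignore_initial_segment LIMSEQ_realpow_zero) auto
  then have "eventually (\<lambda>q. K * real p ^ (h * Suc k) * \<theta> ^ (q + 1) < \<epsilon>) sequentially"
    using e by (intro order_tendstoD(2)) auto
  then obtain M0 where M0: "\<forall>q\<ge>M0. K * real p ^ (h * Suc k) * \<theta> ^ (q + 1) < \<epsilon>"
    unfolding eventually_sequentially by blast
  have "pbd r \<epsilon> (eps q a j m)"
    if q: "q \<ge> max M0 k" and ajm: "a \<le> j" "j < d" "m \<in> monoms d (j - a)" for q a j m
  proof -
    have md: "m \<in> monoms d d" by (rule subsetD[OF monoms_mono ajm(3)]) (use ajm in simp)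
    let ?B = "(1 / real p ^ (q - k)) ^ h"
    have B0: "0 \<le> ?B" by simp
    have 1: "pbd (rr k) (K * ?B) (\<Sum>k'<d. smult (scoef a j k' m) (xk q k' - 1))"
    proof (rule pbd_sum)
      fix k' assume "k' \<in> {..<d}"
      then have k': "k' < d" by simp
      have "pbd (rr k) (Sm * (real p ^ (h + \<beta>) * ?B)) (smult (scoef a j k' m) (xk q k' - 1))"
        by (intro pbd_smult xk_minus_1_bound k' Sm md) (use q ajm in auto)
      then show "pbd (rr k) (K * ?B) (smult (scoef a j k' m) (xk q k' - 1))"
        unfolding K_def by (simp only: mult.assoc)
    qed (use K0 B0 rr_pos[of k] in \<open>auto intro!: mult_nonneg_nonneg\<close>)
    have "nk ((\<alpha> a / \<alpha> j) ^ (q + 1)) \<le> (\<theta> * real p ^ h) ^ (q + 1)"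
      unfolding nk_power by (intro power_mono \<theta>(3) ajm nk_nonneg)
    then have "pbd (rr k) ((\<theta> * real p ^ h) ^ (q + 1) * (K * ?B)) (eps q a j m)"
      unfolding eps_def by (intro pbd_smult 1)
    moreover have "(\<theta> * real p ^ h) ^ (q + 1) * (K * ?B) = K * real p ^ (h * Suc k) * \<theta> ^ (q + 1)"
    proof -
      have qk: "q + 1 = (q - k) + Suc k" using q by simp
      have "(real p ^ h) ^ (q + 1) * ?B = (real p ^ h) ^ Suc k * ((real p ^ h) ^ (q - k) * ?B)"
        unfolding qk power_add by (simp only: mult_ac)
      also have "(real p ^ h) ^ (q - k) = (real p ^ (q - k)) ^ h" by (simp only: power_mult[symmetric] mult.commute)
      also have "(real p ^ (q - k)) ^ h * ?B = 1" using p_pos by (simp add: power_divide)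
      finally have "(real p ^ h) ^ (q + 1) * ?B = real p ^ (h * Suc k)" by (simp only: power_mult mult_1_right)
      then show ?thesis unfolding power_mult_distrib by (metis mult.assoc mult.commute)
    qed
    moreover have "K * real p ^ (h * Suc k) * \<theta> ^ (q + 1) \<le> \<epsilon>" using M0 q by (simp add: less_imp_le)
    ultimately have "pbd (rr k) \<epsilon> (eps q a j m)" using bd_mono by metis
    then show ?thesis by (rule bd_radius) (use r rk in auto)
  qed
  then show ?thesis by blast
qed

lemma EE_small:
  assumes r: "0 < r" "r < 1" and e: "0 < \<epsilon>" and b: "b < d"
  shows "\<exists>M. \<forall>n\<ge>M. \<forall>x\<in>idx b. \<forall>y\<in>idx b. pbd r \<epsilon> (EE (N + n) x y)"
proof -
  obtain M where M: "\<forall>q\<ge>M. \<forall>a j m. a \<le> j \<longrightarrow> j < d \<longrightarrow> m \<in> monoms d (j - a) \<longrightarrow> pbd r \<epsilon> (eps q a j m)"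
    using eps_small[OF r e] by blast
  have "pbd r \<epsilon> (EE (N + n) x y)" if n: "n \<ge> M" and y: "y \<in> idx b" for n x y
  proof (cases "fst x \<le> fst y")
    case True
    have yd: "fst y < d" using y b unfolding idx_def by auto
    have "N + n \<ge> M" using n by simp
    then have "pbd r \<epsilon> (eps (N + n) (fst x) (fst y) m)" if "m \<in> monoms d (fst y - fst x)" for m
      using M True yd that by blast
    then show ?thesis unfolding EE_def if_P[OF True] by (intro pbd_sum) (use r e in auto)
  next
    case False
    then have "EE (N + n) x y = 0" unfolding EE_def by simp
    then show ?thesis using pbd_0[of \<epsilon> r] e by simp
  qed
  then show ?thesis by blast
qed

section \<open>Limits of the coefficients and convergence in H\<close>

definition clim :: "nat \<Rightarrow> nat \<times> (nat \<times> nat \<Rightarrow> nat) \<Rightarrow> 'k ser" where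
  "clim b x = (SOME L. inH nk L \<and> (\<forall>r \<epsilon>. 0 < r \<longrightarrow> r < 1 \<longrightarrow> 0 < \<epsilon> \<longrightarrow>
     (\<exists>M. \<forall>m\<ge>M. bd r \<epsilon> (\<lambda>n. coeff (cc b m x) n - L n))))"

lemma clim_prop:
  assumes b: "b < d" and x: "x \<in> idx b"
  shows "inH nk (clim b x) \<and> (\<forall>r \<epsilon>. 0 < r \<longrightarrow> r < 1 \<longrightarrow> 0 < \<epsilon> \<longrightarrow>
     (\<exists>M. \<forall>m\<ge>M. bd r \<epsilon> (\<lambda>n. coeff (cc b m x) n - clim b x n)))"
proof -
  have "\<exists>M. \<forall>m\<ge>M. pbd r \<epsilon> (cc b (Suc m) x - cc b m x)" if "0 < r" "r < 1" "0 < \<epsilon>" for r \<epsilon>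
  proof (rule perturbed_recursion_cauchy[where x = "cc b" and E = "\<lambda>n. EE (N + n)" and I = "idx b", OF finite_idx])
    show "cc b (Suc n) y = cc b n y + (\<Sum>j\<in>idx b. EE (N + n) y j * cc b n j)" for n y by simp
    show "\<exists>M. \<forall>n\<ge>M. \<forall>i\<in>idx b. \<forall>j\<in>idx b. pbd r \<epsilon> (EE (N + n) i j)" if "0 < \<epsilon>" for \<epsilon>
      by (rule EE_small[OF \<open>0 < r\<close> \<open>r < 1\<close> that b])
  qed (use that x in auto)
  from poly_sequence_limit[of "\<lambda>m. cc b m x", OF this]
  show ?thesis unfolding clim_def by (rule someI_ex)
qed

text \<open>Extended by 0 to the monomials that do not occur in the entry (a, b), so that all
  entries are sums over the same set of monomials.\<close>

definition ccoef :: "nat \<Rightarrow> nat \<Rightarrow> (nat \<times> nat \<Rightarrow> nat) \<Rightarrow> 'k ser" where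
  "ccoef a b m = (if b < d \<and> (a, m) \<in> idx b then clim b (a, m) else (\<lambda>_. 0))"

lemma inH_zero: "inH nk (\<lambda>_. 0)"
  unfolding inH_def by simp

lemma inH_ccoef: "inH nk (ccoef a b m)"
  unfolding ccoef_def using clim_prop inH_zero by auto

definition Wc :: "(nat \<Rightarrow> nat \<Rightarrow> 'k) \<Rightarrow> nat \<Rightarrow> nat \<Rightarrow> 'k ser" where
  "Wc lam a b n = (\<Sum>m\<in>monoms d (d - 1). mono_eval d lam m * ccoef a b m n)"

text \<open>Convergence in the Frechet topology of H, that is for the Gauss norm of every radius
  below 1.\<close>

definition plim :: "(nat \<Rightarrow> 'k ser) \<Rightarrow> 'k ser \<Rightarrow> bool" where
  "plim F L \<longleftrightarrow> (\<forall>r \<epsilon>. 0 < r \<longrightarrow> r < 1 \<longrightarrow> 0 < \<epsilon> \<longrightarrow> (\<exists>M. \<forall>m\<ge>M. bd r \<epsilon> (\<lambda>n. F m n - L n)))"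

lemma plimI:
  assumes "\<And>r \<epsilon>. 0 < r \<Longrightarrow> r < 1 \<Longrightarrow> 0 < \<epsilon> \<Longrightarrow> \<exists>M. \<forall>m\<ge>M. bd r \<epsilon> (\<lambda>n. F m n - L n)" shows "plim F L"
  unfolding plim_def using assms by blast

lemma plimD: "plim F L \<Longrightarrow> 0 < r \<Longrightarrow> r < 1 \<Longrightarrow> 0 < \<epsilon> \<Longrightarrow> \<exists>M. \<forall>m\<ge>M. bd r \<epsilon> (\<lambda>n. F m n - L n)"
  unfolding plim_def by blast

lemma plim_const: "plim (\<lambda>_. L) L"
  by (rule plimI) (simp add: bd_zero)

lemma plim_add:
  assumes "plim F L" "plim G L'" shows "plim (\<lambda>m n. F m n + G m n) (\<lambda>n. L n + L' n)"
proof (rule plimI)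
  fix r \<epsilon> :: real assume a: "0 < r" "r < 1" "0 < \<epsilon>"
  obtain M where M: "\<forall>m\<ge>M. bd r \<epsilon> (\<lambda>n. F m n - L n)" using plimD[OF assms(1) a] by blast
  obtain M' where M': "\<forall>m\<ge>M'. bd r \<epsilon> (\<lambda>n. G m n - L' n)" using plimD[OF assms(2) a] by blast
  have "bd r \<epsilon> (\<lambda>n. (F m n + G m n) - (L n + L' n))" if "m \<ge> max M M'" for m
  proof -
    have "bd r \<epsilon> (\<lambda>n. (F m n - L n) + (G m n - L' n))"
      by (rule bd_add) (use M M' that a in auto)
    then show ?thesis by (simp add: algebra_simps)
  qed
  then show "\<exists>M. \<forall>m\<ge>M. bd r \<epsilon> (\<lambda>n. (F m n + G m n) - (L n + L' n))" by blast
qed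

lemma plim_sum:
  assumes "finite A" "\<And>i. i \<in> A \<Longrightarrow> plim (F i) (L i)"
  shows "plim (\<lambda>m n. \<Sum>i\<in>A. F i m n) (\<lambda>n. \<Sum>i\<in>A. L i n)"
  using assms
proof (induction A rule: finite_induct)
  case empty
  then show ?case using plim_const[of "\<lambda>_. 0"] by simp
next
  case (insert i A)
  then have "plim (\<lambda>m n. F i m n + (\<Sum>i\<in>A. F i m n)) (\<lambda>n. L i n + (\<Sum>i\<in>A. L i n))"
    by (intro plim_add) simp_all
  then show ?case using insert by simp
qed

lemma plim_scale:
  assumes "plim F L" shows "plim (\<lambda>m n. c * F m n) (\<lambda>n. c * L n)"
proof (rule plimI)
  fix r \<epsilon> :: real assume a: "0 < r" "r < 1" "0 < \<epsilon>"
  have c: "0 < nk c + 1" using nk_nonneg[of c] by linarith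
  then have "0 < \<epsilon> / (nk c + 1)" using a by simp
  then obtain M where M: "\<forall>m\<ge>M. bd r (\<epsilon> / (nk c + 1)) (\<lambda>n. F m n - L n)" using plimD[OF assms a(1,2)] by blast
  have "bd r \<epsilon> (\<lambda>n. c * F m n - c * L n)" if "m \<ge> M" for m
  proof -
    have "bd r ((nk c + 1) * (\<epsilon> / (nk c + 1))) (\<lambda>n. c * (F m n - L n))"
      by (rule bd_scale) (use M that in auto)
    then show ?thesis using c by (simp add: right_diff_distrib)
  qed
  then show "\<exists>M. \<forall>m\<ge>M. bd r \<epsilon> (\<lambda>n. c * F m n - c * L n)" by blast
qed

text \<open>The ultrametric inequality absorbs an approximation error of size B, so the constant is
  kept; B has to be positive to serve as such an error.\<close>

lemma plim_bd:
  assumes F: "plim F L" and r: "0 < r" "r < 1" and B: "0 < B" and b: "\<And>m. m \<ge> m' \<Longrightarrow> bd r B (F m)"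
  shows "bd r B L"
proof -
  obtain M where M: "\<forall>m\<ge>M. bd r B (\<lambda>n. F m n - L n)" using plimD[OF F r B] by blast
  have "bd r B (\<lambda>n. F (max M m') n - (F (max M m') n - L n))"
    by (rule bd_diff) (use M b r in auto)
  then show ?thesis by simp
qed

lemma inH_add: "inH nk f \<Longrightarrow> inH nk g \<Longrightarrow> inH nk (\<lambda>n. f n + g n)"
  unfolding inH_def
proof (intro allI impI)
  fix r :: real assume a: "\<forall>r. 0 < r \<and> r < 1 \<longrightarrow> (\<lambda>n. nk (f n) * r ^ n) \<longlonglongrightarrow> 0"
    "\<forall>r. 0 < r \<and> r < 1 \<longrightarrow> (\<lambda>n. nk (g n) * r ^ n) \<longlonglongrightarrow> 0" and r: "0 < r \<and> r < 1"
  have "(\<lambda>n. nk (f n) * r ^ n + nk (g n) * r ^ n) \<longlonglongrightarrow> 0 + 0" using a r by (intro tendsto_add) auto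
  then have lim: "(\<lambda>n. nk (f n) * r ^ n + nk (g n) * r ^ n) \<longlonglongrightarrow> 0" by simp
  have "nk (f n + g n) * r ^ n \<le> nk (f n) * r ^ n + nk (g n) * r ^ n" for n
  proof -
    have "nk (f n + g n) \<le> nk (f n) + nk (g n)"
      by (rule nk_add_le) simp_all
    then show ?thesis unfolding distrib_right[symmetric] by (rule mult_right_mono) (use r in simp)
  qed
  then show "(\<lambda>n. nk (f n + g n) * r ^ n) \<longlonglongrightarrow> 0"
    by (intro tendsto_sandwich[OF _ _ tendsto_const lim] always_eventually allI) (use r in simp_all)
qed

lemma inH_scale: "inH nk f \<Longrightarrow> inH nk (\<lambda>n. c * f n)"
  unfolding inH_def nk_mult
proof (intro allI impI)
  fix r :: real assume a: "\<forall>r. 0 < r \<and> r < 1 \<longrightarrow> (\<lambda>n. nk (f n) * r ^ n) \<longlonglongrightarrow> 0" and r: "0 < r \<and> r < 1"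
  have "(\<lambda>n. nk c * (nk (f n) * r ^ n)) \<longlonglongrightarrow> nk c * 0" using a r by (intro tendsto_mult tendsto_const) auto
  then show "(\<lambda>n. nk c * nk (f n) * r ^ n) \<longlonglongrightarrow> 0" by (simp add: mult.assoc)
qed

lemma inH_sum:
  assumes "finite A" "\<And>i. i \<in> A \<Longrightarrow> inH nk (f i)" shows "inH nk (\<lambda>n. \<Sum>i\<in>A. f i n)"
  using assms
proof (induction A rule: finite_induct)
  case empty
  then show ?case using inH_zero by simp
next
  case (insert i A)
  then have "inH nk (\<lambda>n. f i n + (\<Sum>i\<in>A. f i n))" by (intro inH_add) simp_all
  then show ?case using insert by simp
qed

lemma inH_Wc: "inH nk (Wc lam a b)"
  unfolding Wc_def[abs_def] by (intro inH_sum inH_scale inH_ccoef finite_monoms)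

section \<open>The recursion in the eigenbasis and its expansion in monomials\<close>

lemma Tq_lower: assumes "unipotent d lam" "j < i" "i < d" shows "Tq lam q i j = 0"
  unfolding Tq_def
proof (rule sum.neutral, rule ballI)
  fix k assume "k \<in> {..<d}"
  have "lam i k * uinv lam k j = 0"
  proof (cases "k < i")
    case True
    then show ?thesis using unipotentD(2)[OF assms(1) True assms(3)] by simp
  next
    case False
    then show ?thesis using assms(2) by (simp add: uinv_lower)
  qed
  then show "smult (lam i k * uinv lam k j) (xk q k) = 0" by simp
qed

lemma Tq_minus_mid:
  assumes R: "meq d (mmul d lam (uinv lam)) mid" and ij: "i < d" "j < d"
  shows "Tq lam q i j - mid i j = (\<Sum>k<d. smult (lam i k * uinv lam k j) (xk q k - 1))"
proof -
  have "(\<Sum>k<d. smult (lam i k * uinv lam k j) 1) = smult (\<Sum>k<d. lam i k * uinv lam k j) (1 :: 'k poly)"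
    by (rule smult_sum[symmetric])
  also have "(\<Sum>k<d. lam i k * uinv lam k j) = mid i j" using R ij unfolding meq_def mmul_def by blast
  also have "smult (mid i j) 1 = (mid i j :: 'k poly)" unfolding mid_def by simp
  finally show ?thesis unfolding Tq_def smult_diff_right sum_subtractf by simp
qed

lemma Ym_Suc:
  assumes R: "meq d (mmul d lam (uinv lam)) mid" and i: "i < d"
  shows "Ym lam (Suc m) i b = Ym lam m i b
    + (\<Sum>j<d. smult ((\<alpha> i / \<alpha> j) ^ (N + m + 1)) (Tq lam (N + m) i j - mid i j) * Ym lam m j b)"
proof -
  have "(\<Sum>j<d. smult ((\<alpha> i / \<alpha> j) ^ (N + m + 1)) (mid i j) * Ym lam m j b) = (\<Sum>j<d. if j = i then Ym lam m i b else 0)"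
    using \<alpha>_nz by (intro sum.cong) (auto simp: mid_def)
  also have "\<dots> = Ym lam m i b" using i by simp
  finally show ?thesis by (simp add: smult_diff_right left_diff_distrib sum_subtractf)
qed

lemma Ym_lower:
  assumes "unipotent d lam" shows "b < i \<Longrightarrow> i < d \<Longrightarrow> Ym lam m i b = 0"
proof (induction m arbitrary: i)
  case 0
  then show ?case by (simp add: mid_def)
next
  case (Suc m)
  have "smult ((\<alpha> i / \<alpha> j) ^ (N + m + 1)) (Tq lam (N + m) i j) * Ym lam m j b = 0" if "j < d" for j
  proof (cases "j < i")
    case True
    then show ?thesis using Tq_lower[OF assms True Suc.prems(2)] by simp
  next
    case False
    then show ?thesis using Suc.IH[of j] Suc.prems that by simp
  qed
  then show ?case by (simp only: Ym.simps) (rule sum.neutral, simp only: lessThan_iff Ball_def, blast)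
qed

lemma smult_sum_right: "smult c (\<Sum>i\<in>A. f i) = (\<Sum>i\<in>A. smult c (f i))" for f :: "'i \<Rightarrow> 'k poly"
  by (induction A rule: infinite_finite_induct) (auto simp: smult_add_right)

lemma eps_expand:
  assumes U: "unipotent d lam" and R: "meq d (mmul d lam (uinv lam)) mid" and aj: "a \<le> j" "j < d"
  shows "smult ((\<alpha> a / \<alpha> j) ^ (q + 1)) (Tq lam q a j - mid a j)
    = (\<Sum>m\<in>monoms d (j - a). [:mono_eval d lam m:] * eps q a j m)"
proof -
  have "Tq lam q a j - mid a j = (\<Sum>k<d. smult (lam a k * uinv lam k j) (xk q k - 1))"
    by (rule Tq_minus_mid[OF R]) (use aj in auto)
  also have "\<dots> = (\<Sum>k<d. \<Sum>m\<in>monoms d (j - a). smult (mono_eval d lam m) (smult (scoef a j k m) (xk q k - 1)))"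
    by (rule sum.cong[OF refl]) (simp add: scoef[OF aj _ U] smult_sum)
  also have "\<dots> = (\<Sum>m\<in>monoms d (j - a). smult (mono_eval d lam m) (\<Sum>k<d. smult (scoef a j k m) (xk q k - 1)))"
    unfolding smult_sum_right by (rule sum.swap)
  finally have e: "Tq lam q a j - mid a j = \<dots>" .
  show ?thesis unfolding e
    by (subst smult_sum_right, rule sum.cong[OF refl], simp add: eps_def mult.commute)
qed

text \<open>Sorted by monomials, the recursion for the matrices becomes the recursion
  \<open>cc\<close>, each product preserving the degree bound since b - a = (j - a) + (b - j). As
  \<open>cc\<close> does not involve \<open>lam\<close>, convergence is only needed there.\<close>

lemma Ym_expand:
  assumes U: "unipotent d lam" and R: "meq d (mmul d lam (uinv lam)) mid" and b: "b < d"
  shows "a \<le> b \<Longrightarrow> Ym lam n a b = (\<Sum>m\<in>monoms d (b - a). [:mono_eval d lam m:] * cc b n (a, m))"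
proof (induction n arbitrary: a)
  case 0
  show ?case
  proof (cases "a = b")
    case True
    have "(\<Sum>m\<in>monoms d (b - a). [:mono_eval d lam m:] * cc b 0 (a, m))
        = (\<Sum>m\<in>monoms d (b - a). [:mono_eval d lam m:] * (if m = (\<lambda>_. 0) then 1 else 0))"
      using True by (intro sum.cong) auto
    also have "\<dots> = [:mono_eval d lam (\<lambda>_. 0):] * 1" by (rule sum_monoms_delta[OF zero_monoms])
    finally show ?thesis using True by (simp add: mono_eval_zero mid_def one_pCons)
  next
    case False
    then show ?thesis by (simp add: mid_def)
  qed
next
  case (Suc n)
  have a: "a < d" using Suc.prems b by simp
  let ?D = "\<lambda>j. smult ((\<alpha> a / \<alpha> j) ^ (N + n + 1)) (Tq lam (N + n) a j - mid a j)"
  let ?M = "monoms d (b - a)"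
  have prod_expand: "?D j * Ym lam n j b = (\<Sum>m\<in>?M. [:mono_eval d lam m:] *
      (\<Sum>m2\<in>monoms d (b - j). EE (N + n) (a, m) (j, m2) * cc b n (j, m2)))" if j: "j \<le> b" for j
  proof (cases "a \<le> j")
    case True
    have jd: "j < d" using j b by simp
    have bj: "b - a = (j - a) + (b - j)" using True j by simp
    have "?D j * Ym lam n j b = (\<Sum>m1\<in>monoms d (j - a). [:mono_eval d lam m1:] * eps (N + n) a j m1)
       * (\<Sum>m2\<in>monoms d (b - j). [:mono_eval d lam m2:] * cc b n (j, m2))"
      unfolding eps_expand[OF U R True jd] Suc.IH[OF j] ..
    also have "\<dots> = (\<Sum>m\<in>?M. [:mono_eval d lam m:] * (\<Sum>m2\<in>monoms d (b - j).
       (\<Sum>m1\<in>{m1\<in>monoms d (j - a). madd m1 m2 = m}. eps (N + n) a j m1) * cc b n (j, m2)))"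
      unfolding bj by (rule convolution_expand) (rule finite_monoms madd_monoms | assumption | simp add: mono_eval_madd)+
    finally show ?thesis unfolding EE_def using True by simp
  next
    case False
    then have "Tq lam (N + n) a j - mid a j = 0" using Tq_lower[OF U, of j a] a by (simp add: mid_def)
    then have "?D j = 0" by (simp only: smult_0_right)
    then show ?thesis unfolding EE_def using False by (simp del: smult_eq_0_iff)
  qed
  have "(\<Sum>j<d. ?D j * Ym lam n j b) = (\<Sum>j\<le>b. ?D j * Ym lam n j b)"
    by (rule sum.mono_neutral_right) (use b Ym_lower[OF U] in auto)
  also have "\<dots> = (\<Sum>j\<le>b. \<Sum>m\<in>?M. [:mono_eval d lam m:] *
      (\<Sum>m2\<in>monoms d (b - j). EE (N + n) (a, m) (j, m2) * cc b n (j, m2)))"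
    by (rule sum.cong[OF refl]) (rule prod_expand, simp)
  also have "\<dots> = (\<Sum>m\<in>?M. \<Sum>j\<le>b. [:mono_eval d lam m:] *
      (\<Sum>m2\<in>monoms d (b - j). EE (N + n) (a, m) (j, m2) * cc b n (j, m2)))"
    by (rule sum.swap)
  also have "\<dots> = (\<Sum>m\<in>?M. [:mono_eval d lam m:] * (\<Sum>y\<in>idx b. EE (N + n) (a, m) y * cc b n y))"
    unfolding idx_def sum_distrib_left[symmetric]
    by (subst sum.Sigma) (auto simp: finite_monoms split_beta)
  finally have "Ym lam (Suc n) a b = (\<Sum>m\<in>?M. [:mono_eval d lam m:] * cc b n (a, m))
     + (\<Sum>m\<in>?M. [:mono_eval d lam m:] * (\<Sum>y\<in>idx b. EE (N + n) (a, m) y * cc b n y))"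
    unfolding Ym_Suc[OF R a] Suc.IH[OF Suc.prems] by (rule arg_cong)
  then show ?case by (simp only: cc.simps distrib_left sum.distrib)
qed

lemma Ym_limit:
  assumes U: "unipotent d lam" and R: "meq d (mmul d lam (uinv lam)) mid" and ab: "a < d" "b < d"
  shows "plim (\<lambda>n. coeff (Ym lam n a b)) (Wc lam a b)"
proof (cases "a \<le> b")
  case True
  have W: "Wc lam a b n = (\<Sum>m\<in>monoms d (b - a). mono_eval d lam m * clim b (a, m) n)" for n
    unfolding Wc_def
  proof (rule sum.mono_neutral_cong_right)
    show "monoms d (b - a) \<subseteq> monoms d (d - 1)" using ab by (intro monoms_mono) simp
  qed (use True ab in \<open>auto simp: ccoef_def idx_def finite_monoms\<close>)
  have coeffs: "(\<lambda>n. coeff (\<Sum>m\<in>monoms d (b - a). [:mono_eval d lam m:] * cc b n (a, m)))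
      = (\<lambda>n k. \<Sum>m\<in>monoms d (b - a). mono_eval d lam m * coeff (cc b n (a, m)) k)"
    by (intro ext) (simp add: coeff_sum)
  have "plim (\<lambda>n k. \<Sum>m\<in>monoms d (b - a). mono_eval d lam m * coeff (cc b n (a, m)) k)
     (\<lambda>k. \<Sum>m\<in>monoms d (b - a). mono_eval d lam m * clim b (a, m) k)"
  proof (intro plim_sum plim_scale finite_monoms)
    fix m assume "m \<in> monoms d (b - a)"
    then have "(a, m) \<in> idx b" unfolding idx_def using True by simp
    then show "plim (\<lambda>n. coeff (cc b n (a, m))) (clim b (a, m))"
      using clim_prop[OF ab(2)] unfolding plim_def by blast
  qed
  then show ?thesis
    unfolding W[abs_def] Ym_expand[OF U R ab(2) True] coeffs .
next
  case False
  have "Wc lam a b = (\<lambda>_. 0)" unfolding Wc_def[abs_def] ccoef_def idx_def using False by simp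
  then show ?thesis using Ym_lower[OF U, of b a] using False ab plim_const[of "\<lambda>_. 0"] by (simp add: zero_poly.rep_eq)
qed

section \<open>The slope bound and the growth of the limit\<close>

definition sig :: real where
  "sig = real \<beta> + Max {ordp p nk (\<alpha> k) - real_of_int (t i) | i k. i \<le> k \<and> k < d}"

lemma sig_ge: assumes "i \<le> k" "k < d" shows "real \<beta> + ordp p nk (\<alpha> k) - real_of_int (t i) \<le> sig"
proof -
  let ?S = "{ordp p nk (\<alpha> k) - real_of_int (t i) | i k. i \<le> k \<and> k < d}"
  have "?S \<subseteq> (\<lambda>(i, k). ordp p nk (\<alpha> k) - real_of_int (t i)) ` ({..<d} \<times> {..<d})"
  proof
    fix x assume "x \<in> ?S"
    then obtain i k where "x = ordp p nk (\<alpha> k) - real_of_int (t i)" "i \<le> k" "k < d" by blast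
    then show "x \<in> (\<lambda>(i, k). ordp p nk (\<alpha> k) - real_of_int (t i)) ` ({..<d} \<times> {..<d})"
      by (intro image_eqI[of _ _ "(i, k)"]) auto
  qed
  then have "finite ?S" by (rule finite_subset) simp
  then have "ordp p nk (\<alpha> k) - real_of_int (t i) \<le> Max ?S" by (rule Max_ge) (use assms in blast)
  then show ?thesis unfolding sig_def by linarith
qed

text \<open>An instance of \<open>slope_estimate\<close>, carried over to the limit:
  \<open>\<tau> i / nk (\<alpha> j)\<close> is p to the power t_d - t_i + \<open>\<beta>\<close> +
  ord(\<alpha> j), and the shift by t_d in the definition of slope makes this at most
  \<open>\<sigma>\<close>.\<close>

lemma Wc_slope:
  assumes U: "unipotent d lam" and R: "meq d (mmul d lam (uinv lam)) mid"
  shows "\<exists>C>0. \<forall>n i b. i < d \<longrightarrow> b < d \<longrightarrow>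
    bd (rr n) (C * (real p powr (sig + real_of_int (t (d - 1)))) ^ n * nk (\<alpha> i) ^ n) (Wc lam i b)"
proof -
  define \<sigma> where "\<sigma> = real p powr (sig + real_of_int (t (d - 1)))"
  have \<sigma>: "0 < \<sigma>" unfolding \<sigma>_def using p_pos by simp
  define \<tau> where "\<tau> i = real p ^ (nat (t (d - 1) - t i) + \<beta>)" for i
  have \<tau>0: "0 \<le> \<tau> i" for i unfolding \<tau>_def by simp
  define A where "A = {..<d} \<times> {..<d} \<times> {..<d}"
  define C where "C = 1 + (\<Sum>(i, k, j)\<in>A. nk (lam i k * uinv lam k j))"
  have C1: "1 \<le> C" unfolding C_def by (simp add: sum_nonneg split_beta)
  have CA: "nk (lam i k * uinv lam k j) \<le> C" if "i < d" "k < d" "j < d" for i k j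
  proof -
    have "(\<lambda>(i, k, j). nk (lam i k * uinv lam k j)) (i, k, j) \<le> (\<Sum>(i, k, j)\<in>A. nk (lam i k * uinv lam k j))"
      by (rule member_le_sum) (use that in \<open>auto simp: A_def\<close>)
    then show ?thesis unfolding C_def by simp
  qed
  \<comment> \<open>Terms with k \<ge> i involve the shorter interval ]t_k, t_d], so
    \<open>\<tau> i\<close> serves the whole row.\<close>
  have \<tau>_mono: "\<tau> k \<le> \<tau> i" if "i \<le> k" "k < d" for i k
    unfolding \<tau>_def using t_le[OF that] p_gt1 by (intro power_increasing add_right_mono nat_mono) auto
  have TA: "pbd 1 (\<tau> i * (if i = j then 1 else C)) (Tq lam q i j)" if ij: "i \<le> j" "j < d" for q i j
    unfolding Tq_def
  proof (rule pbd_sum)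
    let ?w = "if i = j then 1 else C"
    show nn: "0 \<le> \<tau> i * ?w" using \<tau>0[of i] C1 by simp
    fix k assume "k \<in> {..<d}"
    then have k: "k < d" by simp
    show "pbd 1 (\<tau> i * ?w) (smult (lam i k * uinv lam k j) (xk q k))"
    proof (cases "i \<le> k \<and> k \<le> j")
      case True
      have "nk (lam i k * uinv lam k j) \<le> ?w"
      proof (cases "i = j")
        \<comment> \<open>On the diagonal only k = i contributes, with coefficient 1, so no constant
          is lost there.\<close>
        case eq: True
        then have "k = i" using True by simp
        then show ?thesis using eq unipotentD(1)[OF U k] by (simp add: uinv_diag)
      qed (use CA ij k in auto)
      then have "pbd 1 (?w * \<tau> k) (smult (lam i k * uinv lam k j) (xk q k))"
        unfolding \<tau>_def by (intro pbd_smult xk_bound k)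
      moreover have "?w * \<tau> k \<le> \<tau> i * ?w"
        unfolding mult.commute[of "\<tau> i"] by (rule mult_left_mono) (use True k C1 \<tau>_mono in auto)
      ultimately show ?thesis by (rule bd_mono)
    next
      case False
      then have z: "lam i k * uinv lam k j = 0"
        using unipotentD(2)[OF U, of k i] uinv_lower[of j k lam] ij by (cases "k < i") auto
      show ?thesis unfolding z smult_0_left by (rule pbd_0[OF nn])
    qed
  qed simp
  define K where "K = C * real p ^ (h + \<beta>)"
  have K1: "1 \<le> K" unfolding K_def using mult_mono[OF C1 p_power_ge1] C1 by simp
  have TB: "pbd (rr k) (K * (1 / real p ^ (q - k)) ^ h) (Tq lam q i j - mid i j)"
    if kq: "k \<le> q" and ij: "i \<le> j" "j < d" for k q i j
  proof -
    have i: "i < d" using ij by simp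
    show ?thesis unfolding Tq_minus_mid[OF R i ij(2)]
    proof (rule pbd_sum)
      fix k' assume "k' \<in> {..<d}"
      then have k': "k' < d" by simp
      show "pbd (rr k) (K * (1 / real p ^ (q - k)) ^ h) (smult (lam i k' * uinv lam k' j) (xk q k' - 1))"
        unfolding K_def mult.assoc by (intro pbd_smult xk_minus_1_bound k' kq CA i ij)
    qed (use K1 rr_pos[of k] in \<open>auto intro!: mult_nonneg_nonneg\<close>)
  qed
  have S: "\<tau> i / nk (\<alpha> j) \<le> \<sigma>" if ij: "i \<le> j" "j < d" for i j
  proof -
    have na: "0 < nk (\<alpha> j)" using \<alpha>_nz[OF ij(2)] by (rule nk_pos)
    have "nk (\<alpha> j) = real p powr (- ordp p nk (\<alpha> j))"
      unfolding ordp_def using na p_gt1 by simp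
    then have 1: "1 / nk (\<alpha> j) = real p powr (ordp p nk (\<alpha> j))" by (simp add: powr_minus inverse_eq_divide)
    have "t i \<le> t (d - 1)" using ij d by (intro t_le) auto
    then have "real (nat (t (d - 1) - t i) + \<beta>) = real_of_int (t (d - 1)) - real_of_int (t i) + real \<beta>" by simp
    then have 2: "\<tau> i = real p powr (real_of_int (t (d - 1)) - real_of_int (t i) + real \<beta>)"
      unfolding \<tau>_def using p_pos by (metis powr_realpow)
    have "\<tau> i / nk (\<alpha> j) = \<tau> i * (1 / nk (\<alpha> j))" by simp
    also have "\<dots> = real p powr ((real_of_int (t (d - 1)) - real_of_int (t i) + real \<beta>) + ordp p nk (\<alpha> j))"
      unfolding 1 2 by (rule powr_add[symmetric])
    also have "\<dots> \<le> \<sigma>" unfolding \<sigma>_def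
      using sig_ge[OF ij] p_gt1 by (intro powr_mono) auto
    finally show ?thesis .
  qed
  obtain \<theta> where \<theta>: "\<theta> > 0" "\<theta> < 1" "\<And>i j. i \<le> j \<Longrightarrow> j < d \<Longrightarrow> nk (\<alpha> i / \<alpha> j) \<le> \<theta> * real p ^ h"
    using theta_exists by blast
  have "\<exists>c\<ge>0. \<forall>n m i b. i < d \<longrightarrow> b < d \<longrightarrow> n \<le> N + m \<longrightarrow> pbd (rr n) (c * \<sigma> ^ n * nk (\<alpha> i) ^ n) (Ym lam m i b)"
    by (rule slope_estimate[where \<alpha> = \<alpha> and d = d and T = "Tq lam" and \<tau> = \<tau> and C = C and \<sigma> = \<sigma> and K = K and h = h and \<theta> = \<theta>])
      (fact \<alpha>_nz Tq_lower[OF U] TA C1 \<tau>0 S \<sigma> TB K1 \<theta> | simp)+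
  then obtain c where c: "c \<ge> 0" "\<And>n m i b. i < d \<Longrightarrow> b < d \<Longrightarrow> n \<le> N + m \<Longrightarrow> pbd (rr n) (c * \<sigma> ^ n * nk (\<alpha> i) ^ n) (Ym lam m i b)"
    by blast
  \<comment> \<open>The constant c may be 0, while the passage to the limit asks for a positive
    bound.\<close>
  have "bd (rr n) ((c + 1) * \<sigma> ^ n * nk (\<alpha> i) ^ n) (Wc lam i b)" if ib: "i < d" "b < d" for n i b
  proof (rule plim_bd[OF Ym_limit[OF U R ib] rr_pos rr_lt1, where m' = n])
    show "0 < (c + 1) * \<sigma> ^ n * nk (\<alpha> i) ^ n"
      using c(1) \<sigma> nk_pos[OF \<alpha>_nz[OF ib(1)]] by (intro mult_pos_pos zero_less_power) auto
    fix m assume m: "n \<le> m"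
    have "c * \<sigma> ^ n * nk (\<alpha> i) ^ n \<le> (c + 1) * \<sigma> ^ n * nk (\<alpha> i) ^ n"
      by (intro mult_right_mono zero_le_power nk_nonneg less_imp_le[OF \<sigma>]) simp
    moreover have "n \<le> N + m" using m by simp
    ultimately show "pbd (rr n) ((c + 1) * \<sigma> ^ n * nk (\<alpha> i) ^ n) (Ym lam m i b)"
      using bd_mono[OF c(2)[OF ib]] by blast
  qed
  then show ?thesis using c(1) unfolding \<sigma>_def by (intro exI[of _ "c + 1"]) auto
qed

end

section \<open>Back to the standard basis\<close>

text \<open>An invertible matrix kills no basis vector. In the final proof this makes the
  assumptions on the module contradictory when some \<alpha> i is 0.\<close>

lemma eigenvalue_nonzero:
  fixes Phi :: "nat \<Rightarrow> nat \<Rightarrow> 'a::field"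
  assumes Phi: "minvertible d Phi" and e: "is_basis d e"
    and eig: "mapply d Phi (e i) = (\<lambda>a. \<alpha> i * e i a)" and i: "i < d"
  shows "\<alpha> i \<noteq> 0"
proof
  assume z: "\<alpha> i = 0"
  define E where "E = (\<lambda>x y. e y x)"
  have E2: "meq d (mmul d (minv d E) E) mid"
    unfolding E_def by (rule minv_inverse(2)[OF is_basis_invertible[OF e]])
  have 0: "mmul d Phi E a i = 0" if "a < d" for a
    using fun_cong[OF eig, of a] that z unfolding mapply_def mmul_def E_def by simp
  have "E a i = 0" if a: "a < d" for a
  proof -
    have "meq d (mmul d (minv d Phi) (mmul d Phi E)) E"
      unfolding mmul_assoc[symmetric]
      by (rule meq_trans[OF meq_mmul[OF minv_inverse(2)[OF Phi] meq_refl] mmul_mid_left])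
    then have "E a i = (\<Sum>k<d. minv d Phi a k * mmul d Phi E k i)"
      using a i unfolding meq_def mmul_def[of d "minv d Phi"] by simp
    then show ?thesis using 0 by simp
  qed
  then have "mmul d (minv d E) E i i = 0" unfolding mmul_def by simp
  then show False using E2 i unfolding meq_def mid_def by simp
qed

lemma mconst_dg: "mconst (dg f) = dg (\<lambda>i. [:f i:])" for f :: "nat \<Rightarrow> 'a::comm_ring_1"
  by (intro ext) (simp add: mconst_def dg_def)

lemma cprod_sum_right: "cprod f (\<lambda>n. \<Sum>i\<in>A. c i * g i n) k = (\<Sum>i\<in>A. c i * cprod f (g i) k)"
proof -
  have "cprod f (\<lambda>n. \<Sum>i\<in>A. c i * g i n) k = (\<Sum>l\<le>k. \<Sum>i\<in>A. c i * (f l * g i (k - l)))"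
    unfolding cprod_def sum_distrib_left by (intro sum.cong refl) (simp add: mult_ac)
  also have "\<dots> = (\<Sum>i\<in>A. c i * cprod f (g i) k)"
    unfolding cprod_def sum_distrib_left by (rule sum.swap)
  finally show ?thesis .
qed

context padic
begin

lemma inLam_bounded: assumes "inLam nk f" shows "\<exists>L. bd 1 L f"
proof -
  obtain c where c: "c \<noteq> 0" "\<And>n. nk (c * f n) \<le> 1" using assms unfolding inLam_def by blast
  have "nk (f n) \<le> 1 / nk c" for n
    using c(2)[of n] nk_pos[OF c(1)] by (simp add: nk_mult field_simps)
  then have "bd 1 (1 / nk c) f" unfolding bd_def by simp
  then show ?thesis by blast
qed

end

locale refined_module = refinement_datum p nk u N d jl jr \<alpha> t
  for p and nk :: "'k::field_char_0 \<Rightarrow> real" and u N d jl jr \<alpha> t +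
  fixes Phi :: "nat \<Rightarrow> nat \<Rightarrow> 'k" and v e lam
  assumes Phi: "minvertible d Phi" and bv: "is_basis d v" and be: "is_basis d e"
    and eig: "\<forall>i<d. mapply d Phi (e i) = (\<lambda>a. \<alpha> i * e i a)"
    and vlam: "\<forall>j<d. v j = (\<lambda>a. \<Sum>i<d. lam i j * e i a)"
    and U: "unipotent d lam"
begin

section \<open>Change between the eigenbasis, the adapted basis and the standard basis\<close>

definition E where "E = (\<lambda>x y. e y x)"
definition E' where "E' = minv d E"
definition V where "V = (\<lambda>x y. v y x)"
definition V' where "V' = minv d V"

lemma EE': "meq d (mmul d E E') mid" and E'E: "meq d (mmul d E' E) mid"
  unfolding E'_def E_def using minv_inverse[OF is_basis_invertible[OF be]] by auto

lemma VV': "meq d (mmul d V V') mid" and V'V: "meq d (mmul d V' V) mid"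
  unfolding V'_def V_def using minv_inverse[OF is_basis_invertible[OF bv]] by auto

lemma V_eq: "meq d V (mmul d E lam)"
  unfolding meq_def mmul_def V_def E_def using vlam by (simp add: mult.commute)

text \<open>The recursion only makes \<open>uinv lam\<close> a left inverse. As \<open>lam\<close>
  is E^(-1) V, it has the right inverse V^(-1) E, and the two must agree.\<close>

lemma lam_right_inverse: "meq d (mmul d lam (uinv lam)) mid"
proof -
  have "meq d (mmul d E' V) (mmul d (mmul d E' E) lam)"
    unfolding mmul_assoc by (rule meq_mmul[OF meq_refl V_eq])
  also have "meq d (mmul d (mmul d E' E) lam) lam"
    by (rule meq_trans[OF meq_mmul[OF E'E meq_refl] mmul_mid_left])
  finally (meq_trans) have "meq d (mmul d E' V) lam" .
  then have "meq d (mmul d lam (mmul d V' E)) (mmul d (mmul d E' V) (mmul d V' E))"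
    by (intro meq_mmul[OF meq_sym meq_refl])
  also have "mmul d (mmul d E' V) (mmul d V' E) = mmul d (mmul d E' (mmul d V V')) E"
    by (simp only: mmul_assoc)
  also have "meq d (mmul d (mmul d E' (mmul d V V')) E) (mmul d (mmul d E' mid) E)"
    by (intro meq_mmul meq_refl VV')
  also (meq_trans) have "meq d (mmul d (mmul d E' mid) E) (mmul d E' E)"
    by (intro meq_mmul meq_refl mmul_mid_right)
  also (meq_trans) have "meq d (mmul d E' E) mid" by (rule E'E)
  finally (meq_trans) have r: "meq d (mmul d lam (mmul d V' E)) mid" .
  have "meq d (uinv lam) (mmul d V' E)"
    by (rule left_right_inverse[OF uinv_left_inverse[OF U] r])
  then show ?thesis by (rule meq_trans[OF meq_mmul[OF meq_refl] r])
qed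

lemma V'_eq: "meq d V' (mmul d (uinv lam) E')"
proof (rule left_right_inverse[OF V'V])
  have "meq d (mmul d V (mmul d (uinv lam) E')) (mmul d (mmul d E lam) (mmul d (uinv lam) E'))"
    by (rule meq_mmul[OF V_eq meq_refl])
  also have "mmul d (mmul d E lam) (mmul d (uinv lam) E') = mmul d (mmul d E (mmul d lam (uinv lam))) E'"
    by (simp only: mmul_assoc)
  also have "meq d (mmul d (mmul d E (mmul d lam (uinv lam))) E') (mmul d (mmul d E mid) E')"
    by (intro meq_mmul meq_refl lam_right_inverse)
  also (meq_trans) have "meq d (mmul d (mmul d E mid) E') (mmul d E E')"
    by (intro meq_mmul meq_refl mmul_mid_right)
  also (meq_trans) have "meq d (mmul d E E') mid" by (rule EE')
  finally (meq_trans) show "meq d (mmul d V (mmul d (uinv lam) E')) mid" .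
qed

lemma Phi_cnj: "meq d Phi (cnj d E E' (dg \<alpha>))"
proof -
  have "meq d (mmul d Phi E) (mmul d E (dg \<alpha>))"
    unfolding meq_def
  proof (intro allI impI)
    fix x y assume xy: "x < d" "y < d"
    have "mmul d Phi E x y = mapply d Phi (e y) x" unfolding mmul_def mapply_def E_def using xy by simp
    also have "\<dots> = \<alpha> y * e y x" using eig xy by simp
    finally show "mmul d Phi E x y = mmul d E (dg \<alpha>) x y"
      unfolding mmul_dg_right[OF xy(2)] E_def by simp
  qed
  then have 1: "meq d (mmul d (mmul d Phi E) E') (cnj d E E' (dg \<alpha>))"
    unfolding cnj_def by (rule meq_mmul[OF _ meq_refl])
  have "meq d (mmul d Phi (mmul d E E')) Phi"
    by (rule meq_trans[OF meq_mmul[OF meq_refl EE'] mmul_mid_right])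
  then show ?thesis using 1 unfolding mmul_assoc by (rule meq_trans[OF meq_sym])
qed

lemma Phi_inv_cnj: "meq d (minv d Phi) (cnj d E E' (dg (\<lambda>i. inverse (\<alpha> i))))"
proof (rule left_right_inverse[OF minv_inverse(2)[OF Phi]])
  have "meq d (mmul d (dg \<alpha>) (dg (\<lambda>i. inverse (\<alpha> i)))) mid"
    unfolding meq_def by (simp add: mmul_dg_left dg_def mid_def \<alpha>_nz)
  from meq_trans[OF cnj_meq[OF this] cnj_mid[OF EE']]
  show "meq d (mmul d Phi (cnj d E E' (dg (\<lambda>i. inverse (\<alpha> i))))) mid"
    by (rule meq_trans[OF cnj_mult[OF E'E Phi_cnj meq_refl]])
qed

abbreviation "cE \<equiv> cnj d (mconst E) (mconst E')"

lemma pE'E: "meq d (mmul d (mconst E') (mconst E)) mid"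
  unfolding mmul_mconst mconst_mid[symmetric] by (rule meq_mconst[OF E'E])

lemma pEE': "meq d (mmul d (mconst E) (mconst E')) mid"
  unfolding mmul_mconst mconst_mid[symmetric] by (rule meq_mconst[OF EE'])

lemma Phi_pow_cnj: "meq d (mconst (mpow d Phi n)) (cE (dg (\<lambda>i. [:\<alpha> i ^ n:])))"
  unfolding mconst_dg[symmetric] cnj_mconst
  by (rule meq_mconst[OF cnj_mpow[OF E'E EE' Phi_cnj]])

lemma Phi_inv_pow: "meq d (mpow d (minv d Phi) n) (cnj d E E' (dg (\<lambda>i. inverse (\<alpha> i) ^ n)))"
  by (rule cnj_mpow[OF E'E EE' Phi_inv_cnj])

lemma Phi_inv_pow_cnj: "meq d (mconst (mpow d (minv d Phi) n)) (cE (dg (\<lambda>i. [:inverse (\<alpha> i) ^ n:])))"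
  unfolding mconst_dg[symmetric] cnj_mconst by (rule meq_mconst[OF Phi_inv_pow])

text \<open>Since V = E \<open>lam\<close>, conjugating the diagonal matrix by V amounts to
  conjugating it by \<open>lam\<close>, which gives \<open>Tq lam q\<close>, and then by E.\<close>

lemma Tmat_cnj: "meq d (Tmat p u d {jl..jr} t v q) (cE (Tq lam q))"
proof -
  have sandwich: "mmul d (mmul d A (dg (xk q))) B i j = (\<Sum>k<d. A i k * xk q k * B k j)" for A B i j
    unfolding mmul_def[of d _ B] by (rule sum.cong[OF refl]) (simp add: mmul_dg_right)
  have T: "Tmat p u d {jl..jr} t v q = mmul d (mmul d (mconst V) (dg (xk q))) (mconst V')"
    by (intro ext) (simp only: Tmat_def sandwich mconst_def V'_def V_def)
  have 1: "meq d (mmul d (mmul d (mconst V) (dg (xk q))) (mconst V'))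
      (mmul d (mmul d (mconst (mmul d E lam)) (dg (xk q))) (mconst (mmul d (uinv lam) E')))"
    by (intro meq_mmul meq_refl meq_mconst V_eq V'_eq)
  have 2: "mmul d (mmul d (mconst (mmul d E lam)) (dg (xk q))) (mconst (mmul d (uinv lam) E'))
    = cE (mmul d (mmul d (mconst lam) (dg (xk q))) (mconst (uinv lam)))"
    unfolding cnj_def mmul_mconst[symmetric] by (simp only: mmul_assoc)
  have c: "[:x:] * f * [:y:] = smult (x * y) f" for x y and f :: "'k poly"
    by (simp add: mult.commute)
  have "meq d (mmul d (mmul d (mconst lam) (dg (xk q))) (mconst (uinv lam))) (Tq lam q)"
    unfolding meq_def sandwich Tq_def mconst_def c by blast
  then show ?thesis unfolding T by (rule meq_trans[OF 1[unfolded 2] cnj_meq])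
qed

lemma Zs_cnj: "meq d (Zs p u d {jl..jr} t Phi v N m) (cE (Ym lam m))"
proof (induction m)
  case 0
  show ?case using meq_sym[OF cnj_mid[OF pEE']] by simp
next
  case (Suc m)
  let ?q = "N + m"
  let ?A = "dg (\<lambda>i. [:\<alpha> i ^ (?q + 1):])" and ?B = "dg (\<lambda>i. [:inverse (\<alpha> i) ^ (?q + 1):])"
  have "meq d (Zs p u d {jl..jr} t Phi v N (Suc m)) (cE (mmul d (mmul d (mmul d ?A (Tq lam ?q)) ?B) (Ym lam m)))"
    unfolding Zs.simps
    by (intro cnj_mult[OF pE'E] Phi_pow_cnj Phi_inv_pow_cnj Tmat_cnj Suc)
  moreover have "meq d (mmul d (mmul d (mmul d ?A (Tq lam ?q)) ?B) (Ym lam m)) (Ym lam (Suc m))"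
    unfolding meq_def
  proof (intro allI impI)
    fix i b assume i: "i < d" and b: "b < d"
    have "mmul d (mmul d ?A (Tq lam ?q)) ?B i j = smult ((\<alpha> i / \<alpha> j) ^ (?q + 1)) (Tq lam ?q i j)" if j: "j < d" for j
      unfolding mmul_dg_right[OF j] mmul_dg_left[OF i] divide_inverse power_mult_distrib by (simp add: mult.commute)
    then show "mmul d (mmul d (mmul d ?A (Tq lam ?q)) ?B) (Ym lam m) i b = Ym lam (Suc m) i b"
      unfolding mmul_def[of d _ "Ym lam m"] Ym.simps by (intro sum.cong refl) (simp only: lessThan_iff)
  qed
  ultimately show ?case by (rule meq_trans[OF _ cnj_meq])
qed

section \<open>The limit in the standard basis and the slope of the module it generates\<close>

definition Zinf :: "nat \<Rightarrow> nat \<Rightarrow> 'k ser" where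
  "Zinf k l = (\<lambda>n. \<Sum>b<d. E' b l * (\<Sum>a<d. E k a * Wc lam a b n))"

lemma Zinf_cnj: "(\<lambda>k l. Zinf k l n) = cnj d E E' (\<lambda>a b. Wc lam a b n)"
  by (intro ext) (simp add: Zinf_def cnj_def mmul_def mult.commute)

lemma inH_Zinf: "inH nk (Zinf k l)"
  unfolding Zinf_def by (intro inH_sum inH_scale inH_Wc finite_lessThan)

lemma Zs_limit: assumes "k < d" "l < d"
  shows "plim (\<lambda>m. coeff (Zs p u d {jl..jr} t Phi v N m k l)) (Zinf k l)"
proof -
  have "Zs p u d {jl..jr} t Phi v N m k l = (\<Sum>b<d. smult (E' b l) (\<Sum>a<d. smult (E k a) (Ym lam m a b)))" for m
  proof -
    have "Zs p u d {jl..jr} t Phi v N m k l = cE (Ym lam m) k l" using Zs_cnj assms unfolding meq_def by blast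
    moreover have c: "f * [:x:] = smult x f" "[:x:] * f = smult x f" for x and f :: "'k poly"
      by (simp_all add: mult.commute)
    ultimately show ?thesis by (simp only: cnj_def mmul_def mconst_def c)
  qed
  then have eq: "(\<lambda>m. coeff (Zs p u d {jl..jr} t Phi v N m k l))
      = (\<lambda>m n. \<Sum>b<d. E' b l * (\<Sum>a<d. E k a * coeff (Ym lam m a b) n))"
    by (intro ext) (simp add: coeff_sum)
  show ?thesis unfolding eq Zinf_def
    by (intro plim_sum plim_scale finite_lessThan Ym_limit[OF U lam_right_inverse]) auto
qed

lemma Zinf_in_eigenbasis:
  assumes "a < d" "b < d"
  shows "(\<Sum>k<d. \<Sum>l<d. E' a k * Zinf k l n * E l b) = Wc lam a b n"
proof -
  let ?W = "\<lambda>a b. Wc lam a b n"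
  have 1: "(\<Sum>k<d. \<Sum>l<d. E' a k * Zinf k l n * E l b) = cnj d E' E (\<lambda>k l. Zinf k l n) a b"
    unfolding cnj_def mmul_def sum_distrib_right by (rule sum.swap)
  have 2: "cnj d E' E (\<lambda>k l. Zinf k l n) = mmul d (mmul d (mmul d E' E) ?W) (mmul d E' E)"
    unfolding Zinf_cnj unfolding cnj_def by (simp only: mmul_assoc)
  have "mmul d (mmul d (mmul d E' E) ?W) (mmul d E' E) a b = ?W a b"
  proof -
    have "meq d (mmul d (mmul d (mmul d E' E) ?W) (mmul d E' E)) (mmul d (mmul d mid ?W) mid)"
      by (intro meq_mmul meq_refl E'E)
    then have "meq d (mmul d (mmul d (mmul d E' E) ?W) (mmul d E' E)) ?W"
      by (rule meq_trans[OF _ meq_trans[OF mmul_mid_right mmul_mid_left]])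
    then show ?thesis using assms unfolding meq_def by blast
  qed
  then show ?thesis unfolding 1 2 .
qed

text \<open>In the eigenbasis the n-th power of the inverse of \<phi> divides row i by
  \<open>\<alpha> i ^ n\<close>, which cancels exactly the factor \<open>nk (\<alpha> i) ^ n\<close>
  of \<open>Wc_slope\<close>. The change of basis costs a constant independent of n.\<close>

lemma Phi_inv_Zinf_bound:
  "\<exists>D\<ge>0. \<forall>n a c. a < d \<longrightarrow> c < d \<longrightarrow>
    bd (rr n) (D * (real p powr (sig + real_of_int (t (d - 1)))) ^ n)
      (\<lambda>k. \<Sum>b<d. mpow d (minv d Phi) n a b * Zinf b c k)"
proof -
  define \<sigma> where "\<sigma> = real p powr (sig + real_of_int (t (d - 1)))"
  have \<sigma>0: "0 \<le> \<sigma>" unfolding \<sigma>_def by simp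
  obtain C where C: "C > 0" "\<And>n i b. i < d \<Longrightarrow> b < d \<Longrightarrow>
    bd (rr n) (C * \<sigma> ^ n * nk (\<alpha> i) ^ n) (Wc lam i b)"
    using Wc_slope[OF U lam_right_inverse] unfolding \<sigma>_def by blast
  define B where "B = (\<Sum>z\<in>{..<d} \<times> {..<d}. nk (E (fst z) (snd z)))"
  define B' where "B' = (\<Sum>z\<in>{..<d} \<times> {..<d}. nk (E' (fst z) (snd z)))"
  have B: "nk (E a i) \<le> B" if "a < d" "i < d" for a i
    unfolding B_def using member_le_sum[of "(a, i)" "{..<d} \<times> {..<d}" "\<lambda>z. nk (E (fst z) (snd z))"] that by simp
  have B': "nk (E' a i) \<le> B'" if "a < d" "i < d" for a i
    unfolding B'_def using member_le_sum[of "(a, i)" "{..<d} \<times> {..<d}" "\<lambda>z. nk (E' (fst z) (snd z))"] that by simp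
  have BB: "0 \<le> B" "0 \<le> B'" unfolding B_def B'_def by (simp_all add: sum_nonneg)
  have r0: "0 \<le> rr n" for n using rr_pos[of n] by simp
  have bound: "bd (rr n) (B' * (B * (C * \<sigma> ^ n))) (\<lambda>k. \<Sum>b<d. mpow d (minv d Phi) n a b * Zinf b c k)"
    if ac: "a < d" "c < d" for n a c
  proof -
    have T: "bd (rr n) (C * \<sigma> ^ n) (\<lambda>k. inverse (\<alpha> i) ^ n * Wc lam i b k)" if "i < d" "b < d" for i b
    proof -
      have "bd (rr n) (inverse (nk (\<alpha> i)) ^ n * (C * \<sigma> ^ n * nk (\<alpha> i) ^ n)) (\<lambda>k. inverse (\<alpha> i) ^ n * Wc lam i b k)"
        by (rule bd_scale[OF C(2)[OF that]]) (simp only: nk_power nk_inverse order_refl)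
      moreover have "inverse (nk (\<alpha> i)) ^ n * (C * \<sigma> ^ n * nk (\<alpha> i) ^ n) = C * \<sigma> ^ n"
        using \<alpha>_nz[OF that(1)] by (simp add: power_inverse)
      ultimately show ?thesis by metis
    qed
    have "(\<Sum>b<d. mpow d (minv d Phi) n a b * Zinf b c k)
        = (\<Sum>b<d. E' b c * (\<Sum>i<d. E a i * (inverse (\<alpha> i) ^ n * Wc lam i b k)))" for k
    proof -
      have "meq d (mmul d (mpow d (minv d Phi) n) (\<lambda>k' l. Zinf k' l k))
        (cnj d E E' (mmul d (dg (\<lambda>i. inverse (\<alpha> i) ^ n)) (\<lambda>a b. Wc lam a b k)))"
        unfolding Zinf_cnj by (rule cnj_mult[OF E'E Phi_inv_pow meq_refl])
      then have "(\<Sum>b<d. mpow d (minv d Phi) n a b * Zinf b c k)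
        = cnj d E E' (mmul d (dg (\<lambda>i. inverse (\<alpha> i) ^ n)) (\<lambda>a b. Wc lam a b k)) a c"
        using ac unfolding meq_def mmul_def[of d "mpow d (minv d Phi) n"] by blast
      also have "\<dots> = (\<Sum>b<d. (\<Sum>i<d. E a i * mmul d (dg (\<lambda>i. inverse (\<alpha> i) ^ n)) (\<lambda>a b. Wc lam a b k) i b) * E' b c)"
        unfolding cnj_def mmul_def[of d _ E'] mmul_def[of d E] ..
      also have "\<dots> = (\<Sum>b<d. (\<Sum>i<d. E a i * (inverse (\<alpha> i) ^ n * Wc lam i b k)) * E' b c)"
        by (rule sum.cong[OF refl], rule arg_cong2[where f = times, OF sum.cong[OF refl] refl])
          (simp only: lessThan_iff mmul_dg_left)
      also have "\<dots> = (\<Sum>b<d. E' b c * (\<Sum>i<d. E a i * (inverse (\<alpha> i) ^ n * Wc lam i b k)))"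
        by (rule sum.cong[OF refl mult.commute])
      finally show ?thesis .
    qed
    moreover have "bd (rr n) (B' * (B * (C * \<sigma> ^ n))) (\<lambda>k. \<Sum>b<d. E' b c * (\<Sum>i<d. E a i * (inverse (\<alpha> i) ^ n * Wc lam i b k)))"
    proof (rule bd_sum)
      have C\<sigma>: "0 \<le> C * \<sigma> ^ n" by (intro mult_nonneg_nonneg zero_le_power \<sigma>0 less_imp_le[OF C(1)])
      fix b assume "b \<in> {..<d}"
      then have b: "b < d" by simp
      have "bd (rr n) (B * (C * \<sigma> ^ n)) (\<lambda>k. \<Sum>i<d. E a i * (inverse (\<alpha> i) ^ n * Wc lam i b k))"
      proof (rule bd_sum)
        fix i assume "i \<in> {..<d}"
        then have i: "i < d" by simp
        show "bd (rr n) (B * (C * \<sigma> ^ n)) (\<lambda>k. E a i * (inverse (\<alpha> i) ^ n * Wc lam i b k))"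
          by (rule bd_scale[OF T[OF i b] B[OF ac(1) i]])
      qed (rule mult_nonneg_nonneg[OF BB(1) C\<sigma>] r0)+
      then show "bd (rr n) (B' * (B * (C * \<sigma> ^ n))) (\<lambda>k. E' b c * (\<Sum>i<d. E a i * (inverse (\<alpha> i) ^ n * Wc lam i b k)))"
        by (rule bd_scale[OF _ B'[OF b ac(2)]])
    qed (intro mult_nonneg_nonneg BB zero_le_power \<sigma>0 less_imp_le[OF C(1)] r0)+
    ultimately show ?thesis by (simp only:)
  qed
  have "0 \<le> B' * (B * C)" by (intro mult_nonneg_nonneg BB less_imp_le[OF C(1)])
  moreover have "B' * (B * (C * \<sigma> ^ n)) = (B' * (B * C)) * \<sigma> ^ n" for n by (simp only: mult.assoc)
  note bound[unfolded this]
  ultimately show ?thesis unfolding \<sigma>_def[symmetric] by (intro exI[of _ "B' * (B * C)"] conjI allI impI)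
qed

text \<open>Elements of \<Lambda> are bounded on the open unit disc and commute with \<phi>, so they
  change the bounds by a constant independent of n.\<close>

lemma has_slope_gen_mod:
  assumes g: "g \<in> gen_mod nk d Zinf"
  shows "has_slope_le p nk d Phi (t (d - 1)) g sig"
proof -
  define \<sigma> where "\<sigma> = real p powr (sig + real_of_int (t (d - 1)))"
  have \<sigma>: "0 < \<sigma>" unfolding \<sigma>_def using p_pos by simp
  obtain D where D: "D \<ge> 0" "\<And>n a c. a < d \<Longrightarrow> c < d \<Longrightarrow>
    bd (rr n) (D * \<sigma> ^ n) (\<lambda>k. \<Sum>b<d. mpow d (minv d Phi) n a b * Zinf b c k)"
    using Phi_inv_Zinf_bound unfolding \<sigma>_def by blast
  obtain r :: nat and f :: "nat \<Rightarrow> 'k ser" and w :: "nat \<Rightarrow> nat \<Rightarrow> 'k"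
    where f: "\<And>i. i < r \<Longrightarrow> inLam nk (f i)"
      and geq: "\<And>a. a < d \<Longrightarrow> g a = (\<lambda>k. \<Sum>i<r. cprod (f i) (\<lambda>n. \<Sum>b<d. Zinf a b n * w i b) k)"
    using g unfolding gen_mod_def by blast
  have "\<forall>i. \<exists>L. i < r \<longrightarrow> bd 1 L (f i)" using inLam_bounded f by blast
  from choice[OF this] obtain L where L: "\<And>i. i < r \<Longrightarrow> bd 1 (L i) (f i)" by blast
  have L0: "0 \<le> L i" if "i < r" for i using bd_nonneg[OF L[OF that]] .
  define w' where "w' i = (\<Sum>c<d. nk (w i c))" for i
  have w': "nk (w i c) \<le> w' i" if "c < d" for i c unfolding w'_def by (rule member_le_sum) (use that in auto)
  have w'0: "0 \<le> w' i" for i unfolding w'_def by (simp add: sum_nonneg)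
  define B where "B = (\<Sum>i<r. L i * w' i)"
  have B: "L i * w' i \<le> B" if "i < r" for i
    unfolding B_def by (rule member_le_sum) (use that L0 w'0 in \<open>auto intro!: mult_nonneg_nonneg\<close>)
  have B0: "0 \<le> B" unfolding B_def by (rule sum_nonneg) (use L0 w'0 in \<open>auto intro!: mult_nonneg_nonneg\<close>)
  have r0: "0 \<le> rr n" for n using rr_pos[of n] by simp
  have bound: "bd (rr n) (B * (D * \<sigma> ^ n)) (sapply d (mpow d (minv d Phi) n) g a)" if a: "a < d" for n a
  proof -
    let ?P = "mpow d (minv d Phi) n"
    let ?X = "\<lambda>c k. \<Sum>b<d. ?P a b * Zinf b c k"
    have "sapply d ?P g a = (\<lambda>k. \<Sum>i<r. cprod (f i) (\<lambda>n. \<Sum>c<d. w i c * ?X c n) k)"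
    proof
      fix k
      have "sapply d ?P g a k = (\<Sum>b<d. ?P a b * (\<Sum>i<r. cprod (f i) (\<lambda>n. \<Sum>c<d. Zinf b c n * w i c) k))"
        unfolding sapply_def by (rule sum.cong[OF refl]) (simp add: geq)
      also have "\<dots> = (\<Sum>i<r. \<Sum>b<d. ?P a b * cprod (f i) (\<lambda>n. \<Sum>c<d. Zinf b c n * w i c) k)"
        unfolding sum_distrib_left by (rule sum.swap)
      also have "\<dots> = (\<Sum>i<r. cprod (f i) (\<lambda>n. \<Sum>b<d. ?P a b * (\<Sum>c<d. Zinf b c n * w i c)) k)"
        unfolding cprod_sum_right ..
      also have "\<dots> = (\<Sum>i<r. cprod (f i) (\<lambda>n. \<Sum>c<d. w i c * ?X c n) k)"
      proof -
        have "(\<Sum>b<d. ?P a b * (\<Sum>c<d. Zinf b c n * w i c)) = (\<Sum>c<d. w i c * ?X c n)" for i n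
        proof -
          have "(\<Sum>b<d. ?P a b * (\<Sum>c<d. Zinf b c n * w i c)) = (\<Sum>c<d. \<Sum>b<d. ?P a b * (Zinf b c n * w i c))"
            unfolding sum_distrib_left by (rule sum.swap)
          also have "\<dots> = (\<Sum>c<d. w i c * ?X c n)"
            unfolding sum_distrib_left by (simp only: mult_ac)
          finally show ?thesis .
        qed
        then show ?thesis by simp
      qed
      finally show "sapply d ?P g a k = (\<Sum>i<r. cprod (f i) (\<lambda>n. \<Sum>c<d. w i c * ?X c n) k)" .
    qed
    moreover have "bd (rr n) (B * (D * \<sigma> ^ n)) (\<lambda>k. \<Sum>i<r. cprod (f i) (\<lambda>n. \<Sum>c<d. w i c * ?X c n) k)"
    proof (rule bd_sum)
      fix i assume "i \<in> {..<r}"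
      then have i: "i < r" by simp
      have x: "bd (rr n) (w' i * (D * \<sigma> ^ n)) (\<lambda>n. \<Sum>c<d. w i c * ?X c n)"
      proof (rule bd_sum)
        fix c assume "c \<in> {..<d}"
        then have c: "c < d" by simp
        show "bd (rr n) (w' i * (D * \<sigma> ^ n)) (\<lambda>n. w i c * ?X c n)"
          by (rule bd_scale[OF D(2)[OF a c] w'[OF c]])
      qed (intro mult_nonneg_nonneg w'0 D(1) zero_le_power less_imp_le[OF \<sigma>] r0)+
      have y: "bd (rr n) (L i) (f i)" using bd_radius[OF L[OF i]] r0 rr_lt1[of n] by simp
      have "bd (rr n) (L i * (w' i * (D * \<sigma> ^ n))) (cprod (f i) (\<lambda>n. \<Sum>c<d. w i c * ?X c n))"
        by (rule bd_cprod[OF y x r0])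
      moreover have "L i * (w' i * (D * \<sigma> ^ n)) \<le> B * (D * \<sigma> ^ n)"
        unfolding mult.assoc[symmetric, of "L i" "w' i"]
        by (intro mult_right_mono B i mult_nonneg_nonneg D(1) zero_le_power less_imp_le[OF \<sigma>])
      ultimately show "bd (rr n) (B * (D * \<sigma> ^ n)) (\<lambda>k. cprod (f i) (\<lambda>n. \<Sum>c<d. w i c * ?X c n) k)"
        by (rule bd_mono)
    qed (intro mult_nonneg_nonneg B0 D(1) zero_le_power less_imp_le[OF \<sigma>] r0)+
    ultimately show ?thesis by simp
  qed
  have "(SUP n. ereal (real p powr (- (sig + real_of_int (t (d - 1))) * real n)) *
        vnorm nk d ((1 / real p) powr (1 / real p ^ n)) (sapply d (mpow d (minv d Phi) n) g)) \<le> ereal (B * D)"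
  proof (rule SUP_least)
    fix n
    have "vnorm nk d (rr n) (sapply d (mpow d (minv d Phi) n) g) \<le> ereal (B * (D * \<sigma> ^ n))"
      unfolding vnorm_def by (subst Max_le_iff) (use d bound gnorm_le_iff in \<open>auto simp: lessThan_empty_iff\<close>)
    then have "ereal (real p powr (- (sig + real_of_int (t (d - 1))) * real n)) *
        vnorm nk d (rr n) (sapply d (mpow d (minv d Phi) n) g)
      \<le> ereal (real p powr (- (sig + real_of_int (t (d - 1))) * real n)) * ereal (B * (D * \<sigma> ^ n))"
      by (rule ereal_mult_left_mono) simp
    also have "\<dots> = ereal (B * D)"
    proof -
      have "\<sigma> ^ n = real p powr ((sig + real_of_int (t (d - 1))) * real n)"
        unfolding \<sigma>_def using p_pos by (simp add: powr_powr flip: powr_realpow)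
      then have "real p powr (- (sig + real_of_int (t (d - 1))) * real n) * \<sigma> ^ n = 1"
        unfolding mult_minus_left powr_minus using p_pos by simp
      then have "real p powr (- (sig + real_of_int (t (d - 1))) * real n) * (B * (D * \<sigma> ^ n)) = B * D"
        by (metis mult.assoc mult.commute mult_1)
      then show ?thesis by simp
    qed
    finally show "ereal (real p powr (- (sig + real_of_int (t (d - 1))) * real n)) *
        vnorm nk d ((1 / real p) powr (1 / real p ^ n)) (sapply d (mpow d (minv d Phi) n) g) \<le> ereal (B * D)"
      unfolding rr_def .
  qed
  \<comment> \<open>The witness for \<rho> is 1/p, whose radii in the definition of slope are the
    \<open>rr n\<close>.\<close>
  then show ?thesis unfolding has_slope_le_def
    using inv_p(1,2) by (intro exI[of _ "1 / real p"] conjI) (auto intro: le_less_trans)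
qed

lemma slope_mod_le: "slope_mod p nk d Phi (t (d - 1)) (gen_mod nk d Zinf) \<le> ereal sig"
  unfolding slope_mod_def slope_el_def
  by (intro SUP_least Inf_lower imageI CollectI has_slope_gen_mod)

end

text \<open>As h \<ge> 1 and p \<ge> 3 the subtractions of natural numbers are exact, and integer
  division is the floor of the real quotient.\<close>

lemma (in refinement_datum) sig_floor:
  "sig = real_of_int \<lfloor>(real h - 1) / (real p - 1)\<rfloor> + Max {ordp p nk (\<alpha> k) - real_of_int (t i) | i k. i \<le> k \<and> k < d}"
proof -
  have "(real h - 1) / (real p - 1) = real (h - 1) / real (p - 1)"
    using h_ge1 p_ge3 by (simp add: of_nat_diff)
  then show ?thesis unfolding sig_def by (simp only: floor_divide_of_nat_eq of_int_of_nat_eq)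
qed

theorem mainTheorem12:
  fixes nk :: "'k::field_char_0 \<Rightarrow> real" and p :: nat and u :: 'k
    and N d :: nat and jl jr :: int and \<alpha> :: "nat \<Rightarrow> 'k" and t :: "nat \<Rightarrow> int"
  assumes Qp: "is_Qp p nk" and pprime: "prime p" and podd: "odd p"
    and u: "top_gen p nk u"
    and d: "d \<ge> 1"
    and tmono: "\<forall>i j. i < j \<and> j < d \<longrightarrow> t i < t j"
    and J: "{t 0<..t (d - 1)} \<subseteq> {jl..jr}"
    and Jbig: "\<forall>i j. i \<le> j \<and> j < d \<longrightarrow> real (card {jl..jr}) > ordp p nk (\<alpha> j / \<alpha> i)"
  shows "\<exists>c :: nat \<Rightarrow> nat \<Rightarrow> (nat \<times> nat \<Rightarrow> nat) \<Rightarrow> 'k ser.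
     (\<forall>a b m. inH nk (c a b m)) \<and>
     (\<forall>(Phi :: nat \<Rightarrow> nat \<Rightarrow> 'k) Fil F v e lam.
        minvertible d Phi \<and> filtration d Fil \<and> distinct_HT_weights d Fil t \<and>
        refinement d Phi Fil t F \<and>
        is_basis d v \<and> (\<forall>i<d. v i \<in> Fil (t i)) \<and> (\<forall>i\<in>{1..d}. F i = spanv v i) \<and>
        is_basis d e \<and> (\<forall>i<d. mapply d Phi (e i) = (\<lambda>a. \<alpha> i * e i a)) \<and>
        (\<forall>i\<in>{1..d}. F i = spanv e i) \<and>
        (\<forall>j<d. v j = (\<lambda>a. \<Sum>i<d. lam i j * e i a)) \<and>
        (\<forall>i<d. lam i i = 1) \<and> (\<forall>i j. j < i \<and> i < d \<longrightarrow> lam i j = 0)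
      \<longrightarrow> (\<exists>Zinf :: nat \<Rightarrow> nat \<Rightarrow> 'k ser.
            (\<forall>a<d. \<forall>b<d. inH nk (Zinf a b)) \<and>
            (\<forall>\<rho>. 0 < \<rho> \<and> \<rho> < 1 \<longrightarrow> (\<forall>a<d. \<forall>b<d.
               (\<lambda>m. gnorm nk \<rho> (\<lambda>n. coeff (Zs p u d {jl..jr} t Phi v N m a b) n - Zinf a b n))
                 \<longlonglongrightarrow> 0)) \<and>
            (\<forall>a<d. \<forall>b<d.
               (\<lambda>n. \<Sum>k<d. \<Sum>l<d. minv d (\<lambda>x y. e y x) a k * Zinf k l n * e b l) =
               (\<lambda>n. \<Sum>m\<in>monoms d (d - 1). mono_eval d lam m * c a b m n)) \<and>
            slope_mod p nk d Phi (t (d - 1)) (gen_mod nk d Zinf) \<le>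
              ereal (real_of_int \<lfloor>(real (card {jl..jr}) - 1) / (real p - 1)\<rfloor> +
                     Max {ordp p nk (\<alpha> k) - real_of_int (t i) | i k. i \<le> k \<and> k < d})))"
    (is "\<exists>c. ?inH c \<and> (\<forall>Phi Fil F v e lam. ?hyp Phi Fil F v e lam \<longrightarrow> ?concl c Phi v e lam)")
proof (cases "\<forall>i<d. \<alpha> i \<noteq> 0")
  \<comment> \<open>With a vanishing \<alpha> i no module satisfies the assumptions, and zero
    coefficients serve as witness.\<close>
  case False
  then obtain i where i: "i < d" "\<alpha> i = 0" by blast
  have no: "\<not> ?hyp Phi Fil F v e lam" for Phi Fil F v e lam
  proof
    assume hyp: "?hyp Phi Fil F v e lam"
    then have "minvertible d Phi" "is_basis d e" "mapply d Phi (e i) = (\<lambda>a. \<alpha> i * e i a)"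
      using i(1) by blast+
    then have "\<alpha> i \<noteq> 0" using i(1) by (rule eigenvalue_nonzero[where \<alpha> = \<alpha>])
    then show False using i(2) by contradiction
  qed
  have "nk 0 = 0" using Qp unfolding is_Qp_def by blast
  then have inH: "?inH (\<lambda>_ _ _ _. 0)" unfolding inH_def by simp
  show ?thesis
    by (rule exI[of _ "\<lambda>_ _ _ _. 0"], rule conjI[OF inH], intro allI impI, rule notE[OF no])
next
  case True
  interpret refinement_datum p nk u N d jl jr \<alpha> t
    by unfold_locales (use assms True in blast)+
  \<comment> \<open>The coefficients are fixed before a module is chosen, in the order of the
    quantifiers of the statement.\<close>
  have inH: "?inH ccoef" using inH_ccoef by blast
  have concl: "?concl ccoef Phi v e lam" if hyp: "?hyp Phi Fil F v e lam" for Phi Fil F v e lam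
  proof -
    interpret M: refined_module p nk u N d jl jr \<alpha> t Phi v e lam
      by unfold_locales (use hyp in \<open>(unfold unipotent_def)?, blast\<close>)+
    have 1: "\<forall>a<d. \<forall>b<d. inH nk (M.Zinf a b)" using M.inH_Zinf by blast
    have 2: "(\<lambda>m. gnorm nk \<rho> (\<lambda>n. coeff (Zs p u d {jl..jr} t Phi v N m a b) n - M.Zinf a b n)) \<longlonglongrightarrow> 0"
      if "0 < \<rho> \<and> \<rho> < 1" "a < d" "b < d" for \<rho> a b
      unfolding gnorm_tendsto_0_iff using plimD[OF M.Zs_limit[OF that(2,3)]] that(1) by blast
    have 3: "(\<lambda>n. \<Sum>k<d. \<Sum>l<d. minv d (\<lambda>x y. e y x) a k * M.Zinf k l n * e b l) =
               (\<lambda>n. \<Sum>m\<in>monoms d (d - 1). mono_eval d lam m * ccoef a b m n)" if "a < d" "b < d" for a b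
      using M.Zinf_in_eigenbasis[OF that] unfolding M.E'_def M.E_def Wc_def by (intro ext)
    show ?thesis
      by (intro exI[of _ M.Zinf] conjI 1 allI impI 2 3 M.slope_mod_le[unfolded sig_floor]) simp_all
  qed
  show ?thesis
    by (rule exI[of _ ccoef], rule conjI[OF inH], intro allI impI, rule concl)
qed

end
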